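(* Let $\mathcal{L}_1$ and $\mathcal{L}_2$ be multiplicity free commutative subspace lattices on Hilbert spaces $\mathcal{H}_1$ and $\mathcal{H}_2$ respectively, and let $\mathcal{B}_1,\mathcal{B}_2\subset B(\mathcal{K})$ be operator algebras that contain the compact operators $K(\mathcal{K})$. If $\operatorname{Alg}(\mathcal{L}_1)\otimes\mathcal{B}_1$ and $\operatorname{Alg}(\mathcal{L}_2)\otimes\mathcal{B}_2$ are isometrically isomorphic, then $\operatorname{Alg}(\mathcal{L}_1)$ and $\operatorname{Alg}(\mathcal{L}_2)$ are unitarily equivalent, i.e. there is a unitary $V:\mathcal{H}_2\to\mathcal{H}_1$ with $\operatorname{Alg}(\mathcal{L}_2)=V^*\operatorname{Alg}(\mathcal{L}_1)V$.
   Context: $\mathcal{K}$ is a fixed nonzero separable Hilbert space (for instance $\ell^2(\mathbb{N})$). An operator algebra is a norm-closed subalgebra of some $B(\mathcal{H})$ (with its operator space structure). The diagonal of an operator algebra $\mathcal{A}\subset B(\mathcal{H})$ is the C$^*$-algebra $\mathrm{d}(\mathcal{A})=\mathcal{A}\cap\mathcal{A}^*$. Standing assumption: every operator algebra contains, in its diagonal, a contractive approximate identity for the algebra. The symbol $\otimes$ between operator algebras denotes the minimal (spatial, norm-closed) tensor product, $\mathcal{A}\otimes\mathcal{B}\subset B(\mathcal{H}\otimes\mathcal{K})$ for $\mathcal{A}\subset B(\mathcal{H})$, $\mathcal{B}\subset B(\mathcal{K})$. "Isometrically isomorphic" means that there is a surjective isometric algebra homomorphism. A subspace lattice on $\mathcal{H}$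 is a strongly closed collection of (orthogonal) projections in $B(\mathcal{H})$, closed under $\wedge$ and $\vee$, containing $0$ and $I$. A commutative subspace lattice (CSL) is a subspace lattice whose projections commute pairwise. For a subspace lattice $\mathcal{L}\subset B(\mathcal{H})$, $\operatorname{Alg}(\mathcal{L})$ is the algebra of all $T\in B(\mathcal{H})$ with $(I-P)TP=0$ for all $P\in\mathcal{L}$. A CSL $\mathcal{L}$ is multiplicity free if the von Neumann algebra $\mathcal{L}''$ generated by $\mathcal{L}$ is a maximal abelian self-adjoint subalgebra of $B(\mathcal{H})$ (equivalently, the diagonal $\mathcal{L}'$ of $\operatorname{Alg}(\mathcal{L})$ is commutative). *)

theory Defs
  imports "HOL-Analysis.Analysis"
begin

class scaleC =
  fixes scaleC :: "complex \<Rightarrow> 'a \<Rightarrow> 'a"  (infixr \<open>*\<^sub>C\<close> 75)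

text \<open>
  Complex inner product spaces, \<open>cinner\<close> being conjugate-linear in its first argument. They extend
  \<^class>\<open>real_inner\<close>, so that norm and topology are the library's:
  \<open>norm x = sqrt (inner x x)\<close>, where \<open>inner\<close> is the real part of \<open>cinner\<close>.
\<close>
class complex_inner = real_inner + scaleC +
  fixes cinner :: "'a \<Rightarrow> 'a \<Rightarrow> complex"
  assumes scaleC_add_right: "c *\<^sub>C (x + y) = c *\<^sub>C x + c *\<^sub>C y"
    and scaleC_add_left: "(c + d) *\<^sub>C x = c *\<^sub>C x + d *\<^sub>C x"
    and scaleC_scaleC: "c *\<^sub>C d *\<^sub>C x = (c * d) *\<^sub>C x"
    and scaleR_scaleC: "r *\<^sub>R x = complex_of_real r *\<^sub>C x"
    and cinner_commute: "cinner x y = cnj (cinner y x)"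
    and cinner_add_right: "cinner x (y + z) = cinner x y + cinner x z"
    and cinner_scaleC_right: "cinner x (c *\<^sub>C y) = c * cinner x y"
    and inner_cinner: "inner x y = Re (cinner x y)"

class chilbert_space = complex_inner + banach

lemma cinner_add_left: "cinner (x + y) z = cinner x z + cinner y z"
  by (metis cinner_add_right cinner_commute complex_cnj_add)

lemma cinner_scaleC_left: "cinner (c *\<^sub>C x) y = cnj c * cinner x y"
  by (metis cinner_scaleC_right cinner_commute complex_cnj_mult)

lemma scaleC_one [simp]: "1 *\<^sub>C x = x" for x :: "'a::complex_inner"
  using scaleR_scaleC[of 1 x] by simp

lemma scaleC_zero_left [simp]: "0 *\<^sub>C x = 0" for x :: "'a::complex_inner"
  using scaleR_scaleC[of 0 x] by simp

lemma scaleC_zero_right [simp]: "c *\<^sub>C 0 = (0 :: 'a::complex_inner)"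
  using scaleC_add_right[of c "0::'a" 0] by simp

lemma scaleC_minus_one: "(- 1) *\<^sub>C x = - x" for x :: "'a::complex_inner"
  using scaleR_scaleC[of "-1" x] by simp

lemma scaleC_minus_right: "c *\<^sub>C (- x) = - (c *\<^sub>C x)" for x :: "'a::complex_inner"
  using scaleC_add_right[of c x "- x"] by (simp add: eq_neg_iff_add_eq_0 add.commute)

lemma scaleC_diff_right: "c *\<^sub>C (x - y) = c *\<^sub>C x - c *\<^sub>C y" for x :: "'a::complex_inner"
  using scaleC_add_right[of c x "- y"] by (simp add: scaleC_minus_right)

lemma cinner_zero_left [simp]: "cinner 0 x = 0"
  using cinner_add_left[of 0 0 x] by simp

lemma cinner_zero_right [simp]: "cinner x 0 = 0"
  using cinner_add_right[of x 0 0] by simp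

lemma cinner_minus_right [simp]: "cinner x (- y) = - cinner x y"
  using cinner_add_right[of x y "- y"] by (simp add: eq_neg_iff_add_eq_0 add.commute)

lemma cinner_minus_left [simp]: "cinner (- x) y = - cinner x y"
  using cinner_add_left[of x "- x" y] by (simp add: eq_neg_iff_add_eq_0 add.commute)

lemma cinner_diff_right: "cinner x (y - z) = cinner x y - cinner x z"
  using cinner_add_right[of x y "- z"] by simp

lemma cinner_diff_left: "cinner (x - y) z = cinner x z - cinner y z"
  using cinner_add_left[of x "- y" z] by simp

lemma cinner_scaleR_left: "cinner (r *\<^sub>R x) y = complex_of_real r * cinner x y"
  by (simp add: scaleR_scaleC cinner_scaleC_left)

lemma cinner_scaleR_right: "cinner x (r *\<^sub>R y) = complex_of_real r * cinner x y"
  by (simp add: scaleR_scaleC cinner_scaleC_right)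

lemma cinner_sum_right: "cinner x (\<Sum>i\<in>A. f i) = (\<Sum>i\<in>A. cinner x (f i))"
  by (induction A rule: infinite_finite_induct) (simp_all add: cinner_add_right)

lemma cinner_sum_left: "cinner (\<Sum>i\<in>A. f i) x = (\<Sum>i\<in>A. cinner (f i) x)"
  by (induction A rule: infinite_finite_induct) (simp_all add: cinner_add_left)

lemma scaleC_sum_right: "c *\<^sub>C (\<Sum>i\<in>A. f i) = (\<Sum>i\<in>A. c *\<^sub>C f i)" for f :: "_ \<Rightarrow> 'a::complex_inner"
  by (induction A rule: infinite_finite_induct) (simp_all add: scaleC_add_right)

lemma cinner_self: "cinner x x = complex_of_real (inner x x)"
proof -
  have "Im (cinner x x) = 0"
    using cinner_commute[of x x] by (metis cnj.simps(2) equal_neg_zero)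
  then show ?thesis
    by (simp add: complex_eq_iff inner_cinner)
qed

lemma cinner_eq_zero_iff: "cinner x x = 0 \<longleftrightarrow> x = 0"
  by (simp add: cinner_self)

lemma cinner_self_norm: "cinner x x = complex_of_real ((norm x)\<^sup>2)"
  by (simp add: cinner_self power2_norm_eq_inner)

lemma norm_scaleC: "norm (c *\<^sub>C x) = cmod c * norm x" for x :: "'a::complex_inner"
proof -
  have "complex_of_real ((norm (c *\<^sub>C x))\<^sup>2) = (c * cnj c) * complex_of_real ((norm x)\<^sup>2)"
    unfolding cinner_self_norm[symmetric]
    by (simp only: cinner_scaleC_left cinner_scaleC_right mult_ac)
  also have "\<dots> = complex_of_real ((cmod c * norm x)\<^sup>2)"
    unfolding complex_norm_square[symmetric] by (simp only: power_mult_distrib of_real_mult)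
  finally have "(norm (c *\<^sub>C x))\<^sup>2 = (cmod c * norm x)\<^sup>2"
    using of_real_eq_iff by blast
  then show ?thesis
    by (simp add: power2_eq_iff_nonneg)
qed

lemma norm_cinner_le: "cmod (cinner x y) \<le> norm x * norm y" for x :: "'a::complex_inner"
proof (cases "cinner x y = 0")
  case False
  define u where "u = cnj (cinner x y) / cmod (cinner x y)"
  have u: "cmod u = 1" "u * cinner x y = cmod (cinner x y)"
    using False by (auto simp: u_def norm_divide mult.commute complex_norm_square[symmetric] power2_eq_square)
  have "cmod (cinner x y) = Re (cinner x (u *\<^sub>C y))"
    by (simp add: cinner_scaleC_right u)
  also have "\<dots> \<le> norm x * norm (u *\<^sub>C y)"
    unfolding inner_cinner[symmetric] by (rule norm_cauchy_schwarz)
  finally show ?thesis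
    by (simp add: norm_scaleC u)
qed simp

lemma bounded_bilinear_cinner: "bounded_bilinear (cinner :: 'a::complex_inner \<Rightarrow> _)"
  by (unfold_locales; (intro exI[of _ 1])?)
     (auto simp: cinner_add_left cinner_add_right cinner_scaleR_left cinner_scaleR_right
        scaleR_conv_of_real norm_cinner_le)

lemmas tendsto_cinner = bounded_bilinear.tendsto[OF bounded_bilinear_cinner]

lemma bounded_linear_scaleC: "bounded_linear (scaleC c :: 'a::complex_inner \<Rightarrow> 'a)"
  by (rule bounded_linear_intro[of _ "cmod c"])
     (auto simp: scaleC_add_right norm_scaleC scaleR_scaleC scaleC_scaleC mult.commute)

lemma cinner_ext:
  assumes "\<And>z. cinner z x = cinner z y"
  shows "x = y"
proof -
  have "cinner (x - y) (x - y) = 0"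
    by (simp add: cinner_diff_right assms)
  then show ?thesis
    by (simp only: cinner_eq_zero_iff right_minus_eq)
qed

definition orthonormal :: "'a::complex_inner set \<Rightarrow> bool"
  where "orthonormal E \<longleftrightarrow> (\<forall>e\<in>E. \<forall>f\<in>E. cinner e f = (if e = f then 1 else 0))"

lemma finite_orthonormal_expansion:
  fixes X :: "'a::complex_inner set"
  assumes "finite X"
  shows "\<exists>E. finite E \<and> orthonormal E \<and> (\<forall>x\<in>X. x = (\<Sum>e\<in>E. cinner e x *\<^sub>C e))"
  using assms
proof induction
  case empty
  show ?case by (rule exI[of _ "{}"]) (simp add: orthonormal_def)
next
  case (insert x X)
  then obtain E where E: "finite E" "orthonormal E" "\<And>y. y \<in> X \<Longrightarrow> y = (\<Sum>e\<in>E. cinner e y *\<^sub>C e)"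
    by blast
  define r where "r = x - (\<Sum>e\<in>E. cinner e x *\<^sub>C e)"
  have re: "cinner e r = 0" if "e \<in> E" for e
  proof -
    have "(\<Sum>f\<in>E. cinner f x * cinner e f) = (\<Sum>f\<in>E. if f = e then cinner e x else 0)"
      using E(2) that by (intro sum.cong) (auto simp: orthonormal_def)
    then show ?thesis
      using E(1) that by (simp add: r_def cinner_diff_right cinner_sum_right cinner_scaleC_right)
  qed
  show ?case
  proof (cases "r = 0")
    case True
    then have "x = (\<Sum>e\<in>E. cinner e x *\<^sub>C e)"
      by (simp add: r_def)
    then show ?thesis
      using E by (intro exI[of _ E]) blast
  next
    case False
    define g where "g = (1 / norm r) *\<^sub>R r"
    have gg: "cinner g g = 1"
      using False by (simp add: cinner_self_norm g_def)
    have eg: "cinner e g = 0" if "e \<in> E" for e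
      using re[OF that] by (simp add: g_def cinner_scaleR_right)
    have ge: "cinner g e = 0" if "e \<in> E" for e
      using eg[OF that] cinner_commute[of g e] by simp
    have gE: "g \<notin> E"
      using gg eg by force
    have "finite (insert g E)" "orthonormal (insert g E)"
      using E gg eg ge gE by (auto simp: orthonormal_def)
    moreover have "y = (\<Sum>e\<in>insert g E. cinner e y *\<^sub>C e)" if "y \<in> X" for y
    proof -
      have "cinner g y = cinner g (\<Sum>e\<in>E. cinner e y *\<^sub>C e)"
        using E(3)[OF that] by simp
      also have "\<dots> = 0"
        by (simp add: cinner_sum_right cinner_scaleC_right ge)
      finally show ?thesis
        using E(3)[OF that] E(1) gE by simp
    qed
    moreover have "x = (\<Sum>e\<in>insert g E. cinner e x *\<^sub>C e)"
    proof -
      have rg: "r = norm r *\<^sub>R g"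
        using False by (simp add: g_def)
      have x: "x = r + (\<Sum>e\<in>E. cinner e x *\<^sub>C e)"
        by (simp add: r_def)
      have "cinner g x = cinner g (r + (\<Sum>e\<in>E. cinner e x *\<^sub>C e))"
        using x by simp
      also have "\<dots> = norm r"
        by (subst rg) (simp add: cinner_add_right cinner_sum_right cinner_scaleC_right
            cinner_scaleR_right ge gg)
      finally have "cinner g x *\<^sub>C g = r"
        using rg by (simp add: scaleR_scaleC)
      then show ?thesis
        using E(1) gE x by simp
    qed
    ultimately show ?thesis
      by blast
  qed
qed

lemma Cauchy_const [simp]: "Cauchy (\<lambda>_. a)" for a :: "'a::metric_space"
  by (rule LIMSEQ_imp_Cauchy) (rule tendsto_const)

text \<open>
  The completion of an inner product space: Cauchy sequences modulo null sequences.
\<close>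
definition cauchy_rel :: "(nat \<Rightarrow> 'a::real_normed_vector) \<Rightarrow> (nat \<Rightarrow> 'a) \<Rightarrow> bool"
  where "cauchy_rel X Y \<longleftrightarrow> Cauchy X \<and> Cauchy Y \<and> (\<lambda>n. X n - Y n) \<longlonglongrightarrow> 0"

lemma part_equivp_cauchy_rel: "part_equivp (cauchy_rel :: (nat \<Rightarrow> 'a::real_normed_vector) \<Rightarrow> _)"
proof (rule part_equivpI)
  show "\<exists>X :: nat \<Rightarrow> 'a. cauchy_rel X X"
    by (rule exI[of _ "\<lambda>_. 0"]) (simp add: cauchy_rel_def)
  show "symp (cauchy_rel :: (nat \<Rightarrow> 'a) \<Rightarrow> _)"
    by (rule sympI) (auto simp: cauchy_rel_def dest: tendsto_minus)
  show "transp (cauchy_rel :: (nat \<Rightarrow> 'a) \<Rightarrow> _)"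
  proof (rule transpI)
    fix X Y Z :: "nat \<Rightarrow> 'a"
    assume "cauchy_rel X Y" "cauchy_rel Y Z"
    then show "cauchy_rel X Z"
      using tendsto_add[of "\<lambda>n. X n - Y n" 0 sequentially "\<lambda>n. Y n - Z n" 0]
      by (simp add: cauchy_rel_def)
  qed
qed

quotient_type (overloaded) 'a completion = "nat \<Rightarrow> 'a::real_normed_vector" / partial: cauchy_rel
  by (rule part_equivp_cauchy_rel)

lemma Cauchy_add': "Cauchy X \<Longrightarrow> Cauchy Y \<Longrightarrow> Cauchy (\<lambda>n. X n + Y n)"
  for X :: "nat \<Rightarrow> 'a::real_normed_vector"
  unfolding Cauchy_def dist_norm
proof (intro allI impI)
  fix e :: real
  assume X: "\<forall>e>0. \<exists>M. \<forall>m\<ge>M. \<forall>n\<ge>M. norm (X m - X n) < e"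
    and Y: "\<forall>e>0. \<exists>M. \<forall>m\<ge>M. \<forall>n\<ge>M. norm (Y m - Y n) < e" and "e > 0"
  then obtain M N where M: "\<And>m n. m \<ge> M \<Longrightarrow> n \<ge> M \<Longrightarrow> norm (X m - X n) < e / 2"
    and N: "\<And>m n. m \<ge> N \<Longrightarrow> n \<ge> N \<Longrightarrow> norm (Y m - Y n) < e / 2"
    by (meson half_gt_zero)
  show "\<exists>M. \<forall>m\<ge>M. \<forall>n\<ge>M. norm (X m + Y m - (X n + Y n)) < e"
  proof (intro exI[of _ "max M N"] allI impI)
    fix m n assume "m \<ge> max M N" "n \<ge> max M N"
    then show "norm (X m + Y m - (X n + Y n)) < e"
      using M[of m n] N[of m n] norm_triangle_ineq[of "X m - X n" "Y m - Y n"]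
      by (simp add: algebra_simps)
  qed
qed

lemma Cauchy_cinner:
  fixes X Y :: "nat \<Rightarrow> 'a::complex_inner"
  assumes "Cauchy X" "Cauchy Y"
  shows "Cauchy (\<lambda>n. cinner (X n) (Y n))"
proof -
  obtain A where A: "A > 0" "\<And>n. norm (X n) \<le> A"
    using Cauchy_Bseq[OF assms(1)] by (auto simp: Bseq_def)
  obtain B where B: "B > 0" "\<And>n. norm (Y n) \<le> B"
    using Cauchy_Bseq[OF assms(2)] by (auto simp: Bseq_def)
  show ?thesis
    unfolding Cauchy_def dist_norm
  proof (intro allI impI)
    fix e :: real assume e: "e > 0"
    obtain M where M: "\<And>m n. m \<ge> M \<Longrightarrow> n \<ge> M \<Longrightarrow> norm (X m - X n) < e / (2 * B)"
      using assms(1) e B(1) unfolding Cauchy_def dist_norm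
      by (meson divide_pos_pos mult_pos_pos zero_less_numeral)
    obtain N where N: "\<And>m n. m \<ge> N \<Longrightarrow> n \<ge> N \<Longrightarrow> norm (Y m - Y n) < e / (2 * A)"
      using assms(2) e A(1) unfolding Cauchy_def dist_norm
      by (meson divide_pos_pos mult_pos_pos zero_less_numeral)
    show "\<exists>M. \<forall>m\<ge>M. \<forall>n\<ge>M. cmod (cinner (X m) (Y m) - cinner (X n) (Y n)) < e"
    proof (intro exI[of _ "max M N"] allI impI)
      fix m n assume mn: "m \<ge> max M N" "n \<ge> max M N"
      have "cinner (X m) (Y m) - cinner (X n) (Y n)
          = cinner (X m - X n) (Y m) + cinner (X n) (Y m - Y n)"
        by (simp add: cinner_diff_left cinner_diff_right)
      then have "cmod (cinner (X m) (Y m) - cinner (X n) (Y n))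
          \<le> norm (X m - X n) * norm (Y m) + norm (X n) * norm (Y m - Y n)"
        by (simp add: norm_triangle_mono norm_cinner_le)
      also have "\<dots> \<le> norm (X m - X n) * B + A * norm (Y m - Y n)"
        by (intro add_mono mult_left_mono mult_right_mono A B norm_ge_zero)
      also have "\<dots> < e / (2 * B) * B + A * (e / (2 * A))"
        using M[of m n] N[of m n] mn A(1) B(1)
        by (intro add_strict_mono mult_strict_right_mono mult_strict_left_mono) auto
      also have "\<dots> = e"
        using A(1) B(1) by simp
      finally show "cmod (cinner (X m) (Y m) - cinner (X n) (Y n)) < e" .
    qed
  qed
qed

lemma cauchy_rel_cinner:
  fixes X Y :: "nat \<Rightarrow> 'a::complex_inner"
  assumes "cauchy_rel X X'" "cauchy_rel Y Y'"
  shows "lim (\<lambda>n. cinner (X n) (Y n)) = lim (\<lambda>n. cinner (X' n) (Y' n))"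
proof -
  have c: "Cauchy X" "Cauchy X'" "Cauchy Y" "Cauchy Y'"
    and d: "(\<lambda>n. X n - X' n) \<longlonglongrightarrow> 0" "(\<lambda>n. Y n - Y' n) \<longlonglongrightarrow> 0"
    using assms by (auto simp: cauchy_rel_def)
  let ?l = "lim (\<lambda>n. cinner (X' n) (Y' n))"
  have l: "(\<lambda>n. cinner (X' n) (Y' n)) \<longlonglongrightarrow> ?l"
    using Cauchy_cinner[OF c(2,4)] by (simp add: Cauchy_convergent_iff convergent_LIMSEQ_iff)
  have "Bfun Y sequentially" "Bfun X' sequentially"
    using Cauchy_Bseq c by auto
  then have "(\<lambda>n. cinner (X n - X' n) (Y n)) \<longlonglongrightarrow> 0" "(\<lambda>n. cinner (X' n) (Y n - Y' n)) \<longlonglongrightarrow> 0"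
    using bounded_bilinear.Zfun_prod_Bfun[OF bounded_bilinear_cinner, of "\<lambda>n. X n - X' n" sequentially Y]
      bounded_bilinear.Bfun_prod_Zfun[OF bounded_bilinear_cinner, of X' sequentially "\<lambda>n. Y n - Y' n"] d
    by (auto simp: tendsto_Zfun_iff)
  then have "(\<lambda>n. cinner (X n - X' n) (Y n) + cinner (X' n) (Y n - Y' n) + cinner (X' n) (Y' n)) \<longlonglongrightarrow> 0 + 0 + ?l"
    by (intro tendsto_add l)
  then have "(\<lambda>n. cinner (X n) (Y n)) \<longlonglongrightarrow> ?l"
    by (simp add: cinner_diff_left cinner_diff_right)
  then show ?thesis
    by (rule limI)
qed

lemma tendsto_lim_cinner:
  fixes X Y :: "nat \<Rightarrow> 'a::complex_inner"
  assumes "cauchy_rel X X" "cauchy_rel Y Y"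
  shows "(\<lambda>n. cinner (X n) (Y n)) \<longlonglongrightarrow> lim (\<lambda>n. cinner (X n) (Y n))"
  using Cauchy_cinner[of X Y] assms
  by (simp add: cauchy_rel_def Cauchy_convergent_iff convergent_LIMSEQ_iff)

lemma Cauchy_scaleC: "Cauchy X \<Longrightarrow> Cauchy (\<lambda>n. c *\<^sub>C X n)" for X :: "nat \<Rightarrow> 'a::complex_inner"
  by (rule bounded_linear.Cauchy[OF bounded_linear_scaleC])

lemma Cauchy_minus: "Cauchy X \<Longrightarrow> Cauchy (\<lambda>n. - X n)" for X :: "nat \<Rightarrow> 'a::real_normed_vector"
  by (rule bounded_linear.Cauchy[OF bounded_linear_minus[OF bounded_linear_ident]])

instantiation completion :: (complex_inner) complex_inner
begin

lift_definition zero_completion :: "'a completion" is "\<lambda>_. 0"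
  by (simp add: cauchy_rel_def)

lift_definition plus_completion :: "'a completion \<Rightarrow> 'a completion \<Rightarrow> 'a completion"
  is "\<lambda>X Y n. X n + Y n"
  unfolding cauchy_rel_def by (auto simp: Cauchy_add' add_diff_add intro: tendsto_add_zero)

lift_definition uminus_completion :: "'a completion \<Rightarrow> 'a completion"
  is "\<lambda>X n. - X n"
proof -
  fix X Y :: "nat \<Rightarrow> 'a"
  assume "cauchy_rel X Y"
  then show "cauchy_rel (\<lambda>n. - X n) (\<lambda>n. - Y n)"
    using tendsto_minus[of "\<lambda>n. X n - Y n" 0 sequentially]
    by (simp add: cauchy_rel_def Cauchy_minus algebra_simps)
qed

definition minus_completion :: "'a completion \<Rightarrow> 'a completion \<Rightarrow> 'a completion"
  where "minus_completion x y = x + - y"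

lift_definition scaleC_completion :: "complex \<Rightarrow> 'a completion \<Rightarrow> 'a completion"
  is "\<lambda>c X n. c *\<^sub>C X n"
  unfolding cauchy_rel_def
  by (auto simp: Cauchy_scaleC scaleC_diff_right[symmetric]
      intro: bounded_linear.tendsto_zero[OF bounded_linear_scaleC])

definition scaleR_completion :: "real \<Rightarrow> 'a completion \<Rightarrow> 'a completion"
  where "scaleR_completion r x = complex_of_real r *\<^sub>C x"

lift_definition cinner_completion :: "'a completion \<Rightarrow> 'a completion \<Rightarrow> complex"
  is "\<lambda>X Y. lim (\<lambda>n. cinner (X n) (Y n))"
  by (rule cauchy_rel_cinner)

definition inner_completion :: "'a completion \<Rightarrow> 'a completion \<Rightarrow> real"
  where "inner_completion x y = Re (cinner x y)"

definition norm_completion :: "'a completion \<Rightarrow> real"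
  where "norm_completion x = sqrt (inner x x)"

definition dist_completion :: "'a completion \<Rightarrow> 'a completion \<Rightarrow> real"
  where "dist_completion x y = norm (x - y)"

definition sgn_completion :: "'a completion \<Rightarrow> 'a completion"
  where "sgn_completion x = scaleR (inverse (norm x)) x"

definition uniformity_completion :: "('a completion \<times> 'a completion) filter"
  where "uniformity_completion = (INF e\<in>{0<..}. principal {(x, y). dist x y < e})"

definition open_completion :: "'a completion set \<Rightarrow> bool"
  where "open_completion U \<longleftrightarrow> (\<forall>x\<in>U. \<forall>\<^sub>F (x', y) in uniformity. x' = x \<longrightarrow> y \<in> U)"

instance
proof
  fix x y z :: "'a completion" and c d :: complex and r s :: real
  show cS: "c *\<^sub>C (x + y) = c *\<^sub>C x + c *\<^sub>C y" for c and x y :: "'a completion"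
    by transfer (simp add: cauchy_rel_def scaleC_add_right Cauchy_add' Cauchy_scaleC)
  show cA: "(c + d) *\<^sub>C x = c *\<^sub>C x + d *\<^sub>C x" for c d and x :: "'a completion"
    by transfer (simp add: cauchy_rel_def scaleC_add_left Cauchy_add' Cauchy_scaleC)
  show cM: "c *\<^sub>C d *\<^sub>C x = (c * d) *\<^sub>C x" for c d and x :: "'a completion"
    by transfer (simp add: cauchy_rel_def scaleC_scaleC Cauchy_scaleC)
  show "r *\<^sub>R x = complex_of_real r *\<^sub>C x" for r and x :: "'a completion"
    by (simp add: scaleR_completion_def)
  show cC: "cinner x y = cnj (cinner y x)" for x y :: "'a completion"
  proof transfer
    fix X Y :: "nat \<Rightarrow> 'a" assume XY: "cauchy_rel X X" "cauchy_rel Y Y"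
    have "(\<lambda>n. cnj (cinner (Y n) (X n))) \<longlonglongrightarrow> cnj (lim (\<lambda>n. cinner (Y n) (X n)))"
      by (intro tendsto_cnj tendsto_lim_cinner XY)
    then show "lim (\<lambda>n. cinner (X n) (Y n)) = cnj (lim (\<lambda>n. cinner (Y n) (X n)))"
      by (intro limI) (simp add: cinner_commute[symmetric])
  qed
  show cR: "cinner x (y + z) = cinner x y + cinner x z" for x y z :: "'a completion"
  proof transfer
    fix X Y Z :: "nat \<Rightarrow> 'a" assume XYZ: "cauchy_rel X X" "cauchy_rel Y Y" "cauchy_rel Z Z"
    show "lim (\<lambda>n. cinner (X n) (Y n + Z n)) = lim (\<lambda>n. cinner (X n) (Y n)) + lim (\<lambda>n. cinner (X n) (Z n))"
      unfolding cinner_add_right by (intro limI tendsto_add tendsto_lim_cinner XYZ)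
  qed
  show cRs: "cinner x (c *\<^sub>C y) = c * cinner x y" for c and x y :: "'a completion"
  proof transfer
    fix c and X Y :: "nat \<Rightarrow> 'a" assume XY: "cauchy_rel X X" "cauchy_rel Y Y"
    show "lim (\<lambda>n. cinner (X n) (c *\<^sub>C Y n)) = c * lim (\<lambda>n. cinner (X n) (Y n))"
      unfolding cinner_scaleC_right by (intro limI tendsto_mult tendsto_const tendsto_lim_cinner XY)
  qed
  show "inner x y = Re (cinner x y)" for x y :: "'a completion"
    by (rule inner_completion_def)
  show "x + y + z = x + (y + z)"
    by transfer (simp add: cauchy_rel_def add.assoc Cauchy_add')
  show "x + y = y + x"
    by transfer (simp add: cauchy_rel_def add.commute Cauchy_add')
  show "0 + x = x"
    by transfer (simp add: cauchy_rel_def)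
  show "- x + x = 0"
    by transfer (simp add: cauchy_rel_def)
  show "x - y = x + - y"
    by (rule minus_completion_def)
  show "r *\<^sub>R (x + y) = r *\<^sub>R x + r *\<^sub>R y"
    by (simp add: scaleR_completion_def cS)
  show "(r + s) *\<^sub>R x = r *\<^sub>R x + s *\<^sub>R x"
    by (simp add: scaleR_completion_def cA)
  show "r *\<^sub>R s *\<^sub>R x = (r * s) *\<^sub>R x"
    by (simp add: scaleR_completion_def cM)
  show "1 *\<^sub>R x = x"
    unfolding scaleR_completion_def by transfer (simp add: cauchy_rel_def)
  show "sgn x = inverse (norm x) *\<^sub>R x"
    by (rule sgn_completion_def)
  show "dist x y = norm (x - y)"
    by (rule dist_completion_def)
  show "uniformity = (INF e\<in>{0<..}. principal {(x, y :: 'a completion). dist x y < e})"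
    by (rule uniformity_completion_def)
  show "open U \<longleftrightarrow> (\<forall>x\<in>U. \<forall>\<^sub>F (x', y) in uniformity. x' = x \<longrightarrow> y \<in> U)" for U :: "'a completion set"
    by (rule open_completion_def)
  show "norm x = sqrt (inner x x)"
    by (rule norm_completion_def)
  have cL: "cinner (x + y) z = cinner x z + cinner y z" for x y z :: "'a completion"
    by (metis cC cR complex_cnj_add)
  have cLs: "cinner (c *\<^sub>C x) y = cnj c * cinner x y" for c and x y :: "'a completion"
    by (metis cC cRs complex_cnj_mult)
  show "inner x y = inner y x"
    unfolding inner_completion_def by (subst cC) simp
  show "inner (x + y) z = inner x z + inner y z"
    by (simp add: inner_completion_def cL)
  show "inner (r *\<^sub>R x) y = r * inner x y"
    by (simp add: inner_completion_def scaleR_completion_def cLs)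
  have sq: "(\<lambda>n. (norm (X n))\<^sup>2) \<longlonglongrightarrow> Re (lim (\<lambda>n. cinner (X n) (X n)))"
    if "cauchy_rel X X" for X :: "nat \<Rightarrow> 'a"
    using tendsto_Re[OF tendsto_lim_cinner[OF that that]] by (simp add: cinner_self_norm)
  show "0 \<le> inner x x"
    unfolding inner_completion_def
  proof transfer
    fix X :: "nat \<Rightarrow> 'a" assume "cauchy_rel X X"
    then show "0 \<le> Re (lim (\<lambda>n. cinner (X n) (X n)))"
      by (rule LIMSEQ_le_const[OF sq]) simp
  qed
  show "inner x x = 0 \<longleftrightarrow> x = 0"
    unfolding inner_completion_def
  proof transfer
    fix X :: "nat \<Rightarrow> 'a" assume X: "cauchy_rel X X"
    have "Re (lim (\<lambda>n. cinner (X n) (X n))) = 0 \<longleftrightarrow> (\<lambda>n. (norm (X n))\<^sup>2) \<longlonglongrightarrow> 0"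
      using sq[OF X] LIMSEQ_unique by metis
    also have "\<dots> \<longleftrightarrow> (\<lambda>n. norm (X n)) \<longlonglongrightarrow> 0"
      by simp
    also have "\<dots> \<longleftrightarrow> cauchy_rel X (\<lambda>_. 0)"
      using X by (auto simp: cauchy_rel_def tendsto_norm_zero_iff)
    finally show "Re (lim (\<lambda>n. cinner (X n) (X n))) = 0 \<longleftrightarrow> cauchy_rel X (\<lambda>_. 0)" .
  qed
qed

end

lift_definition embed_completion :: "'a::complex_inner \<Rightarrow> 'a completion" is "\<lambda>x _. x"
  by (simp add: cauchy_rel_def)

lemma cinner_embed_completion [simp]: "cinner (embed_completion x) (embed_completion y) = cinner x y"
  by transfer simp

lemma norm_embed_completion [simp]: "norm (embed_completion x) = norm x"
  by (simp add: norm_eq_sqrt_inner inner_cinner)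

lemma embed_completion_add: "embed_completion (x + y) = embed_completion x + embed_completion y"
  by transfer (simp add: cauchy_rel_def)

lemma embed_completion_scaleC: "embed_completion (c *\<^sub>C x) = c *\<^sub>C embed_completion x"
  by transfer (simp add: cauchy_rel_def)

lemma embed_completion_diff: "embed_completion (x - y) = embed_completion x - embed_completion y"
  using embed_completion_add[of "x - y" y] by simp

lemma embed_completion_tendsto:
  assumes "cauchy_rel X X"
  shows "(\<lambda>n. embed_completion (X n)) \<longlonglongrightarrow> abs_completion X"
proof (rule metric_LIMSEQ_I)
  fix e :: real assume "e > 0"
  have X: "Cauchy X"
    using assms by (simp add: cauchy_rel_def)
  then obtain M where M: "\<And>m n. m \<ge> M \<Longrightarrow> n \<ge> M \<Longrightarrow> norm (X m - X n) < e / 2"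
    using \<open>e > 0\<close> by (meson CauchyD half_gt_zero)
  have "dist (embed_completion (X n)) (abs_completion X) < e" if "n \<ge> M" for n
  proof -
    let ?D = "\<lambda>m. X n - X m"
    have D: "cauchy_rel ?D ?D"
      using Cauchy_add'[OF Cauchy_const[of "X n"] Cauchy_minus[OF X]]
      by (simp add: cauchy_rel_def)
    have "embed_completion (X n) - abs_completion X = abs_completion ?D"
      using assms D unfolding minus_completion_def
      by (simp add: embed_completion.abs_eq uminus_completion.abs_eq plus_completion.abs_eq
          eq_onp_same_args cauchy_rel_def Cauchy_minus)
    then have "(norm (embed_completion (X n) - abs_completion X))\<^sup>2 = Re (lim (\<lambda>m. cinner (?D m) (?D m)))"
      using D by (simp add: power2_norm_eq_inner inner_cinner cinner_completion.abs_eq)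
    also have "\<dots> \<le> (e / 2)\<^sup>2"
    proof (rule LIMSEQ_le_const2)
      show "(\<lambda>m. Re (cinner (?D m) (?D m))) \<longlonglongrightarrow> Re (lim (\<lambda>m. cinner (?D m) (?D m)))"
        by (intro tendsto_Re tendsto_lim_cinner D)
      show "\<exists>N. \<forall>m\<ge>N. Re (cinner (?D m) (?D m)) \<le> (e / 2)\<^sup>2"
      proof (intro exI[of _ M] allI impI)
        fix m assume "m \<ge> M"
        then have "(norm (?D m))\<^sup>2 \<le> (e / 2)\<^sup>2"
          using M[of n m] that by (intro power_mono) auto
        then show "Re (cinner (?D m) (?D m)) \<le> (e / 2)\<^sup>2"
          by (simp add: cinner_self_norm)
      qed
    qed
    finally have "norm (embed_completion (X n) - abs_completion X) \<le> e / 2"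
      using \<open>e > 0\<close> by (simp add: power2_le_iff_abs_le)
    then show ?thesis
      using \<open>e > 0\<close> by (simp add: dist_norm)
  qed
  then show "\<exists>N. \<forall>n\<ge>N. dist (embed_completion (X n)) (abs_completion X) < e"
    by blast
qed

lemma completion_cases:
  obtains X where "cauchy_rel X X" "z = abs_completion X"
proof -
  have "cauchy_rel (rep_completion z) (rep_completion z)" "z = abs_completion (rep_completion z)"
    by (rule Quotient3_rep_reflp[OF Quotient3_completion], rule Quotient3_abs_rep[OF Quotient3_completion, symmetric])
  then show thesis by (rule that)
qed

lemma closure_range_embed_completion: "closure (range (embed_completion :: 'a::complex_inner \<Rightarrow> _)) = UNIV"
proof -
  have "z \<in> closure (range embed_completion)" for z :: "'a completion"
    using embed_completion_tendsto by (cases z rule: completion_cases) (fastforce simp: closure_sequential)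
  then show ?thesis by auto
qed

instance completion :: (complex_inner) chilbert_space
proof
  fix Z :: "nat \<Rightarrow> 'a completion"
  assume Z: "Cauchy Z"
  have "\<exists>x. dist (embed_completion x) (Z n) < inverse (real (Suc n))" for n
    using closure_range_embed_completion[where 'a = 'a] closure_approachable[of "Z n" "range embed_completion"] by force
  then obtain X where X: "\<And>n. dist (embed_completion (X n)) (Z n) < inverse (real (Suc n))"
    by metis
  have d: "(\<lambda>n. embed_completion (X n) - Z n) \<longlonglongrightarrow> 0"
    by (rule Lim_null_comparison[OF _ LIMSEQ_inverse_real_of_nat])
       (intro always_eventually allI less_imp_le X[unfolded dist_norm])
  then have "Cauchy (\<lambda>n. (embed_completion (X n) - Z n) + Z n)"
    by (intro Cauchy_add' Z LIMSEQ_imp_Cauchy)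
  then have "Cauchy X"
    by (simp add: Cauchy_iff flip: embed_completion_diff)
  then have "cauchy_rel X X"
    by (simp add: cauchy_rel_def)
  from tendsto_diff[OF embed_completion_tendsto[OF this] d] show "convergent Z"
    by (auto simp: convergent_def)
qed

instantiation blinfun :: (real_normed_vector, complex_inner) scaleC
begin

lift_definition scaleC_blinfun :: "complex \<Rightarrow> ('a \<Rightarrow>\<^sub>L 'b) \<Rightarrow> ('a \<Rightarrow>\<^sub>L 'b)"
  is "\<lambda>c T x. c *\<^sub>C T x"
  by (rule bounded_linear_compose[OF bounded_linear_scaleC])

instance ..

end

lemma scaleC_blinfun_apply [simp]: "blinfun_apply (c *\<^sub>C T) x = c *\<^sub>C T x"
  by transfer simp

definition csubspace :: "'a::{scaleC, zero, plus} set \<Rightarrow> bool"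
  where "csubspace S \<longleftrightarrow> 0 \<in> S \<and> (\<forall>x\<in>S. \<forall>y\<in>S. x + y \<in> S) \<and> (\<forall>c. \<forall>x\<in>S. c *\<^sub>C x \<in> S)"

text \<open>
  \<open>clin_ops\<close> is \<open>B(H, K)\<close>: the type \<open>blinfun\<close> of the library consists of all bounded \<^emph>\<open>real\<close>-linear
  maps, among which the complex-linear ones are singled out. The operator norm and the norm topology
  are those of \<open>blinfun\<close>.
\<close>
definition clin_ops :: "('a::complex_inner \<Rightarrow>\<^sub>L 'b::complex_inner) set"
  where "clin_ops = {T. \<forall>c x. blinfun_apply T (c *\<^sub>C x) = c *\<^sub>C T x}"

text \<open>
  Existence of the adjoint is \<open>cinner_adj_left\<close> below.
\<close>
definition adj :: "('a::complex_inner \<Rightarrow>\<^sub>L 'b::complex_inner) \<Rightarrow> ('b \<Rightarrow>\<^sub>L 'a)"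
  where "adj T = (THE S. \<forall>x y. cinner (blinfun_apply S y) x = cinner y (T x))"

lemma adj_eqI:
  fixes T :: "'a::complex_inner \<Rightarrow>\<^sub>L 'b::complex_inner" and S :: "'b \<Rightarrow>\<^sub>L 'a"
  assumes "\<And>x y. cinner (S y) x = cinner y (T x)"
  shows "adj T = S"
  unfolding adj_def
proof (rule the_equality)
  fix S' assume S': "\<forall>x y. cinner (blinfun_apply S' y) x = cinner y (T x)"
  have "S' y = S y" for y
  proof (rule cinner_ext)
    fix z
    have "cinner (S' y) z = cinner (S y) z"
      using S' assms by simp
    then show "cinner z (S' y) = cinner z (S y)"
      by (subst (1 2) cinner_commute) simp
  qed
  then show "S' = S"
    by (rule blinfun_eqI)
qed (use assms in blast)

lemma orthogonal_projection_exists: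
  fixes M :: "'a::{real_inner, banach} set"
  assumes "subspace M" "closed M"
  shows "\<exists>p\<in>M. \<forall>m\<in>M. inner (x - p) m = 0"
proof -
  have M0: "M \<noteq> {}"
    using subspace_0[OF assms(1)] by auto
  define d where "d = infdist x M"
  have d: "d \<le> norm (x - m)" if "m \<in> M" for m
    using infdist_le[OF that] by (simp add: d_def dist_norm)
  have d0: "d \<ge> 0"
    by (simp add: d_def infdist_nonneg)
  have "\<exists>m\<in>M. norm (x - m) < d + inverse (real (Suc n))" for n
  proof -
    have "(INF a\<in>M. dist x a) < d + inverse (real (Suc n))"
      using M0 by (simp add: d_def infdist_def)
    then show ?thesis
      using M0 by (subst (asm) cINF_less_iff) (auto simp: dist_norm intro!: bdd_belowI2[of _ 0])
  qed
  then obtain u where u: "\<And>n. u n \<in> M" "\<And>n. norm (x - u n) < d + inverse (real (Suc n))"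
    by metis
  have lim: "(\<lambda>n. norm (x - u n)) \<longlonglongrightarrow> d"
  proof (rule real_tendsto_sandwich)
    show "\<forall>\<^sub>F n in sequentially. d \<le> norm (x - u n)"
      by (intro always_eventually allI d u)
    show "\<forall>\<^sub>F n in sequentially. norm (x - u n) \<le> d + inverse (real (Suc n))"
      by (intro always_eventually allI less_imp_le u)
    show "(\<lambda>n. d + inverse (real (Suc n))) \<longlonglongrightarrow> d"
      using tendsto_add[OF tendsto_const LIMSEQ_inverse_real_of_nat, of d] by simp
  qed (rule tendsto_const)
  have par: "(norm (u m - u n))\<^sup>2 \<le> 2 * (norm (x - u m))\<^sup>2 + 2 * (norm (x - u n))\<^sup>2 - 4 * d\<^sup>2" for m n
  proof -
    have "(1/2) *\<^sub>R (u m + u n) \<in> M"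
      by (intro subspace_scale subspace_add assms u)
    then have "d\<^sup>2 \<le> (norm (x - (1/2) *\<^sub>R (u m + u n)))\<^sup>2"
      using d d0 by (intro power_mono) auto
    moreover have "(norm (u m - u n))\<^sup>2 + 4 * (norm (x - (1/2) *\<^sub>R (u m + u n)))\<^sup>2
        = 2 * (norm (x - u m))\<^sup>2 + 2 * (norm (x - u n))\<^sup>2"
      by (simp add: power2_norm_eq_inner algebra_simps inner_add_left inner_add_right
          inner_diff_left inner_diff_right inner_commute)
    ultimately show ?thesis
      by linarith
  qed
  have "Cauchy u"
  proof (rule CauchyI)
    fix e :: real assume e: "e > 0"
    have "(\<lambda>n. 2 * (norm (x - u n))\<^sup>2) \<longlonglongrightarrow> 2 * d\<^sup>2"
      by (intro tendsto_intros lim)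
    moreover have "2 * d\<^sup>2 < 2 * d\<^sup>2 + e\<^sup>2 / 2"
      using e by simp
    ultimately obtain N where N: "\<And>n. n \<ge> N \<Longrightarrow> 2 * (norm (x - u n))\<^sup>2 < 2 * d\<^sup>2 + e\<^sup>2 / 2"
      by (metis (no_types, lifting) order_tendstoD(2) eventually_sequentially)
    have "norm (u m - u n) < e" if "m \<ge> N" "n \<ge> N" for m n
    proof -
      have "(norm (u m - u n))\<^sup>2 < e\<^sup>2"
        using par[of m n] N[OF that(1)] N[OF that(2)] by argo
      then show ?thesis
        using e by (simp add: power2_less_imp_less)
    qed
    then show "\<exists>M. \<forall>m\<ge>M. \<forall>n\<ge>M. norm (u m - u n) < e"
      by blast
  qed
  then obtain p where p: "u \<longlonglongrightarrow> p"
    by (auto simp: Cauchy_convergent_iff convergent_def)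
  have pM: "p \<in> M"
    using closed_sequentially[OF assms(2)] u p by blast
  have np: "norm (x - p) = d"
    by (rule LIMSEQ_unique[OF _ lim]) (intro tendsto_intros p)
  have "inner (x - p) m = 0" if "m \<in> M" for m
  proof (cases "m = 0")
    case False
    define t where "t = inner (x - p) m / inner m m"
    have mm: "inner m m > 0"
      using False by simp
    have "p + t *\<^sub>R m \<in> M"
      by (intro subspace_add subspace_scale assms pM that)
    then have "d\<^sup>2 \<le> (norm (x - (p + t *\<^sub>R m)))\<^sup>2"
      using d d0 by (intro power_mono) auto
    also have "\<dots> = (norm (x - p))\<^sup>2 - 2 * t * inner (x - p) m + t\<^sup>2 * inner m m"
      unfolding power2_norm_eq_inner
      by (simp add: power2_eq_square[of t] algebra_simps inner_add_left inner_add_right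
          inner_diff_left inner_diff_right inner_commute)
    also have "\<dots> = d\<^sup>2 - (inner (x - p) m)\<^sup>2 / inner m m"
      using mm by (simp add: t_def np power2_eq_square field_simps)
    finally have "(inner (x - p) m)\<^sup>2 / inner m m \<le> 0"
      by simp
    then show ?thesis
      using mm by (simp add: divide_le_0_iff)
  qed simp
  then show ?thesis
    using pM by blast
qed

lemma riesz_real:
  fixes f :: "'a::{real_inner, banach} \<Rightarrow> real"
  assumes "bounded_linear f"
  shows "\<exists>z. \<forall>x. f x = inner z x"
proof -
  interpret f: bounded_linear f by fact
  let ?M = "{x. f x = 0}"
  have M: "subspace ?M" "closed ?M"
    by (auto simp: subspace_def f.add f.scale f.zero
        intro!: closed_Collect_eq linear_continuous_on assms continuous_on_const)
  show ?thesis
  proof (cases "\<exists>x. f x \<noteq> 0")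
    case True
    then obtain x0 where x0: "f x0 \<noteq> 0" by blast
    obtain p where p: "f p = 0" "\<And>m. f m = 0 \<Longrightarrow> inner (x0 - p) m = 0"
      using orthogonal_projection_exists[OF M, of x0] by auto
    define q where "q = x0 - p"
    have fq: "f q \<noteq> 0"
      using x0 p by (simp add: q_def f.diff)
    then have qq: "inner q q \<noteq> 0"
      by (auto simp: f.zero)
    have "f x = inner ((f q / inner q q) *\<^sub>R q) x" for x
    proof -
      have "f (x - (f x / f q) *\<^sub>R q) = 0"
        using fq by (simp add: f.diff f.scale)
      from p(2)[OF this] have "inner q x = f x / f q * inner q q"
        by (simp add: q_def[symmetric] inner_diff_right)
      then show ?thesis
        using fq qq by simp
    qed
    then show ?thesis by blast
  next
    case False
    then show ?thesis by (intro exI[of _ 0]) simp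
  qed
qed

lemma Im_cinner: "Im (cinner x y) = - Re (cinner x (\<i> *\<^sub>C y))"
  by (simp add: cinner_scaleC_right)

lemma adj_exists:
  fixes T :: "'a::chilbert_space \<Rightarrow>\<^sub>L 'b::complex_inner"
  assumes "T \<in> clin_ops"
  shows "\<exists>S\<in>clin_ops. \<forall>x y. cinner (blinfun_apply S y) x = cinner y (T x)"
proof -
  have T: "T (c *\<^sub>C x) = c *\<^sub>C T x" for c x
    using assms by (simp add: clin_ops_def)
  have "\<exists>z. \<forall>x. cinner z x = cinner y (T x)" for y
  proof -
    have "bounded_linear (\<lambda>x. inner y (T x))"
      by (intro bounded_linear_compose[OF bounded_linear_inner_right] blinfun.bounded_linear_right)
    from riesz_real[OF this] obtain z where z: "\<And>x. inner y (T x) = inner z x"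
      by blast
    have "cinner z x = cinner y (T x)" for x
      using z[of x] z[of "\<i> *\<^sub>C x"] by (simp add: complex_eq_iff Im_cinner inner_cinner T)
    then show ?thesis by blast
  qed
  then obtain S where S: "\<And>x y. cinner (S y) x = cinner y (T x)"
    by metis
  have S': "cinner x (S y) = cinner (T x) y" for x y
    using S[of y x] by (metis cinner_commute)
  have add: "S (x + y) = S x + S y" for x y
    by (rule cinner_ext) (simp add: S' cinner_add_right)
  have scale: "S (c *\<^sub>C x) = c *\<^sub>C S x" for c x
    by (rule cinner_ext) (simp add: S' cinner_scaleC_right)
  have bd: "norm (S y) \<le> norm y * norm T" for y
  proof (cases "S y = 0")
    case False
    have "(norm (S y))\<^sup>2 = Re (cinner y (T (S y)))"
      by (simp add: power2_norm_eq_inner inner_cinner S)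
    also have "\<dots> \<le> norm y * norm (T (S y))"
      unfolding inner_cinner[symmetric] by (rule norm_cauchy_schwarz)
    also have "\<dots> \<le> norm y * (norm T * norm (S y))"
      by (intro mult_left_mono norm_blinfun) simp
    finally show ?thesis
      using False by (simp add: power2_eq_square mult.assoc[symmetric])
  qed simp
  have bl: "bounded_linear S"
    by (rule bounded_linear_intro[of _ "norm T"]) (auto simp: add scale scaleR_scaleC bd)
  show ?thesis
    by (rule bexI[of _ "Blinfun S"]) (auto simp: clin_ops_def bounded_linear_Blinfun_apply[OF bl] S scale)
qed

lemma
  fixes T :: "'a::chilbert_space \<Rightarrow>\<^sub>L 'b::complex_inner"
  assumes "T \<in> clin_ops"
  shows cinner_adj_left: "cinner (adj T y) x = cinner y (T x)"
    and cinner_adj_right: "cinner x (adj T y) = cinner (T x) y"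
    and adj_clin_ops: "adj T \<in> clin_ops"
proof -
  obtain S where S: "S \<in> clin_ops" "\<And>x y. cinner (blinfun_apply S y) x = cinner y (T x)"
    using adj_exists[OF assms] by blast
  have "adj T = S"
    by (rule adj_eqI) (rule S)
  with S show *: "cinner (adj T y) x = cinner y (T x)" and "adj T \<in> clin_ops" for x y
    by auto
  show "cinner x (adj T y) = cinner (T x) y"
    using *[of y x] by (metis cinner_commute)
qed

definition is_projection :: "('a::complex_inner \<Rightarrow>\<^sub>L 'a) \<Rightarrow> bool"
  where "is_projection P \<longleftrightarrow> P \<in> clin_ops \<and> P o\<^sub>L P = P \<and> adj P = P"

definition proj_onto :: "'a::complex_inner set \<Rightarrow> ('a \<Rightarrow>\<^sub>L 'a)"
  where "proj_onto M = (THE P. is_projection P \<and> range (blinfun_apply P) = M)"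

lemma is_projection_unique:
  fixes P Q :: "'a::chilbert_space \<Rightarrow>\<^sub>L 'a"
  assumes P: "is_projection P" and Q: "is_projection Q" and "range P = range Q"
  shows "P = Q"
proof (rule blinfun_eqI)
  have fixp: "R y = y" if "y \<in> range R" "is_projection R" for R :: "'a \<Rightarrow>\<^sub>L 'a" and y
    using that by (auto simp: is_projection_def blinfun_apply_blinfun_compose[symmetric])
  fix x
  have PQ: "P (Q y) = Q y" "Q (P y) = P y" for y
    using fixp[of "Q y" P] fixp[of "P y" Q] assms by auto
  show "P x = Q x"
  proof (rule cinner_ext)
    fix z
    have "cinner z (P x) = cinner (P z) x" "cinner z (Q x) = cinner (Q z) x" for x z
      using P Q cinner_adj_right[of P] cinner_adj_right[of Q] by (metis is_projection_def)+
    then show "cinner z (P x) = cinner z (Q x)"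
      by (metis PQ)
  qed
qed

lemma
  fixes M :: "'a::chilbert_space set"
  assumes M: "csubspace M" "closed M"
  shows is_projection_proj_onto: "is_projection (proj_onto M)" and range_proj_onto: "range (proj_onto M) = M"
proof -
  have sub: "subspace M"
    using M by (auto simp: subspace_def csubspace_def scaleR_scaleC)
  obtain p where p: "\<And>x. p x \<in> M" and re: "\<And>x m. m \<in> M \<Longrightarrow> inner (x - p x) m = 0"
    using orthogonal_projection_exists[OF sub M(2)] by metis
  have orth: "cinner (x - p x) m = 0" if "m \<in> M" for x m
    using re[OF that, of x] re[of "\<i> *\<^sub>C m" x] M(1) that
    by (simp add: complex_eq_iff Im_cinner inner_cinner csubspace_def)
  have diffM: "u - v \<in> M" if "u \<in> M" "v \<in> M" for u v
    using sub that by (rule subspace_diff)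
  have uniq: "p x = u" if "u \<in> M" "\<And>m. m \<in> M \<Longrightarrow> cinner (x - u) m = 0" for x u
  proof -
    have m: "p x - u \<in> M"
      using p that diffM by blast
    have "cinner (p x - u) (p x - u) = cinner (x - u) (p x - u) - cinner (x - p x) (p x - u)"
      by (simp add: cinner_diff_left)
    also have "\<dots> = 0"
      using orth[OF m] that(2)[OF m] by simp
    finally show ?thesis
      by (simp only: cinner_eq_zero_iff right_minus_eq)
  qed
  have add: "p (x + y) = p x + p y" for x y
    using orth[of _ x] orth[of _ y] p M(1)
    by (intro uniq) (auto simp: csubspace_def add_diff_add cinner_add_left)
  have scale: "p (c *\<^sub>C x) = c *\<^sub>C p x" for c x
    using orth[of _ x] p M(1)
    by (intro uniq) (auto simp: csubspace_def scaleC_diff_right[symmetric] cinner_scaleC_left)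
  have bd: "norm (p x) \<le> norm x * 1" for x
  proof -
    have "(norm x)\<^sup>2 = (norm (x - p x))\<^sup>2 + (norm (p x))\<^sup>2"
      using re[OF p, of x x]
      by (simp add: power2_norm_eq_inner inner_diff_left inner_diff_right inner_commute)
    then have "(norm (p x))\<^sup>2 \<le> (norm x)\<^sup>2"
      by simp
    then show ?thesis
      by simp
  qed
  have bl: "bounded_linear p"
    by (rule bounded_linear_intro[of _ 1]) (auto simp: add scale scaleR_scaleC bd[simplified])
  define P where "P = Blinfun p"
  have P: "P x = p x" for x
    by (simp add: P_def bounded_linear_Blinfun_apply[OF bl])
  have pid: "p u = u" if "u \<in> M" for u
    using that by (intro uniq) auto
  have "cinner (p y) x = cinner y (p x)" for x y
  proof -
    have "cinner y (p x) = cinner (p y) (p x)"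
      using orth[OF p, of y x] by (simp add: cinner_diff_left)
    moreover have "cinner x (p y) = cinner (p x) (p y)"
      using orth[OF p, of x y] by (simp add: cinner_diff_left)
    ultimately show ?thesis
      by (metis cinner_commute)
  qed
  then have "adj P = P"
    by (intro adj_eqI) (simp add: P)
  then have isP: "is_projection P"
    by (auto simp: is_projection_def clin_ops_def P scale pid[OF p] intro: blinfun_eqI)
  have rP: "range P = M"
    using p pid P by (auto simp: image_iff) metis
  have "proj_onto M = P"
    unfolding proj_onto_def by (rule the_equality) (use isP rP is_projection_unique in blast)+
  with isP rP show "is_projection (proj_onto M)" "range (proj_onto M) = M"
    by auto
qed

text \<open>
  The algebraic tensor product. A sum \<open>\<Sum>i. x\<^sub>i \<otimes> y\<^sub>i\<close> is represented by the function
  \<open>(a, b) \<mapsto> \<Sum>i. cinner a x\<^sub>i * cinner b y\<^sub>i\<close> of its inner products with the elementary tensors. Since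
  these pairings separate the points of the algebraic tensor product, no further identification
  is made. The inner product, too, is the usual one (\<open>cinner_tensor\<close> below).
\<close>
definition tensor_fun :: "('a::complex_inner \<times> 'b::complex_inner) list \<Rightarrow> 'a \<Rightarrow> 'b \<Rightarrow> complex"
  where "tensor_fun us = (\<lambda>a b. \<Sum>(x, y)\<leftarrow>us. cinner a x * cinner b y)"

typedef (overloaded) ('a, 'b) alg_tensor =
    "range (tensor_fun :: ('a::complex_inner \<times> 'b::complex_inner) list \<Rightarrow> _)"
  by blast

setup_lifting type_definition_alg_tensor

lemma tensor_fun_append: "tensor_fun (us @ vs) a b = tensor_fun us a b + tensor_fun vs a b"
  by (simp add: tensor_fun_def)

lemma tensor_fun_scale: "tensor_fun (map (\<lambda>(x, y). (c *\<^sub>C x, y)) us) a b = c * tensor_fun us a b"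
  by (induction us) (auto simp: tensor_fun_def cinner_scaleC_right algebra_simps)

lemma sum_list_tensor_fun:
  "(\<Sum>(x, y)\<leftarrow>us. tensor_fun vs x y) = cnj (\<Sum>(x, y)\<leftarrow>vs. tensor_fun us x y)"
proof (induction us)
  case Nil
  have "(\<Sum>(x, y)\<leftarrow>vs. tensor_fun [] x y) = 0"
    by (induction vs) (auto simp: tensor_fun_def)
  then show ?case by simp
next
  case (Cons p us)
  have "(\<Sum>(x, y)\<leftarrow>vs. tensor_fun (p # us) x y)
      = cnj (tensor_fun vs (fst p) (snd p)) + (\<Sum>(x, y)\<leftarrow>vs. tensor_fun us x y)"
    by (induction vs) (auto simp: tensor_fun_def algebra_simps simp flip: cinner_commute split: prod.splits)
  with Cons show ?case
    by (cases p) simp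
qed

lemma tensor_fun_orthonormal_right:
  fixes us :: "('a::complex_inner \<times> 'b::complex_inner) list"
  obtains E :: "'b set" and z where "finite E" "orthonormal E"
    "\<And>a b. tensor_fun us a b = (\<Sum>e\<in>E. cinner a (z e) * cinner b e)"
    "\<And>e. z e = (\<Sum>(x, y)\<leftarrow>us. cinner e y *\<^sub>C x)"
proof -
  obtain E where E: "finite E" "orthonormal E"
    "\<And>y. y \<in> snd ` set us \<Longrightarrow> y = (\<Sum>e\<in>E. cinner e y *\<^sub>C e)"
    using finite_orthonormal_expansion[of "snd ` set us"] by auto
  define z :: "('a \<times> 'b) list \<Rightarrow> 'b \<Rightarrow> 'a" where "z = (\<lambda>ws e. \<Sum>(x, y)\<leftarrow>ws. cinner e y *\<^sub>C x)"
  have "tensor_fun ws a b = (\<Sum>e\<in>E. cinner a (z ws e) * cinner b e)"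
    if "set ws \<subseteq> set us" for ws a b
    using that
  proof (induction ws)
    case Nil
    then show ?case by (simp add: tensor_fun_def z_def)
  next
    case (Cons p ws)
    obtain x y where p: "p = (x, y)" by fastforce
    then have "y \<in> snd ` set us"
      using Cons.prems by force
    then have "cinner b y = (\<Sum>e\<in>E. cinner e y * cinner b e)"
      using E(3)[of y] cinner_sum_right[of b "\<lambda>e. cinner e y *\<^sub>C e" E]
      by (simp add: cinner_scaleC_right)
    then have "cinner a x * cinner b y = (\<Sum>e\<in>E. cinner a (cinner e y *\<^sub>C x) * cinner b e)"
      by (simp add: sum_distrib_left cinner_scaleC_right mult_ac)
    moreover have "tensor_fun (p # ws) a b = cinner a x * cinner b y + tensor_fun ws a b"
      by (simp add: tensor_fun_def p)
    moreover have "z (p # ws) e = cinner e y *\<^sub>C x + z ws e" for e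
      by (simp add: z_def p)
    ultimately show ?case
      using Cons by (simp add: cinner_add_right sum.distrib algebra_simps)
  qed
  then show thesis
    by (intro that[OF E(1,2), of "z us"]) (auto simp: z_def)
qed

instantiation alg_tensor :: (complex_inner, complex_inner) complex_inner
begin

lift_definition zero_alg_tensor :: "('a, 'b) alg_tensor" is "\<lambda>_ _. 0"
  by (rule image_eqI[of _ _ "[]"]) (auto simp: tensor_fun_def)

lift_definition plus_alg_tensor :: "('a, 'b) alg_tensor \<Rightarrow> ('a, 'b) alg_tensor \<Rightarrow> ('a, 'b) alg_tensor"
  is "\<lambda>F G a b. F a b + G a b"
  by (auto simp: fun_eq_iff image_iff simp flip: tensor_fun_append)

lift_definition scaleC_alg_tensor :: "complex \<Rightarrow> ('a, 'b) alg_tensor \<Rightarrow> ('a, 'b) alg_tensor"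
  is "\<lambda>c F a b. c * F a b"
  by (auto simp: fun_eq_iff image_iff simp flip: tensor_fun_scale)

definition uminus_alg_tensor :: "('a, 'b) alg_tensor \<Rightarrow> ('a, 'b) alg_tensor"
  where "uminus_alg_tensor x = (- 1) *\<^sub>C x"

definition minus_alg_tensor :: "('a, 'b) alg_tensor \<Rightarrow> ('a, 'b) alg_tensor \<Rightarrow> ('a, 'b) alg_tensor"
  where "minus_alg_tensor x y = x + - y"

definition scaleR_alg_tensor :: "real \<Rightarrow> ('a, 'b) alg_tensor \<Rightarrow> ('a, 'b) alg_tensor"
  where "scaleR_alg_tensor r x = complex_of_real r *\<^sub>C x"

definition cinner_alg_tensor :: "('a, 'b) alg_tensor \<Rightarrow> ('a, 'b) alg_tensor \<Rightarrow> complex"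
  where "cinner_alg_tensor F G =
    (\<Sum>(x, y)\<leftarrow>(SOME us. Rep_alg_tensor F = tensor_fun us). Rep_alg_tensor G x y)"

definition inner_alg_tensor :: "('a, 'b) alg_tensor \<Rightarrow> ('a, 'b) alg_tensor \<Rightarrow> real"
  where "inner_alg_tensor x y = Re (cinner x y)"

definition norm_alg_tensor :: "('a, 'b) alg_tensor \<Rightarrow> real"
  where "norm_alg_tensor x = sqrt (inner x x)"

definition dist_alg_tensor :: "('a, 'b) alg_tensor \<Rightarrow> ('a, 'b) alg_tensor \<Rightarrow> real"
  where "dist_alg_tensor x y = norm (x - y)"

definition sgn_alg_tensor :: "('a, 'b) alg_tensor \<Rightarrow> ('a, 'b) alg_tensor"
  where "sgn_alg_tensor x = scaleR (inverse (norm x)) x"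

definition uniformity_alg_tensor :: "(('a, 'b) alg_tensor \<times> ('a, 'b) alg_tensor) filter"
  where "uniformity_alg_tensor = (INF e\<in>{0<..}. principal {(x, y). dist x y < e})"

definition open_alg_tensor :: "('a, 'b) alg_tensor set \<Rightarrow> bool"
  where "open_alg_tensor U \<longleftrightarrow> (\<forall>x\<in>U. \<forall>\<^sub>F (x', y) in uniformity. x' = x \<longrightarrow> y \<in> U)"

lemma cinner_alg_tensor_eq:
  fixes F G :: "('a, 'b) alg_tensor"
  assumes us: "Rep_alg_tensor F = tensor_fun us"
  shows "cinner F G = (\<Sum>(x, y)\<leftarrow>us. Rep_alg_tensor G x y)"
proof -
  obtain vs where vs: "Rep_alg_tensor G = tensor_fun vs"
    using Rep_alg_tensor[of G] by auto
  let ?ws = "SOME us. Rep_alg_tensor F = tensor_fun us"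
  have ws: "Rep_alg_tensor F = tensor_fun ?ws"
    by (rule someI) (rule us)
  have "(\<Sum>(x, y)\<leftarrow>ws. Rep_alg_tensor G x y) = cnj (\<Sum>(x, y)\<leftarrow>vs. Rep_alg_tensor F x y)"
    if "Rep_alg_tensor F = tensor_fun ws" for ws
    unfolding vs that by (rule sum_list_tensor_fun)
  from this[OF ws] this[OF us] show ?thesis
    by (simp add: cinner_alg_tensor_def)
qed

lemma cinner_alg_tensor_orthonormal:
  fixes F :: "('a, 'b) alg_tensor"
  assumes E: "finite E" "orthonormal E"
    and F: "\<And>a b. Rep_alg_tensor F a b = (\<Sum>e\<in>E. cinner a (z e) * cinner b e)"
  shows "cinner F F = (\<Sum>e\<in>E. cinner (z e) (z e))"
proof -
  obtain es where es: "set es = E" "distinct es"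
    using finite_distinct_list[OF E(1)] by blast
  let ?us = "map (\<lambda>e. (z e, e)) es"
  have *: "(\<Sum>(x, y)\<leftarrow>?us. h x y) = (\<Sum>e\<in>E. h (z e) e)" for h :: "'a \<Rightarrow> 'b \<Rightarrow> complex"
    using sum_list_distinct_conv_sum_set[OF es(2), of "\<lambda>e. h (z e) e"] es(1) by (simp add: o_def)
  have "Rep_alg_tensor F = tensor_fun ?us"
    unfolding tensor_fun_def * by (intro ext) (rule F)
  from cinner_alg_tensor_eq[OF this, of F]
  have "cinner F F = (\<Sum>e\<in>E. \<Sum>f\<in>E. cinner (z e) (z f) * cinner e f)"
    by (simp only: * F)
  also have "\<dots> = (\<Sum>e\<in>E. cinner (z e) (z e))"
  proof (rule sum.cong[OF refl])
    fix e assume e: "e \<in> E"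
    have "(\<Sum>f\<in>E. cinner (z e) (z f) * cinner e f) = (\<Sum>f\<in>E. if f = e then cinner (z e) (z e) else 0)"
      using E(2) e by (intro sum.cong) (auto simp: orthonormal_def)
    then show "(\<Sum>f\<in>E. cinner (z e) (z f) * cinner e f) = cinner (z e) (z e)"
      using E(1) e by simp
  qed
  finally show ?thesis .
qed

lemma alg_tensor_orthonormal_right:
  fixes F :: "('a, 'b) alg_tensor"
  obtains E :: "'b set" and z where "finite E" "orthonormal E"
    "\<And>a b. Rep_alg_tensor F a b = (\<Sum>e\<in>E. cinner a (z e) * cinner b e)"
    "cinner F F = (\<Sum>e\<in>E. cinner (z e) (z e))"
proof -
  obtain us where us: "Rep_alg_tensor F = tensor_fun us"
    using Rep_alg_tensor[of F] by auto
  obtain E z where E: "finite E" "orthonormal E"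
      "\<And>a b. Rep_alg_tensor F a b = (\<Sum>e\<in>E. cinner a (z e) * cinner b e)"
    unfolding us by (rule tensor_fun_orthonormal_right[of us]) blast
  show thesis
    by (rule that[OF E cinner_alg_tensor_orthonormal[OF E]])
qed

instance
proof
  fix x y z :: "('a, 'b) alg_tensor" and c d :: complex and r s :: real
  show cS: "c *\<^sub>C (x + y) = c *\<^sub>C x + c *\<^sub>C y" for c and x y :: "('a, 'b) alg_tensor"
    by transfer (simp add: algebra_simps)
  show cA: "(c + d) *\<^sub>C x = c *\<^sub>C x + d *\<^sub>C x" for c d and x :: "('a, 'b) alg_tensor"
    by transfer (simp add: algebra_simps)
  show cM: "c *\<^sub>C d *\<^sub>C x = (c * d) *\<^sub>C x" for c d and x :: "('a, 'b) alg_tensor"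
    by transfer (simp add: algebra_simps)
  show "r *\<^sub>R x = complex_of_real r *\<^sub>C x" for r and x :: "('a, 'b) alg_tensor"
    by (simp add: scaleR_alg_tensor_def)
  show cC: "cinner x y = cnj (cinner y x)" for x y :: "('a, 'b) alg_tensor"
  proof -
    obtain us vs where *: "Rep_alg_tensor x = tensor_fun us" "Rep_alg_tensor y = tensor_fun vs"
      using Rep_alg_tensor[of x] Rep_alg_tensor[of y] by auto
    show ?thesis
      unfolding cinner_alg_tensor_eq[OF *(1)] cinner_alg_tensor_eq[OF *(2)] unfolding *
      by (rule sum_list_tensor_fun)
  qed
  show cR: "cinner x (y + z) = cinner x y + cinner x z" for x y z :: "('a, 'b) alg_tensor"
    unfolding cinner_alg_tensor_def plus_alg_tensor.rep_eq case_prod_beta sum_list_addf ..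
  show cRs: "cinner x (c *\<^sub>C y) = c * cinner x y" for c and x y :: "('a, 'b) alg_tensor"
    unfolding cinner_alg_tensor_def scaleC_alg_tensor.rep_eq case_prod_beta sum_list_const_mult ..
  show "inner x y = Re (cinner x y)" for x y :: "('a, 'b) alg_tensor"
    by (rule inner_alg_tensor_def)
  show "x + y + z = x + (y + z)"
    by transfer (simp add: algebra_simps)
  show "x + y = y + x"
    by transfer (simp add: algebra_simps)
  show "0 + x = x"
    by transfer simp
  show "- x + x = 0"
    unfolding uminus_alg_tensor_def by transfer simp
  show "x - y = x + - y"
    by (rule minus_alg_tensor_def)
  show "r *\<^sub>R (x + y) = r *\<^sub>R x + r *\<^sub>R y"
    by (simp add: scaleR_alg_tensor_def cS)
  show "(r + s) *\<^sub>R x = r *\<^sub>R x + s *\<^sub>R x"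
    by (simp add: scaleR_alg_tensor_def cA)
  show "r *\<^sub>R s *\<^sub>R x = (r * s) *\<^sub>R x"
    by (simp add: scaleR_alg_tensor_def cM)
  show "1 *\<^sub>R x = x"
    unfolding scaleR_alg_tensor_def by transfer simp
  show "sgn x = inverse (norm x) *\<^sub>R x"
    by (rule sgn_alg_tensor_def)
  show "dist x y = norm (x - y)"
    by (rule dist_alg_tensor_def)
  show "uniformity = (INF e\<in>{0<..}. principal {(x, y :: ('a, 'b) alg_tensor). dist x y < e})"
    by (rule uniformity_alg_tensor_def)
  show "open U \<longleftrightarrow> (\<forall>x\<in>U. \<forall>\<^sub>F (x', y) in uniformity. x' = x \<longrightarrow> y \<in> U)"
    for U :: "('a, 'b) alg_tensor set"
    by (rule open_alg_tensor_def)
  show "norm x = sqrt (inner x x)"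
    by (rule norm_alg_tensor_def)
  have cL: "cinner (x + y) z = cinner x z + cinner y z" for x y z :: "('a, 'b) alg_tensor"
    by (metis cC cR complex_cnj_add)
  have cLs: "cinner (c *\<^sub>C x) y = cnj c * cinner x y" for c and x y :: "('a, 'b) alg_tensor"
    by (metis cC cRs complex_cnj_mult)
  show "inner x y = inner y x"
    unfolding inner_alg_tensor_def by (subst cC) simp
  show "inner (x + y) z = inner x z + inner y z"
    by (simp add: inner_alg_tensor_def cL)
  show "inner (r *\<^sub>R x) y = r * inner x y"
    by (simp add: inner_alg_tensor_def scaleR_alg_tensor_def cLs)
  obtain E z where E: "finite E"
    "\<And>a b. Rep_alg_tensor x a b = (\<Sum>e\<in>E. cinner a (z e) * cinner b e)"
    "cinner x x = (\<Sum>e\<in>E. cinner (z e) (z e))"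
    by (rule alg_tensor_orthonormal_right[of x]) blast
  have xx: "inner x x = (\<Sum>e\<in>E. inner (z e) (z e))"
    by (simp add: inner_alg_tensor_def E(3) cinner_self)
  then show "0 \<le> inner x x"
    by (simp add: sum_nonneg)
  show "inner x x = 0 \<longleftrightarrow> x = 0"
  proof
    assume "inner x x = 0"
    then have "\<forall>e\<in>E. z e = 0"
      by (simp add: xx sum_nonneg_eq_0_iff E(1))
    then have "Rep_alg_tensor x = Rep_alg_tensor 0"
      by (intro ext) (simp add: E(2) zero_alg_tensor.rep_eq)
    then show "x = 0"
      by (simp only: Rep_alg_tensor_inject)
  next
    assume "x = 0"
    then show "inner x x = 0"
      by (simp add: inner_alg_tensor_def cinner_alg_tensor_def zero_alg_tensor.rep_eq case_prod_unfold)
  qed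
qed

end

type_synonym ('a, 'b) hilbert_tensor = "('a, 'b) alg_tensor completion"

lift_definition elem_tensor :: "'a::complex_inner \<Rightarrow> 'b::complex_inner \<Rightarrow> ('a, 'b) alg_tensor"
  is "\<lambda>x y a b. cinner a x * cinner b y"
  by (rule image_eqI[of _ _ "[(_, _)]"]) (auto simp: tensor_fun_def)

definition tensor :: "'a::complex_inner \<Rightarrow> 'b::complex_inner \<Rightarrow> ('a, 'b) hilbert_tensor"
    (infixr \<open>\<otimes>\<^sub>h\<close> 70)
  where "x \<otimes>\<^sub>h y = embed_completion (elem_tensor x y)"

text \<open>
  Existence and uniqueness of this operator are \<open>tensor_op_clin_ops\<close>, \<open>tensor_op_apply\<close> and
  \<open>clin_ops_tensor_eqI\<close> below.
\<close>
definition tensor_op ::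
    "('a::complex_inner \<Rightarrow>\<^sub>L 'a) \<Rightarrow> ('b::complex_inner \<Rightarrow>\<^sub>L 'b) \<Rightarrow>
      (('a, 'b) hilbert_tensor \<Rightarrow>\<^sub>L ('a, 'b) hilbert_tensor)"
  where "tensor_op S T =
    (THE R. R \<in> clin_ops \<and> (\<forall>x y. blinfun_apply R (x \<otimes>\<^sub>h y) = S x \<otimes>\<^sub>h T y))"

lemma cinner_elem_tensor: "cinner (elem_tensor x y) F = Rep_alg_tensor F x y"
  using cinner_alg_tensor_eq[of "elem_tensor x y" "[(x, y)]" F]
  by (simp add: elem_tensor.rep_eq tensor_fun_def)

lemma cinner_tensor: "cinner (x \<otimes>\<^sub>h y) (x' \<otimes>\<^sub>h y') = cinner x x' * cinner y y'"
  by (simp add: tensor_def cinner_elem_tensor elem_tensor.rep_eq)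

lemma tensor_fun_eq_sum:
  "Rep_alg_tensor F = tensor_fun us \<Longrightarrow> F = (\<Sum>(x, y)\<leftarrow>us. elem_tensor x y)"
proof (induction us arbitrary: F)
  case Nil
  then have "Rep_alg_tensor F = Rep_alg_tensor 0"
    by (intro ext) (simp add: tensor_fun_def zero_alg_tensor.rep_eq)
  then show ?case
    by (simp add: Rep_alg_tensor_inject)
next
  case (Cons p us)
  have "tensor_fun us \<in> range tensor_fun"
    by simp
  from Cons.IH[OF Abs_alg_tensor_inverse[OF this]]
  have G: "(\<Sum>(x, y)\<leftarrow>us. elem_tensor x y) = Abs_alg_tensor (tensor_fun us)"
    by simp
  have "Rep_alg_tensor F = Rep_alg_tensor (elem_tensor (fst p) (snd p) + Abs_alg_tensor (tensor_fun us))"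
    by (intro ext) (simp add: Cons.prems plus_alg_tensor.rep_eq elem_tensor.rep_eq
        Abs_alg_tensor_inverse, simp add: tensor_fun_def case_prod_unfold)
  then have "F = elem_tensor (fst p) (snd p) + Abs_alg_tensor (tensor_fun us)"
    by (simp only: Rep_alg_tensor_inject)
  then show ?case
    using G by (simp add: case_prod_unfold)
qed

lemma tensor_total:
  fixes M :: "('a::complex_inner, 'b::complex_inner) hilbert_tensor set"
  assumes M: "csubspace M" "closed M" and xy: "\<And>x y. x \<otimes>\<^sub>h y \<in> M"
  shows "M = UNIV"
proof -
  have list: "embed_completion (\<Sum>(x, y)\<leftarrow>us. elem_tensor x y) \<in> M" for us
  proof (induction us)
    case Nil
    show ?case
      using M(1) embed_completion_diff[of "0 :: ('a, 'b) alg_tensor" 0] by (simp add: csubspace_def)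
  next
    case (Cons p us)
    then show ?case
      using M(1) xy[of "fst p" "snd p"]
      by (simp add: csubspace_def embed_completion_add tensor_def case_prod_unfold)
  qed
  have "embed_completion F \<in> M" for F
  proof -
    obtain us where "Rep_alg_tensor F = tensor_fun us"
      using Rep_alg_tensor[of F] by auto
    from tensor_fun_eq_sum[OF this] list show ?thesis by simp
  qed
  then have "closure (range embed_completion) \<subseteq> M"
    by (intro closure_minimal M(2)) auto
  then show ?thesis
    by (simp add: closure_range_embed_completion top.extremum_unique)
qed

lemma cauchy_rel_bounded_linear:
  assumes f: "bounded_linear f" and XY: "cauchy_rel X Y"
  shows "cauchy_rel (\<lambda>n. f (X n)) (\<lambda>n. f (Y n))"
proof -
  have "(\<lambda>n. f (X n - Y n)) \<longlonglongrightarrow> 0"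
    using XY by (intro bounded_linear.tendsto_zero[OF f]) (simp add: cauchy_rel_def)
  then show ?thesis
    using XY by (simp add: cauchy_rel_def bounded_linear.Cauchy[OF f] linear_diff[OF bounded_linear.linear[OF f]])
qed

lemma completion_extension:
  fixes f :: "'a::complex_inner \<Rightarrow> 'b::complex_inner"
  assumes f: "bounded_linear f" and scale: "\<And>c x. f (c *\<^sub>C x) = c *\<^sub>C f x"
  shows "\<exists>T\<in>clin_ops. \<forall>x. blinfun_apply T (embed_completion x) = embed_completion (f x)"
proof -
  define g where "g z = abs_completion (\<lambda>n. f (rep_completion z n))" for z
  have g: "g (abs_completion X) = abs_completion (\<lambda>n. f (X n))" if X: "cauchy_rel X X" for X
  proof -
    have "cauchy_rel (rep_completion (abs_completion X)) X"
      using Quotient3_rep_abs[OF Quotient3_completion, OF X] .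
    from cauchy_rel_bounded_linear[OF f this] show ?thesis
      unfolding g_def using Quotient3_rel[OF Quotient3_completion] by blast
  qed
  note cr = cauchy_rel_bounded_linear[OF f]
  have add: "g (x + y) = g x + g y" for x y
  proof -
    obtain X Y where X: "cauchy_rel X X" "x = abs_completion X" and Y: "cauchy_rel Y Y" "y = abs_completion Y"
      by (metis completion_cases)
    have XY: "cauchy_rel (\<lambda>n. X n + Y n) (\<lambda>n. X n + Y n)"
      using X(1) Y(1) by (auto simp: cauchy_rel_def Cauchy_add')
    show ?thesis
      by (simp add: X(2) Y(2) g[OF X(1)] g[OF Y(1)] plus_completion.abs_eq[OF X(1) Y(1)]
          plus_completion.abs_eq[OF cr[OF X(1)] cr[OF Y(1)]] g[OF XY] linear_add[OF bounded_linear.linear[OF f]])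
  qed
  have sc: "g (c *\<^sub>C x) = c *\<^sub>C g x" for c x
  proof -
    obtain X where X: "cauchy_rel X X" "x = abs_completion X"
      by (metis completion_cases)
    have cX: "cauchy_rel (\<lambda>n. c *\<^sub>C X n) (\<lambda>n. c *\<^sub>C X n)"
      using X(1) by (auto simp: cauchy_rel_def Cauchy_scaleC)
    show ?thesis
      by (simp add: X(2) g[OF X(1)] scaleC_completion.abs_eq[OF X(1)]
          scaleC_completion.abs_eq[OF cr[OF X(1)]] g[OF cX] scale)
  qed
  obtain K where K: "\<And>x. norm (f x) \<le> norm x * K"
    using bounded_linear.bounded[OF f] by blast
  have bd: "norm (g x) \<le> norm x * K" for x
  proof -
    obtain X where X: "cauchy_rel X X" "x = abs_completion X"
      by (metis completion_cases)
    have "(\<lambda>n. norm (embed_completion (f (X n)))) \<longlonglongrightarrow> norm (g x)"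
      unfolding X(2) g[OF X(1)] by (intro tendsto_norm embed_completion_tendsto cr X)
    moreover have "(\<lambda>n. norm (embed_completion (X n)) * K) \<longlonglongrightarrow> norm x * K"
      unfolding X(2) by (intro tendsto_mult tendsto_const tendsto_norm embed_completion_tendsto X)
    ultimately show ?thesis
      by (rule LIMSEQ_le) (simp add: K)
  qed
  have bl: "bounded_linear g"
    by (rule bounded_linear_intro[of _ K]) (auto simp: add sc scaleR_scaleC bd)
  have "g (embed_completion x) = embed_completion (f x)" for x
    using g[of "\<lambda>_. x"] by (simp add: embed_completion.abs_eq cauchy_rel_def)
  then show ?thesis
    by (intro bexI[of _ "Blinfun g"]) (auto simp: clin_ops_def bounded_linear_Blinfun_apply[OF bl] sc)
qed

lift_definition alg_swap :: "('a::complex_inner, 'b::complex_inner) alg_tensor \<Rightarrow> ('b, 'a) alg_tensor"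
  is "\<lambda>F b a. F a b"
proof -
  fix F :: "'a \<Rightarrow> 'b \<Rightarrow> complex"
  assume "F \<in> range tensor_fun"
  then obtain us where "F = tensor_fun us" by blast
  then have "(\<lambda>b a. F a b) = tensor_fun (map (\<lambda>(x, y). (y, x)) us)"
    by (intro ext) (simp add: tensor_fun_def o_def case_prod_unfold mult.commute)
  then show "(\<lambda>b a. F a b) \<in> range tensor_fun" by simp
qed

lemma cinner_alg_swap: "cinner (alg_swap F) (alg_swap F) = cinner F F"
proof -
  obtain us where us: "Rep_alg_tensor F = tensor_fun us"
    using Rep_alg_tensor[of F] by auto
  have "Rep_alg_tensor (alg_swap F) = tensor_fun (map (\<lambda>(x, y). (y, x)) us)"
    by (intro ext) (simp add: alg_swap.rep_eq us tensor_fun_def o_def case_prod_unfold mult.commute)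
  from cinner_alg_tensor_eq[OF this] cinner_alg_tensor_eq[OF us] show ?thesis
    by (simp add: alg_swap.rep_eq o_def case_prod_unfold)
qed

lemma norm_alg_swap: "norm (alg_swap F) = norm F"
  by (simp add: norm_eq_sqrt_inner inner_cinner cinner_alg_swap)

lemma alg_map_left_exists:
  fixes S :: "'a::chilbert_space \<Rightarrow>\<^sub>L 'a"
  assumes S: "S \<in> clin_ops"
  shows "\<exists>f :: ('a, 'b::complex_inner) alg_tensor \<Rightarrow> ('a, 'b) alg_tensor.
    (\<forall>F a b. Rep_alg_tensor (f F) a b = Rep_alg_tensor F (adj S a) b) \<and>
    (\<forall>F. norm (f F) \<le> norm S * norm F)"
proof -
  have ex: "\<exists>G. \<forall>a b. Rep_alg_tensor G a b = Rep_alg_tensor F (adj S a) b"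
    for F :: "('a, 'b) alg_tensor"
  proof -
    obtain us where us: "Rep_alg_tensor F = tensor_fun us"
      using Rep_alg_tensor[of F] by auto
    have "tensor_fun (map (\<lambda>(x, y). (S x, y)) us) a b = tensor_fun us (adj S a) b" for a b
      by (simp add: tensor_fun_def o_def case_prod_unfold cinner_adj_left[OF S])
    then show ?thesis
      by (intro exI[of _ "Abs_alg_tensor (tensor_fun (map (\<lambda>(x, y). (S x, y)) us))"])
         (simp add: Abs_alg_tensor_inverse us)
  qed
  then obtain f :: "('a, 'b) alg_tensor \<Rightarrow> ('a, 'b) alg_tensor"
    where f: "\<And>F a b. Rep_alg_tensor (f F) a b = Rep_alg_tensor F (adj S a) b"
    by metis
  have "norm (f F) \<le> norm S * norm F" for F
  proof -
    obtain E :: "'b set" and z where E: "finite E" "orthonormal E"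
      "\<And>a b. Rep_alg_tensor F a b = (\<Sum>e\<in>E. cinner a (z e) * cinner b e)"
      "cinner F F = (\<Sum>e\<in>E. cinner (z e) (z e))"
      by (rule alg_tensor_orthonormal_right[of F]) blast
    have "cinner (f F) (f F) = (\<Sum>e\<in>E. cinner (S (z e)) (S (z e)))"
      by (rule cinner_alg_tensor_orthonormal[OF E(1,2)]) (simp add: f E(3) cinner_adj_left[OF S])
    then have "(norm (f F))\<^sup>2 = (\<Sum>e\<in>E. (norm (S (z e)))\<^sup>2)"
      by (simp add: power2_norm_eq_inner inner_cinner)
    also have "\<dots> \<le> (\<Sum>e\<in>E. (norm S * norm (z e))\<^sup>2)"
      by (intro sum_mono power_mono norm_blinfun norm_ge_zero)
    also have "\<dots> = (norm S)\<^sup>2 * (\<Sum>e\<in>E. (norm (z e))\<^sup>2)"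
      by (simp add: power_mult_distrib sum_distrib_left)
    also have "(\<Sum>e\<in>E. (norm (z e))\<^sup>2) = (norm F)\<^sup>2"
      by (simp add: power2_norm_eq_inner inner_cinner E(4))
    finally have "(norm (f F))\<^sup>2 \<le> (norm S * norm F)\<^sup>2"
      by (simp add: power_mult_distrib)
    then show ?thesis
      by (rule power2_le_imp_le) simp
  qed
  then show ?thesis
    using f by blast
qed

lemma tensor_op_exists:
  fixes S :: "'a::chilbert_space \<Rightarrow>\<^sub>L 'a" and T :: "'b::chilbert_space \<Rightarrow>\<^sub>L 'b"
  assumes S: "S \<in> clin_ops" and T: "T \<in> clin_ops"
  shows "\<exists>R\<in>clin_ops. \<forall>x y. blinfun_apply R (x \<otimes>\<^sub>h y) = S x \<otimes>\<^sub>h T y"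
proof -
  obtain f :: "('a, 'b) alg_tensor \<Rightarrow> ('a, 'b) alg_tensor"
    where f: "\<And>F a b. Rep_alg_tensor (f F) a b = Rep_alg_tensor F (adj S a) b"
      "\<And>F. norm (f F) \<le> norm S * norm F"
    using alg_map_left_exists[OF S] by blast
  obtain g :: "('b, 'a) alg_tensor \<Rightarrow> ('b, 'a) alg_tensor"
    where g: "\<And>F b a. Rep_alg_tensor (g F) b a = Rep_alg_tensor F (adj T b) a"
      "\<And>F. norm (g F) \<le> norm T * norm F"
    using alg_map_left_exists[OF T] by blast
  define h where "h F = f (alg_swap (g (alg_swap F)))" for F
  have h: "Rep_alg_tensor (h F) a b = Rep_alg_tensor F (adj S a) (adj T b)" for F a b
    by (simp add: h_def f g alg_swap.rep_eq)
  have eqI: "F = G" if "\<And>a b. Rep_alg_tensor F a b = Rep_alg_tensor G a b" for F G :: "('a, 'b) alg_tensor"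
    using that by (metis Rep_alg_tensor_inject ext)
  have add: "h (F + G) = h F + h G" for F G
    by (rule eqI) (simp add: h plus_alg_tensor.rep_eq)
  have scale: "h (c *\<^sub>C F) = c *\<^sub>C h F" for c F
    by (rule eqI) (simp add: h scaleC_alg_tensor.rep_eq)
  have elem: "h (elem_tensor x y) = elem_tensor (S x) (T y)" for x y
    by (rule eqI) (simp add: h elem_tensor.rep_eq cinner_adj_left[OF S] cinner_adj_left[OF T])
  have "norm (h F) \<le> norm F * (norm S * norm T)" for F
  proof -
    have "norm (h F) \<le> norm S * norm (g (alg_swap F))"
      unfolding h_def using f(2) by (metis norm_alg_swap)
    also have "\<dots> \<le> norm S * (norm T * norm F)"
      using g(2) by (intro mult_left_mono) (metis norm_alg_swap, simp)
    finally show ?thesis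
      by (simp add: mult_ac)
  qed
  then have "bounded_linear h"
    by (intro bounded_linear_intro[of _ "norm S * norm T"]) (auto simp: add scale scaleR_scaleC)
  from completion_extension[OF this scale] show ?thesis
    by (metis elem tensor_def)
qed

lemma clin_ops_tensor_eqI:
  fixes R :: "('a::complex_inner, 'b::complex_inner) hilbert_tensor \<Rightarrow>\<^sub>L 'c::complex_inner"
  assumes "R \<in> clin_ops" "R' \<in> clin_ops" "\<And>x y. blinfun_apply R (x \<otimes>\<^sub>h y) = R' (x \<otimes>\<^sub>h y)"
  shows "R = R'"
proof -
  have "closed {z. R z = R' z}"
    by (intro closed_Collect_eq blinfun.continuous_on continuous_on_const continuous_on_id)
  moreover have "csubspace {z. R z = R' z}"
    using assms(1,2) by (auto simp: csubspace_def clin_ops_def blinfun.add_right)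
  ultimately have "{z. R z = R' z} = UNIV"
    using assms(3) by (intro tensor_total) auto
  then show ?thesis
    by (intro blinfun_eqI) auto
qed

lemma
  fixes S :: "'a::chilbert_space \<Rightarrow>\<^sub>L 'a" and T :: "'b::chilbert_space \<Rightarrow>\<^sub>L 'b"
  assumes "S \<in> clin_ops" "T \<in> clin_ops"
  shows tensor_op_clin_ops: "tensor_op S T \<in> clin_ops"
    and tensor_op_apply: "tensor_op S T (x \<otimes>\<^sub>h y) = S x \<otimes>\<^sub>h T y"
proof -
  have "\<exists>!R. R \<in> clin_ops \<and> (\<forall>x y. blinfun_apply R (x \<otimes>\<^sub>h y) = S x \<otimes>\<^sub>h T y)"
  proof (rule ex_ex1I)
    show "\<exists>R. R \<in> clin_ops \<and> (\<forall>x y. blinfun_apply R (x \<otimes>\<^sub>h y) = S x \<otimes>\<^sub>h T y)"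
      using tensor_op_exists[OF assms] by blast
  qed (rule clin_ops_tensor_eqI, simp_all)
  from theI'[OF this] show "tensor_op S T \<in> clin_ops" "tensor_op S T (x \<otimes>\<^sub>h y) = S x \<otimes>\<^sub>h T y"
    by (auto simp: tensor_op_def)
qed

definition compact_ops :: "('a::complex_inner \<Rightarrow>\<^sub>L 'a) set"
  where "compact_ops = {T \<in> clin_ops. compact (closure (blinfun_apply T ` cball 0 1))}"

definition subalgebra :: "('a::complex_inner \<Rightarrow>\<^sub>L 'a) set \<Rightarrow> bool"
  where "subalgebra A \<longleftrightarrow> A \<subseteq> clin_ops \<and> csubspace A \<and> (\<forall>S\<in>A. \<forall>T\<in>A. S o\<^sub>L T \<in> A)"

definition diagonal :: "('a::complex_inner \<Rightarrow>\<^sub>L 'a) set \<Rightarrow> ('a \<Rightarrow>\<^sub>L 'a) set"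
  where "diagonal A = A \<inter> adj ` A"

text \<open>
  A norm-closed subalgebra with a contractive approximate identity in its diagonal. Instead of a net
  we use a proper filter on the operators themselves: a net gives the filter generated by its
  tails, and a proper filter containing the contractions of the diagonal gives a net in the usual way.
\<close>
definition operator_algebra :: "('a::complex_inner \<Rightarrow>\<^sub>L 'a) set \<Rightarrow> bool"
  where "operator_algebra A \<longleftrightarrow> subalgebra A \<and> closed A \<and>
    (\<exists>F. F \<noteq> bot \<and> (\<forall>\<^sub>F e in F. e \<in> diagonal A \<and> norm e \<le> 1) \<and>
      (\<forall>a\<in>A. ((\<lambda>e. e o\<^sub>L a) \<longlongrightarrow> a) F \<and> ((\<lambda>e. a o\<^sub>L e) \<longlongrightarrow> a) F))"

definition spatial_tensor ::
    "('a::complex_inner \<Rightarrow>\<^sub>L 'a) set \<Rightarrow> ('b::complex_inner \<Rightarrow>\<^sub>L 'b) set \<Rightarrow>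
      (('a, 'b) hilbert_tensor \<Rightarrow>\<^sub>L ('a, 'b) hilbert_tensor) set"
  where "spatial_tensor A B = closure (csubspace hull {tensor_op S T | S T. S \<in> A \<and> T \<in> B})"

definition isometrically_isomorphic ::
    "('a::complex_inner \<Rightarrow>\<^sub>L 'a) set \<Rightarrow> ('b::complex_inner \<Rightarrow>\<^sub>L 'b) set \<Rightarrow> bool"
  where "isometrically_isomorphic A B \<longleftrightarrow>
    (\<exists>\<phi>. \<phi> ` A = B \<and>
      (\<forall>S\<in>A. \<forall>T\<in>A. \<phi> (S + T) = \<phi> S + \<phi> T) \<and>
      (\<forall>c. \<forall>S\<in>A. \<phi> (c *\<^sub>C S) = c *\<^sub>C \<phi> S) \<and>
      (\<forall>S\<in>A. \<forall>T\<in>A. \<phi> (S o\<^sub>L T) = \<phi> S o\<^sub>L \<phi> T) \<and>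
      (\<forall>S\<in>A. norm (\<phi> S) = norm S))"

definition proj_inf :: "('a::complex_inner \<Rightarrow>\<^sub>L 'a) \<Rightarrow> ('a \<Rightarrow>\<^sub>L 'a) \<Rightarrow> ('a \<Rightarrow>\<^sub>L 'a)"
  where "proj_inf P Q = proj_onto (range (blinfun_apply P) \<inter> range (blinfun_apply Q))"

definition proj_sup :: "('a::complex_inner \<Rightarrow>\<^sub>L 'a) \<Rightarrow> ('a \<Rightarrow>\<^sub>L 'a) \<Rightarrow> ('a \<Rightarrow>\<^sub>L 'a)"
  where "proj_sup P Q = proj_onto (closure {P x + Q y | x y. True})"

text \<open>
  The library's strong operator topology lives on all bounded real-linear maps. It induces the
  strong operator topology on the complex-linear ones, which form a closed set, so
  closedness of a set of complex-linear operators does not depend on the ambient space.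
\<close>
definition subspace_lattice :: "('a::complex_inner \<Rightarrow>\<^sub>L 'a) set \<Rightarrow> bool"
  where "subspace_lattice L \<longleftrightarrow>
    (\<forall>P\<in>L. is_projection P) \<and> closedin strong_operator_topology L \<and>
    (\<forall>P\<in>L. \<forall>Q\<in>L. proj_inf P Q \<in> L \<and> proj_sup P Q \<in> L) \<and>
    0 \<in> L \<and> id_blinfun \<in> L"

definition csl :: "('a::complex_inner \<Rightarrow>\<^sub>L 'a) set \<Rightarrow> bool"
  where "csl L \<longleftrightarrow> subspace_lattice L \<and> (\<forall>P\<in>L. \<forall>Q\<in>L. P o\<^sub>L Q = Q o\<^sub>L P)"

definition Alg :: "('a::complex_inner \<Rightarrow>\<^sub>L 'a) set \<Rightarrow> ('a \<Rightarrow>\<^sub>L 'a) set"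
  where "Alg L = {T \<in> clin_ops. \<forall>P\<in>L. (id_blinfun - P) o\<^sub>L T o\<^sub>L P = 0}"

definition commutant :: "('a::complex_inner \<Rightarrow>\<^sub>L 'a) set \<Rightarrow> ('a \<Rightarrow>\<^sub>L 'a) set"
  where "commutant A = {T \<in> clin_ops. \<forall>S\<in>A. T o\<^sub>L S = S o\<^sub>L T}"

definition abelian_selfadjoint_subalgebra :: "('a::complex_inner \<Rightarrow>\<^sub>L 'a) set \<Rightarrow> bool"
  where "abelian_selfadjoint_subalgebra M \<longleftrightarrow>
    subalgebra M \<and> adj ` M \<subseteq> M \<and> (\<forall>S\<in>M. \<forall>T\<in>M. S o\<^sub>L T = T o\<^sub>L S)"

definition masa :: "('a::complex_inner \<Rightarrow>\<^sub>L 'a) set \<Rightarrow> bool"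
  where "masa M \<longleftrightarrow> abelian_selfadjoint_subalgebra M \<and>
    (\<forall>N. abelian_selfadjoint_subalgebra N \<longrightarrow> M \<subseteq> N \<longrightarrow> N = M)"

definition multiplicity_free :: "('a::complex_inner \<Rightarrow>\<^sub>L 'a) set \<Rightarrow> bool"
  where "multiplicity_free L \<longleftrightarrow> masa (commutant (commutant L))"

definition unitary :: "('a::complex_inner \<Rightarrow>\<^sub>L 'b::complex_inner) \<Rightarrow> bool"
  where "unitary V \<longleftrightarrow> V \<in> clin_ops \<and> adj V o\<^sub>L V = id_blinfun \<and> V o\<^sub>L adj V = id_blinfun"

end

theory Submission
  imports Defs
begin

text \<open>
  Write \<open>A\<^sub>i\<close> for \<open>Alg L\<^sub>i \<otimes> B\<^sub>i\<close> and \<open>\<P>\<^sub>i\<close> for the projections of the masa \<open>L\<^sub>i''\<close>. An isometric homomorphism maps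
  projections to contractive idempotents, that is, to projections. For \<open>P \<in> \<P>\<^sub>1\<close> the
  closed span of the ranges of the \<open>\<phi>(P \<otimes> k)\<close>, \<open>k\<close> of rank one, therefore reduces \<open>Q \<otimes> k\<close> for all
  \<open>Q \<in> \<P>\<^sub>2\<close>, and so it is the range of \<open>\<theta>(P) \<otimes> 1\<close> for some \<open>\<theta>(P) \<in> \<P>\<^sub>2\<close>. It follows that \<open>\<phi>\<close> intertwines
  multiplication by \<open>P \<otimes> 1\<close> with multiplication by \<open>\<theta>(P) \<otimes> 1\<close>, on both sides. Hence \<open>\<theta>\<close> is a Boolean isomorphism, and
  \<open>(1 - P) Alg L\<^sub>1 P = 0\<close> if and only if \<open>(1 - \<theta>(P)) Alg L\<^sub>2 \<theta>(P) = 0\<close>.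

  It remains to implement \<open>\<theta>\<close> by a unitary, on possibly nonseparable spaces. Call \<open>x\<close> and \<open>y\<close>
  matched if \<open>norm (P x) = norm (\<theta>(P) y)\<close> for all \<open>P\<close>; then \<open>\<theta>(P) y \<mapsto> P x\<close> extends to an isometry of
  cyclic subspaces, and a maximal orthogonal family of matched pairs gives the unitary. Matched
  pairs come from a Radon-Nikodym argument: after a Hahn decomposition, \<open>\<theta>(P) z \<mapsto> P x\<close> is a contraction \<open>B\<close>,
  and \<open>y\<close> is the image of \<open>z\<close> under the square root of \<open>B\<^sup>* B\<close>.
\<close>

subsection \<open>Complex-linear operators and projections\<close>

text \<open>\<open>B\<close> may lack a unit, so \<open>P \<otimes> 1\<close> is in general only a
  multiplier of \<open>A\<close> and \<open>\<phi>\<close> cannot be applied to it;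
  \<open>\<theta>(P)\<close> has to be recovered from the elements \<open>P \<otimes> k\<close>,
  which lie in \<open>A\<close> because \<open>B\<close> contains the compact operators. Nor is
  \<open>\<phi>\<close> assumed to respect adjoints: orthogonality on the second space comes from
  isometry alone.

  Multiplicity freeness makes the projections of \<open>L'\<close> a commuting family that is its
  own commutant among projections. It places them in \<open>L''\<close>, so that every self-adjoint
  element of \<open>A\<close> commutes with every \<open>P \<otimes> 1\<close>; hence the preimage
  of \<open>Q \<otimes> k\<close>, again a projection when \<open>k\<close> is one, can be moved
  past \<open>P \<otimes> 1\<close>. And it gives both Boolean algebras multiplicity one:
  projections onto cyclic subspaces belong to the family, so that equality of measures is all a
  unitary has to respect.

  On a nonseparable space there may be no vector whose measure dominates all others; hence a
  Radon-Nikodym argument below each nonzero projection, glued by Zorn's lemma.\<close>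

lemma clin_opsD: "T \<in> clin_ops \<Longrightarrow> blinfun_apply T (c *\<^sub>C x) = c *\<^sub>C T x"
  by (simp add: clin_ops_def)

lemma clin_ops_intros [intro]:
  shows "id_blinfun \<in> clin_ops"
    and "0 \<in> clin_ops"
    and "S \<in> clin_ops \<Longrightarrow> T \<in> clin_ops \<Longrightarrow> S + T \<in> clin_ops"
    and "S \<in> clin_ops \<Longrightarrow> T \<in> clin_ops \<Longrightarrow> S - T \<in> clin_ops"
    and "S \<in> clin_ops \<Longrightarrow> r *\<^sub>R S \<in> clin_ops"
    and "S \<in> clin_ops \<Longrightarrow> c *\<^sub>C S \<in> clin_ops"
    and "S \<in> clin_ops \<Longrightarrow> U \<in> clin_ops \<Longrightarrow> S o\<^sub>L U \<in> clin_ops"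
  by (auto simp: clin_ops_def scaleC_add_right scaleC_diff_right scaleR_scaleC scaleC_scaleC
      blinfun.add_left blinfun.diff_left blinfun.scaleR_left mult.commute)

lemma clin_ops_Blinfun:
  fixes f :: "'a::complex_inner \<Rightarrow> 'b::complex_inner"
  assumes "\<And>x y. f (x + y) = f x + f y" "\<And>c x. f (c *\<^sub>C x) = c *\<^sub>C f x"
    and "\<And>x. norm (f x) \<le> norm x * C"
  shows "Blinfun f \<in> clin_ops" and "blinfun_apply (Blinfun f) x = f x"
proof -
  have "bounded_linear f"
    by (rule bounded_linear_intro[of _ C]) (auto simp: assms(1,3), simp add: scaleR_scaleC assms(2))
  then show "Blinfun f \<in> clin_ops" "blinfun_apply (Blinfun f) x = f x"
    by (auto simp: clin_ops_def bounded_linear_Blinfun_apply assms(2))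
qed

lemma closed_clin_ops: "closed (clin_ops :: ('a::complex_inner \<Rightarrow>\<^sub>L 'b::complex_inner) set)"
proof -
  have "clin_ops = (\<Inter>c. \<Inter>x. {T :: 'a \<Rightarrow>\<^sub>L 'b. blinfun_apply T (c *\<^sub>C x) = c *\<^sub>C T x})"
    by (auto simp: clin_ops_def)
  also have "closed \<dots>"
    by (intro closed_INT ballI closed_Collect_eq bounded_linear.continuous_on[OF bounded_linear_scaleC]
        blinfun.continuous_on continuous_on_id continuous_on_const)
  finally show ?thesis .
qed

lemma blinfun_compose_apply_eq: "S o\<^sub>L T = U o\<^sub>L V \<Longrightarrow> blinfun_apply S (T x) = U (V x)"
  by (metis blinfun_apply_blinfun_compose)

lemma blinfun_compose_assoc: "(S o\<^sub>L T) o\<^sub>L U = S o\<^sub>L (T o\<^sub>L U)"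
  by (rule blinfun_eqI) simp

lemma compose_id: "a o\<^sub>L id_blinfun = a" "id_blinfun o\<^sub>L a = a"
  by (auto intro: blinfun_eqI)

lemma norm_compose_le: "norm S \<le> a \<Longrightarrow> norm T \<le> b \<Longrightarrow> norm (S o\<^sub>L T) \<le> a * b"
  by (meson norm_blinfun_compose mult_mono norm_ge_zero order_trans)

lemma adj_adj: "T \<in> clin_ops \<Longrightarrow> adj (adj T) = T"
  for T :: "'a::chilbert_space \<Rightarrow>\<^sub>L 'b::chilbert_space"
  by (rule adj_eqI) (simp add: cinner_adj_right)

lemma adj_compose:
  fixes T :: "'a::chilbert_space \<Rightarrow>\<^sub>L 'b::chilbert_space" and S :: "'b \<Rightarrow>\<^sub>L 'c::chilbert_space"
  shows "S \<in> clin_ops \<Longrightarrow> T \<in> clin_ops \<Longrightarrow> adj (S o\<^sub>L T) = adj T o\<^sub>L adj S"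
  by (rule adj_eqI) (simp add: cinner_adj_left)

lemma adj_selfI: "(\<And>x y. cinner (blinfun_apply T x) y = cinner x (T y)) \<Longrightarrow> adj T = T"
  by (rule adj_eqI)

lemma cinner_self_adj:
  fixes T :: "'a::chilbert_space \<Rightarrow>\<^sub>L 'a"
  shows "T \<in> clin_ops \<Longrightarrow> adj T = T \<Longrightarrow> cinner (T x) y = cinner x (T y)"
  by (metis cinner_adj_left)

lemma cinner_swap_zero: "cinner x y = 0 \<Longrightarrow> cinner y x = 0"
  by (subst cinner_commute) simp

lemma power2_norm_add_orth:
  "cinner x y = 0 \<Longrightarrow> (norm (x + y))\<^sup>2 = (norm x)\<^sup>2 + (norm y)\<^sup>2" for x y :: "'a::complex_inner"
  by (simp add: power2_norm_eq_inner inner_cinner cinner_add_left cinner_add_right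
      cinner_swap_zero[of x y])

section \<open>Orthogonal projections\<close>

lemma
  assumes "is_projection P"
  shows proj_clin_ops: "P \<in> clin_ops"
    and proj_idem: "blinfun_apply P (P x) = P x"
    and proj_adj: "adj P = P"
  using assms by (auto simp: is_projection_def blinfun_apply_blinfun_compose[symmetric])

lemma proj_cinner: "is_projection P \<Longrightarrow> cinner (blinfun_apply P x) y = cinner x (P y)"
  for P :: "'a::chilbert_space \<Rightarrow>\<^sub>L 'a"
  by (simp add: cinner_self_adj proj_adj proj_clin_ops)

lemma is_projectionI:
  assumes "P \<in> clin_ops" "\<And>x. blinfun_apply P (P x) = P x" "\<And>x y. cinner (P x) y = cinner x (P y)"
  shows "is_projection P"
  using assms by (auto simp: is_projection_def intro: adj_selfI blinfun_eqI)

lemma is_projection_id [simp]: "is_projection id_blinfun"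
  by (auto intro: is_projectionI)

lemma is_projection_zero [simp]: "is_projection 0"
  by (auto intro: is_projectionI)

lemma is_projection_compl:
  fixes P :: "'a::chilbert_space \<Rightarrow>\<^sub>L 'a"
  assumes "is_projection P"
  shows "is_projection (id_blinfun - P)"
  using assms
  by (intro is_projectionI)
     (auto simp: blinfun.diff_left blinfun.diff_right proj_clin_ops proj_idem cinner_diff_left
       cinner_diff_right proj_cinner)

lemma is_projection_compose:
  fixes P :: "'a::chilbert_space \<Rightarrow>\<^sub>L 'a"
  assumes P: "is_projection P" and Q: "is_projection Q" and PQ: "P o\<^sub>L Q = Q o\<^sub>L P"
  shows "is_projection (P o\<^sub>L Q)"
proof (rule is_projectionI)
  have c: "P (Q x) = Q (P x)" for x
    by (rule blinfun_compose_apply_eq) (rule PQ)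
  show "(P o\<^sub>L Q) ((P o\<^sub>L Q) x) = (P o\<^sub>L Q) x" for x
    by (simp add: c proj_idem[OF P] proj_idem[OF Q])
  show "cinner ((P o\<^sub>L Q) x) y = cinner x ((P o\<^sub>L Q) y)" for x y
    by (simp add: proj_cinner[OF P] proj_cinner[OF Q] c)
qed (use P Q in \<open>auto simp: proj_clin_ops\<close>)

lemma proj_pythagoras:
  fixes P :: "'a::chilbert_space \<Rightarrow>\<^sub>L 'a"
  assumes "is_projection P"
  shows "(norm x)\<^sup>2 = (norm (P x))\<^sup>2 + (norm (x - P x))\<^sup>2"
  using power2_norm_add_orth[of "P x" "x - P x"]
  by (simp add: cinner_diff_right proj_cinner[OF assms] proj_idem[OF assms])

text \<open>The operator on the left is the join of \<open>P\<close> and \<open>Q\<close> in De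
  Morgan form, built only from products and complements, the operations that \<open>\<theta>\<close>
  is known to preserve.\<close>

lemma proj_add_orthogonal:
  fixes P Q :: "'c::chilbert_space \<Rightarrow>\<^sub>L 'c"
  assumes "is_projection P" "\<And>v. P (Q v) = 0"
  shows "(norm ((id_blinfun - ((id_blinfun - P) o\<^sub>L (id_blinfun - Q))) v))\<^sup>2
    = (norm (P v))\<^sup>2 + (norm (Q v))\<^sup>2"
proof -
  have "(id_blinfun - ((id_blinfun - P) o\<^sub>L (id_blinfun - Q))) v = P v + Q v"
    by (simp add: blinfun.diff_left blinfun.diff_right assms(2))
  moreover have "cinner (P v) (Q v) = 0"
    by (simp add: proj_cinner[OF assms(1)] assms(2))
  ultimately show ?thesis
    by (simp add: power2_norm_add_orth)
qed

lemma proj_norm_le: "is_projection P \<Longrightarrow> norm (blinfun_apply P x) \<le> norm x"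
  for P :: "'a::chilbert_space \<Rightarrow>\<^sub>L 'a"
  by (rule power2_le_imp_le) (auto simp: proj_pythagoras[of P x])

lemma norm_proj_le_1: "is_projection P \<Longrightarrow> norm P \<le> 1" for P :: "'a::chilbert_space \<Rightarrow>\<^sub>L 'a"
  by (rule norm_blinfun_bound) (auto simp: proj_norm_le)

lemma proj_cinner_norm: "is_projection P \<Longrightarrow> cinner x (blinfun_apply P x) = complex_of_real ((norm (P x))\<^sup>2)"
  for P :: "'a::chilbert_space \<Rightarrow>\<^sub>L 'a"
  by (metis cinner_self_norm proj_cinner proj_idem)

lemma proj_range_iff: "is_projection P \<Longrightarrow> x \<in> range (blinfun_apply P) \<longleftrightarrow> P x = x"
  by (metis proj_idem rangeE rangeI)

text \<open>Translates the order by ranges, to which Zorn's lemma is applied, into an equation that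
  \<open>\<theta>\<close> preserves.\<close>

lemma proj_range_subset_iff:
  assumes "is_projection P" "is_projection Q"
  shows "range (blinfun_apply P) \<subseteq> range (blinfun_apply Q) \<longleftrightarrow> Q o\<^sub>L P = P"
proof
  assume "range P \<subseteq> range Q"
  then show "Q o\<^sub>L P = P"
    by (intro blinfun_eqI) (auto simp: subset_iff proj_range_iff[OF assms(2)])
next
  assume "Q o\<^sub>L P = P"
  then show "range P \<subseteq> range Q"
    by (metis blinfun_apply_blinfun_compose image_subsetI rangeI)
qed

text \<open>For \<open>n\<close> in the kernel and \<open>y\<close> in the range, \<open>norm y \<le> norm (y + c *\<^sub>C n)\<close> for all \<open>c\<close>, so
  \<open>n\<close> and \<open>y\<close> are orthogonal.\<close>
lemma contractive_idempotent_is_projection: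
  fixes E :: "'a::chilbert_space \<Rightarrow>\<^sub>L 'a"
  assumes E: "E \<in> clin_ops" and idem: "E o\<^sub>L E = E" and nE: "norm E \<le> 1"
  shows "is_projection E"
proof -
  have ide: "E (E x) = E x" for x
    using idem by (metis blinfun_apply_blinfun_compose)
  have orth: "cinner n y = 0" if n: "E n = 0" and y: "E y = y" for n y
  proof (cases "n = 0")
    case False
    \<comment> \<open>The coefficient that makes \<open>y + c *\<^sub>C n\<close> orthogonal to
      \<open>n\<close>, so that its norm is minimal.\<close>
    define c where "c = - (cinner n y / cinner n n)"
    have nn: "cinner n n \<noteq> 0"
      using False by (simp add: cinner_eq_zero_iff)
    have "E (y + c *\<^sub>C n) = y"
      by (simp add: blinfun.add_right clin_opsD[OF E] n y)
    then have "norm y \<le> norm (y + c *\<^sub>C n)"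
      using norm_blinfun[of E "y + c *\<^sub>C n"] nE
      by (metis mult_left_le_one_le mult.commute norm_ge_zero order_trans)
    moreover have "cinner (c *\<^sub>C n) (y + c *\<^sub>C n) = 0"
      using nn by (simp add: cinner_add_right cinner_scaleC_left cinner_scaleC_right c_def)
    then have "(norm (- (c *\<^sub>C n) + (y + c *\<^sub>C n)))\<^sup>2 = (norm (- (c *\<^sub>C n)))\<^sup>2 + (norm (y + c *\<^sub>C n))\<^sup>2"
      by (intro power2_norm_add_orth) simp
    then have "(norm y)\<^sup>2 = (norm (c *\<^sub>C n))\<^sup>2 + (norm (y + c *\<^sub>C n))\<^sup>2"
      by simp
    ultimately have "norm (c *\<^sub>C n) = 0"
      using power_mono[of "norm y" "norm (y + c *\<^sub>C n)" 2] by auto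
    then show ?thesis
      using False nn by (auto simp: norm_scaleC c_def)
  qed simp
  show ?thesis
  proof (rule is_projectionI[OF E ide])
    fix x y
    have "cinner (x - E x) (E y) = 0" "cinner (y - E y) (E x) = 0"
      by (auto intro!: orth simp: blinfun.diff_right ide)
    then show "cinner (E x) y = cinner x (E y)"
      by (metis cinner_diff_left cinner_diff_right cinner_swap_zero eq_iff_diff_eq_0)
  qed
qed

subsection \<open>Closed linear spans\<close>

lemma csubspaceD:
  assumes "csubspace S"
  shows "0 \<in> S" "x \<in> S \<Longrightarrow> y \<in> S \<Longrightarrow> x + y \<in> S" "x \<in> S \<Longrightarrow> c *\<^sub>C x \<in> S"
  using assms by (auto simp: csubspace_def)

lemma csubspace_hull: "csubspace (csubspace hull G)"
  by (rule hull_in) (auto simp: csubspace_def)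

text \<open>Continuity of scaling is a hypothesis because the lemma serves both vectors and
  operators, and \<open>blinfun\<close> carries \<open>scaleC\<close> without being a
  \<open>complex_inner\<close> space.\<close>

lemma csubspace_closure:
  fixes S :: "'a::{real_normed_vector, scaleC} set"
  assumes S: "csubspace S" and cont: "\<And>c. continuous_on UNIV (scaleC c :: 'a \<Rightarrow> 'a)"
  shows "csubspace (closure S)"
  unfolding csubspace_def
proof (intro conjI ballI allI)
  show "0 \<in> closure S"
    using csubspaceD(1)[OF S] closure_subset by blast
  fix x y assume "x \<in> closure S" "y \<in> closure S"
  then obtain f g where "\<And>n. f n \<in> S" "f \<longlonglongrightarrow> x" "\<And>n. g n \<in> S" "g \<longlonglongrightarrow> y"
    by (metis closure_sequential)
  then show "x + y \<in> closure S"
    unfolding closure_sequential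
    by (intro exI[of _ "\<lambda>n. f n + g n"]) (auto intro: tendsto_add csubspaceD(2)[OF S])
next
  fix c x assume "x \<in> closure S"
  then obtain f where f: "\<And>n. f n \<in> S" "f \<longlonglongrightarrow> x"
    by (metis closure_sequential)
  have "(\<lambda>n. c *\<^sub>C f n) \<longlonglongrightarrow> c *\<^sub>C x"
    using continuous_on_tendsto_compose[OF cont f(2)] by simp
  then show "c *\<^sub>C x \<in> closure S"
    unfolding closure_sequential using f by (auto intro!: exI[of _ "\<lambda>n. c *\<^sub>C f n"] csubspaceD(3)[OF S])
qed

lemma continuous_scaleC: "continuous_on UNIV (scaleC c :: 'a \<Rightarrow> 'a::complex_inner)"
  by (rule linear_continuous_on[OF bounded_linear_scaleC])

lemma bounded_linear_scaleC_blinfun: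
  "bounded_linear (scaleC c :: ('a::real_normed_vector \<Rightarrow>\<^sub>L 'b::complex_inner) \<Rightarrow> _)"
proof (rule bounded_linear_intro[of _ "cmod c"])
  fix T :: "'a \<Rightarrow>\<^sub>L 'b"
  show "norm (c *\<^sub>C T) \<le> norm T * cmod c"
  proof (rule norm_blinfun_bound)
    show "norm ((c *\<^sub>C T) x) \<le> norm T * cmod c * norm x" for x
      using mult_left_mono[OF norm_blinfun[of T x], of "cmod c"] by (simp add: norm_scaleC mult_ac)
  qed simp
qed (auto intro!: blinfun_eqI simp: blinfun.add_left blinfun.scaleR_left scaleC_add_right
    scaleR_scaleC scaleC_scaleC mult.commute)

lemma continuous_scaleC_blinfun:
  "continuous_on UNIV (scaleC c :: ('a::real_normed_vector \<Rightarrow>\<^sub>L 'b::complex_inner) \<Rightarrow> _)"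
  by (rule linear_continuous_on[OF bounded_linear_scaleC_blinfun])

definition cspan_closure :: "'a::{real_normed_vector, scaleC} set \<Rightarrow> 'a set"
  where "cspan_closure G = closure (csubspace hull G)"

lemma cspan_closure_minimal: "csubspace X \<Longrightarrow> closed X \<Longrightarrow> G \<subseteq> X \<Longrightarrow> cspan_closure G \<subseteq> X"
  unfolding cspan_closure_def by (meson closure_minimal hull_minimal)

lemma cspan_closure_superset: "G \<subseteq> cspan_closure G"
  unfolding cspan_closure_def by (meson closure_subset hull_subset order_trans)

lemma cspan_closureI: "x \<in> G \<Longrightarrow> x \<in> cspan_closure G"
  using cspan_closure_superset by blast

lemma closed_cspan_closure: "closed (cspan_closure G)"
  by (simp add: cspan_closure_def)

lemma csubspace_cspan_closure: "csubspace (cspan_closure G)" for G :: "'a::complex_inner set"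
  unfolding cspan_closure_def by (rule csubspace_closure[OF csubspace_hull continuous_scaleC])

lemma csubspace_cspan_closure_blinfun:
  "csubspace (cspan_closure G)" for G :: "('a::real_normed_vector \<Rightarrow>\<^sub>L 'b::complex_inner) set"
  unfolding cspan_closure_def by (rule csubspace_closure[OF csubspace_hull continuous_scaleC_blinfun])

lemma
  assumes "T \<in> clin_ops" "csubspace M" "closed M"
  shows csubspace_vimage: "csubspace {x. blinfun_apply T x \<in> M}"
    and closed_vimage_blinfun: "closed {x. blinfun_apply T x \<in> M}"
proof -
  show "csubspace {x. blinfun_apply T x \<in> M}"
    using assms(1,2) by (auto simp: csubspace_def blinfun.add_right clin_opsD)
  have "closed (blinfun_apply T -` M)"
    by (rule closed_vimage[OF assms(3)]) (intro blinfun.continuous_on continuous_on_const continuous_on_id)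
  then show "closed {x. blinfun_apply T x \<in> M}"
    by (simp add: vimage_def)
qed

lemma cspan_closure_invariant:
  fixes T :: "'a::complex_inner \<Rightarrow>\<^sub>L 'a"
  assumes "T \<in> clin_ops" "\<And>x. x \<in> G \<Longrightarrow> T x \<in> cspan_closure G" "x \<in> cspan_closure G"
  shows "T x \<in> cspan_closure G"
proof -
  have "cspan_closure G \<subseteq> {x. T x \<in> cspan_closure G}"
    by (intro cspan_closure_minimal csubspace_vimage closed_vimage_blinfun assms(1)
        csubspace_cspan_closure closed_cspan_closure) (use assms(2) in blast)
  then show ?thesis using assms(3) by blast
qed

lemma clin_ops_eq_on_cspan_closure:
  fixes S T :: "'a::complex_inner \<Rightarrow>\<^sub>L 'b::complex_inner"
  assumes "S \<in> clin_ops" "T \<in> clin_ops" "\<And>x. x \<in> G \<Longrightarrow> S x = T x" "x \<in> cspan_closure G"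
  shows "S x = T x"
proof -
  have "cspan_closure G \<subseteq> {x. (S - T) x \<in> {0}}"
    by (intro cspan_closure_minimal csubspace_vimage closed_vimage_blinfun)
       (use assms in \<open>auto simp: csubspace_def blinfun.diff_left\<close>)
  then show ?thesis using assms(4) by (auto simp: blinfun.diff_left)
qed

abbreviation proj_cspan :: "'a::complex_inner set \<Rightarrow> ('a \<Rightarrow>\<^sub>L 'a)"
  where "proj_cspan G \<equiv> proj_onto (cspan_closure G)"

lemma
  fixes G :: "'a::chilbert_space set"
  shows is_projection_cspan: "is_projection (proj_cspan G)"
    and range_proj_cspan: "range (blinfun_apply (proj_cspan G)) = cspan_closure G"
  using is_projection_proj_onto[OF csubspace_cspan_closure closed_cspan_closure]
    range_proj_onto[OF csubspace_cspan_closure closed_cspan_closure] by auto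

lemma proj_cspan_fix: "x \<in> cspan_closure G \<Longrightarrow> proj_cspan G x = x" for G :: "'a::chilbert_space set"
  by (metis is_projection_cspan range_proj_cspan proj_range_iff)

lemma proj_cspan_mem: "proj_cspan G x \<in> cspan_closure G" for G :: "'a::chilbert_space set"
  by (metis range_proj_cspan rangeI)

lemma proj_cspan_compose:
  fixes G :: "'a::chilbert_space set"
  assumes "T \<in> clin_ops" "\<And>x. x \<in> G \<Longrightarrow> T x = x"
  shows "T o\<^sub>L proj_cspan G = proj_cspan G"
  by (rule blinfun_eqI)
     (use clin_ops_eq_on_cspan_closure[of T id_blinfun G] assms proj_cspan_mem in auto)

lemma proj_cspan_orthogonal:
  fixes G :: "'a::chilbert_space set"
  assumes "\<And>g. g \<in> G \<Longrightarrow> cinner g x = 0"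
  shows "proj_cspan G x = 0"
proof -
  have "closed {y. cinner y x = 0}"
    by (intro closed_Collect_eq bounded_bilinear.continuous_on[OF bounded_bilinear_cinner]
        continuous_on_id continuous_on_const)
  then have "cspan_closure G \<subseteq> {y. cinner y x = 0}"
    using assms by (intro cspan_closure_minimal)
      (auto simp: csubspace_def cinner_add_left cinner_scaleC_left)
  then have "cinner (proj_cspan G x) x = 0"
    using proj_cspan_mem by blast
  then have "cinner (proj_cspan G x) (proj_cspan G x) = 0"
    by (simp add: proj_cinner[OF is_projection_cspan] proj_idem[OF is_projection_cspan])
  then show ?thesis
    by (simp only: cinner_eq_zero_iff)
qed

lemma cspan_closure_eq_UNIV_iff:
  fixes G :: "'a::chilbert_space set"
  shows "cspan_closure G = UNIV \<longleftrightarrow> proj_cspan G = id_blinfun"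
proof
  assume "cspan_closure G = UNIV"
  then show "proj_cspan G = id_blinfun"
    using proj_cspan_fix[of _ G] by (intro blinfun_eqI) simp
next
  assume "proj_cspan G = id_blinfun"
  then show "cspan_closure G = UNIV"
    using range_proj_cspan[of G] by auto
qed

text \<open>An invariant subspace of a self-adjoint operator is reducing: the adjoint of
  \<open>E T E = T E\<close> is \<open>E T E = E T\<close>.\<close>

lemma proj_commute_invariant:
  fixes E T :: "'a::chilbert_space \<Rightarrow>\<^sub>L 'a"
  assumes E: "is_projection E" and T: "T \<in> clin_ops" "adj T = T"
    and inv: "\<And>x. E (T (E x)) = T (E x)"
  shows "E o\<^sub>L T = T o\<^sub>L E"
proof (rule blinfun_eqI)
  fix x
  have "E (T x) = T (E x)"
  proof (rule cinner_ext)
    fix z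
    have "cinner z (E (T x)) = cinner (T (E z)) x"
      by (simp add: proj_cinner[OF E] cinner_self_adj[OF T])
    also have "\<dots> = cinner (E (T (E z))) x"
      by (simp add: inv)
    also have "\<dots> = cinner z (E (T (E x)))"
      by (simp only: proj_cinner[OF E] cinner_self_adj[OF T])
    also have "\<dots> = cinner z (T (E x))"
      by (simp only: inv)
    finally show "cinner z (E (T x)) = cinner z (T (E x))" .
  qed
  then show "(E o\<^sub>L T) x = (T o\<^sub>L E) x" by simp
qed

lemma proj_cspan_commute:
  fixes T :: "'a::chilbert_space \<Rightarrow>\<^sub>L 'a"
  assumes T: "T \<in> clin_ops" "adj T = T" and inv: "\<And>x. x \<in> G \<Longrightarrow> T x \<in> cspan_closure G"
  shows "proj_cspan G o\<^sub>L T = T o\<^sub>L proj_cspan G"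
  using cspan_closure_invariant[OF T(1) inv] proj_cspan_mem
  by (intro proj_commute_invariant is_projection_cspan T proj_cspan_fix) blast

subsection \<open>Extending a contraction from spanning vectors\<close>

text \<open>The \<open>u i\<close> may be linearly dependent, so a relation is extended instead of a
  function: the inequality makes the closure \<open>N\<close> of the graph single-valued and
  contractive on a closed domain, and the operator is extended by zero on the orthogonal complement.
  The last clause records this zero extension.\<close>

lemma contraction_extension:
  fixes u :: "'i \<Rightarrow> 'b::chilbert_space" and w :: "'i \<Rightarrow> 'a::chilbert_space"
  assumes le: "\<And>J c. finite J \<Longrightarrow> J \<subseteq> I \<Longrightarrow>
      norm (\<Sum>i\<in>J. c i *\<^sub>C w i) \<le> norm (\<Sum>i\<in>J. c i *\<^sub>C u i)"
  shows "\<exists>B\<in>clin_ops. norm B \<le> 1 \<and> (\<forall>i\<in>I. blinfun_apply B (u i) = w i) \<and>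
    (\<forall>x. (\<forall>i\<in>I. cinner (u i) x = 0) \<longrightarrow> B x = 0)"
proof -
  define G where "G = {(\<Sum>i\<in>J. c i *\<^sub>C u i, \<Sum>i\<in>J. c i *\<^sub>C w i) | J c. finite J \<and> J \<subseteq> I}"
  define N where "N = closure G"
  have Nseq: "(a, b) \<in> N \<longleftrightarrow> (\<exists>f g. (\<forall>n. (f n, g n) \<in> G) \<and> f \<longlonglongrightarrow> a \<and> g \<longlonglongrightarrow> b)" for a b
  proof
    assume "(a, b) \<in> N"
    then obtain h where "\<And>n. h n \<in> G" "h \<longlonglongrightarrow> (a, b)"
      by (auto simp: N_def closure_sequential)
    then show "\<exists>f g. (\<forall>n. (f n, g n) \<in> G) \<and> f \<longlonglongrightarrow> a \<and> g \<longlonglongrightarrow> b"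
      by (intro exI[of _ "\<lambda>n. fst (h n)"] exI[of _ "\<lambda>n. snd (h n)"]) (auto dest: tendsto_fst tendsto_snd)
  next
    assume "\<exists>f g. (\<forall>n. (f n, g n) \<in> G) \<and> f \<longlonglongrightarrow> a \<and> g \<longlonglongrightarrow> b"
    then obtain f g where "\<forall>n. (f n, g n) \<in> G" "f \<longlonglongrightarrow> a" "g \<longlonglongrightarrow> b" by blast
    then show "(a, b) \<in> N"
      unfolding N_def closure_sequential by (intro exI[of _ "\<lambda>n. (f n, g n)"]) (auto intro: tendsto_Pair)
  qed
  have Gadd: "(a + a', b + b') \<in> G" if ab: "(a, b) \<in> G" "(a', b') \<in> G" for a b a' b'
  proof -
    obtain J c where J: "finite J" "J \<subseteq> I" "a = (\<Sum>i\<in>J. c i *\<^sub>C u i)" "b = (\<Sum>i\<in>J. c i *\<^sub>C w i)"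
      using ab(1) by (auto simp: G_def)
    obtain J' c' where J': "finite J'" "J' \<subseteq> I" "a' = (\<Sum>i\<in>J'. c' i *\<^sub>C u i)" "b' = (\<Sum>i\<in>J'. c' i *\<^sub>C w i)"
      using ab(2) by (auto simp: G_def)
    \<comment> \<open>Both combinations are padded with zero coefficients to
      \<open>J \<union> J'\<close>.\<close>
    define d where "d i = (if i \<in> J then c i else 0) + (if i \<in> J' then c' i else 0)" for i
    have ext: "(\<Sum>i\<in>K. e i *\<^sub>C v i) = (\<Sum>i\<in>J \<union> J'. (if i \<in> K then e i else 0) *\<^sub>C v i)"
      if "K \<subseteq> J \<union> J'" for K e and v :: "'i \<Rightarrow> 'c::complex_inner"
    proof -
      have "(\<Sum>i\<in>J \<union> J'. (if i \<in> K then e i else 0) *\<^sub>C v i) = (\<Sum>i\<in>K. (if i \<in> K then e i else 0) *\<^sub>C v i)"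
        using that J(1) J'(1) by (intro sum.mono_neutral_right) auto
      then show ?thesis by simp
    qed
    have sum: "(\<Sum>i\<in>J. c i *\<^sub>C v i) + (\<Sum>i\<in>J'. c' i *\<^sub>C v i) = (\<Sum>i\<in>J \<union> J'. d i *\<^sub>C v i)"
      for v :: "'i \<Rightarrow> 'c::complex_inner"
      by (subst (1 2) ext) (auto simp: sum.distrib[symmetric] scaleC_add_left d_def)
    show ?thesis
      unfolding G_def J(3,4) J'(3,4) sum using J(1,2) J'(1,2) by blast
  qed
  have Gscale: "(k *\<^sub>C a, k *\<^sub>C b) \<in> G" if ab: "(a, b) \<in> G" for a b k
  proof -
    obtain J c where J: "finite J" "J \<subseteq> I" "a = (\<Sum>i\<in>J. c i *\<^sub>C u i)" "b = (\<Sum>i\<in>J. c i *\<^sub>C w i)"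
      using ab by (auto simp: G_def)
    then show ?thesis
      unfolding G_def by (intro CollectI exI[of _ J] exI[of _ "\<lambda>i. k * c i"])
        (simp add: scaleC_sum_right scaleC_scaleC)
  qed
  have Nadd: "(a + a', b + b') \<in> N" if ab: "(a, b) \<in> N" "(a', b') \<in> N" for a b a' b'
  proof -
    obtain f g where "\<forall>n. (f n, g n) \<in> G" "f \<longlonglongrightarrow> a" "g \<longlonglongrightarrow> b"
      using ab(1) unfolding Nseq by blast
    moreover obtain f' g' where "\<forall>n. (f' n, g' n) \<in> G" "f' \<longlonglongrightarrow> a'" "g' \<longlonglongrightarrow> b'"
      using ab(2) unfolding Nseq by blast
    ultimately show ?thesis
      unfolding Nseq
      by (intro exI[of _ "\<lambda>n. f n + f' n"] exI[of _ "\<lambda>n. g n + g' n"] conjI allI Gadd tendsto_add) auto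
  qed
  have Nscale: "(k *\<^sub>C a, k *\<^sub>C b) \<in> N" if ab: "(a, b) \<in> N" for a b k
  proof -
    obtain f g where "\<forall>n. (f n, g n) \<in> G" "f \<longlonglongrightarrow> a" "g \<longlonglongrightarrow> b"
      using ab unfolding Nseq by blast
    then show ?thesis
      unfolding Nseq
      by (intro exI[of _ "\<lambda>n. k *\<^sub>C f n"] exI[of _ "\<lambda>n. k *\<^sub>C g n"] conjI allI Gscale
          bounded_linear.tendsto[OF bounded_linear_scaleC]) auto
  qed
  have GN: "G \<subseteq> N"
    by (simp add: N_def closure_subset)
  have N0: "(0, 0) \<in> N"
    using GN by (auto simp: G_def intro!: exI[of _ "{}"] subsetD[OF GN])
  have Nle: "norm b \<le> norm a" if ab: "(a, b) \<in> N" for a b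
  proof -
    have Gle: "norm b \<le> norm a" if "(a, b) \<in> G" for a b
      using that le by (auto simp: G_def)
    obtain f g where "\<forall>n. (f n, g n) \<in> G" "f \<longlonglongrightarrow> a" "g \<longlonglongrightarrow> b"
      using ab unfolding Nseq by blast
    then show ?thesis
      by (intro LIMSEQ_le[OF tendsto_norm tendsto_norm, of g b f a]) (auto intro: Gle)
  qed
  have Ndiff: "(a - a', b - b') \<in> N" if "(a, b) \<in> N" "(a', b') \<in> N" for a b a' b'
    using Nadd[OF that(1) Nscale[OF that(2), of "-1"]] by (simp add: scaleC_minus_one)
  have Nuniq: "b = b'" if "(a, b) \<in> N" "(a, b') \<in> N" for a b b'
    using Nle[OF Ndiff[OF that]] by simp
  define M where "M = {a. \<exists>b. (a, b) \<in> N}"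
  have Mc: "csubspace M"
    unfolding csubspace_def M_def using N0 Nadd Nscale by blast
  \<comment> \<open>The inequality passes the Cauchy property from the arguments to the values, so
    the closed graph has a closed domain.\<close>
  have "closed M"
    unfolding closed_sequential_limits
  proof (intro allI impI, elim conjE)
    fix f l assume f: "\<forall>n. f n \<in> M" "f \<longlonglongrightarrow> l"
    then have "\<forall>n. \<exists>b. (f n, b) \<in> N"
      by (simp add: M_def)
    then obtain g where g: "\<And>n. (f n, g n) \<in> N"
      by metis
    have "Cauchy g"
      unfolding Cauchy_def
    proof (intro allI impI)
      fix e :: real assume "e > 0"
      then obtain m where m: "\<forall>i\<ge>m. \<forall>j\<ge>m. dist (f i) (f j) < e"
        using LIMSEQ_imp_Cauchy[OF f(2)] unfolding Cauchy_def by blast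
      have "dist (g i) (g j) \<le> dist (f i) (f j)" for i j
        using Nle[OF Ndiff[OF g g]] by (simp add: dist_norm)
      with m show "\<exists>M. \<forall>m\<ge>M. \<forall>n\<ge>M. dist (g m) (g n) < e"
        by (meson le_less_trans)
    qed
    then obtain b where "g \<longlonglongrightarrow> b"
      by (auto simp: Cauchy_convergent_iff convergent_def)
    with f(2) have "(\<lambda>n. (f n, g n)) \<longlonglongrightarrow> (l, b)"
      by (rule tendsto_Pair)
    then have "(l, b) \<in> N"
      using g closed_sequentially[of N "\<lambda>n. (f n, g n)"] by (simp add: N_def)
    then show "l \<in> M"
      unfolding M_def by blast
  qed
  define E where "E = proj_onto M"
  have E: "is_projection E" "range E = M"
    unfolding E_def using is_projection_proj_onto range_proj_onto Mc \<open>closed M\<close> by blast+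
  have "\<exists>b. (E x, b) \<in> N" for x
  proof -
    have "E x \<in> M"
      using E(2) by blast
    then show ?thesis
      unfolding M_def by blast
  qed
  then obtain f where f: "\<And>x. (E x, f x) \<in> N"
    by metis
  have feq: "f x = b" if "(E x, b) \<in> N" for x b
    using Nuniq[OF f that] .
  have f1: "f (x + y) = f x + f y" for x y
    by (rule feq) (simp add: blinfun.add_right Nadd f)
  have f2: "f (c *\<^sub>C x) = c *\<^sub>C f x" for c x
    by (rule feq) (simp add: clin_opsD[OF proj_clin_ops[OF E(1)]] Nscale f)
  have f3: "norm (f x) \<le> norm x * 1" for x
    using Nle[OF f, of x] proj_norm_le[OF E(1), of x] by simp
  note B = clin_ops_Blinfun[of f, OF f1 f2 f3]
  show ?thesis
  proof (intro bexI[of _ "Blinfun f"] conjI ballI allI impI)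
    show "norm (Blinfun f) \<le> 1"
      by (rule norm_blinfun_bound) (use B f3 in auto)
    fix i assume "i \<in> I"
    then have uw: "(u i, w i) \<in> N"
      by (intro subsetD[OF GN]) (auto simp: G_def intro!: exI[of _ "{i}"] exI[of _ "\<lambda>_. 1"])
    then have "u i \<in> range E"
      unfolding E(2) M_def by blast
    then have "E (u i) = u i"
      using proj_range_iff[OF E(1)] by blast
    then show "Blinfun f (u i) = w i"
      using uw by (simp add: B feq)
  next
    fix x assume x: "\<forall>i\<in>I. cinner (u i) x = 0"
    have "cinner a x = 0" if "(a, b) \<in> N" for a b
    proof -
      have Gx: "cinner a x = 0" if "(a, b) \<in> G" for a b
        using that x by (auto simp: G_def cinner_sum_left cinner_scaleC_left subset_iff intro!: sum.neutral)
      obtain h k where h: "\<forall>n. (h n, k n) \<in> G" "h \<longlonglongrightarrow> a"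
        using \<open>(a, b) \<in> N\<close> unfolding Nseq by blast
      have "(\<lambda>n. cinner (h n) x) \<longlonglongrightarrow> cinner a x"
        by (intro tendsto_cinner tendsto_const h)
      moreover have "(\<lambda>n. cinner (h n) x) = (\<lambda>n. 0)"
        using Gx h(1) by blast
      ultimately show ?thesis
        by (simp add: LIMSEQ_const_iff)
    qed
    then have "cinner (E x) x = 0"
      using f by blast
    then have "cinner (E x) (E x) = 0"
      by (simp add: proj_cinner[OF E(1)] proj_idem[OF E(1)])
    then have "E x = 0"
      by (simp only: cinner_eq_zero_iff)
    then show "Blinfun f x = 0"
      using N0 by (simp add: B feq)
  qed (rule B)
qed

subsection \<open>Square roots\<close>

text \<open>The iteration \<open>X \<mapsto> (A + X\<^sup>2) / 2\<close> from \<open>0\<close> is dominated in norm by the same iteration with \<open>A = 1\<close>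
  on the real line; its limit \<open>X\<close> satisfies \<open>(1 - X)\<^sup>2 = 1 - A\<close>.\<close>
lemma sqrt_one_minus:
  fixes A :: "'a::chilbert_space \<Rightarrow>\<^sub>L 'a"
  assumes A: "A \<in> clin_ops" "adj A = A" "norm A \<le> 1"
  shows "\<exists>R\<in>clin_ops. adj R = R \<and> R o\<^sub>L R = id_blinfun - A \<and>
    (\<forall>T. T o\<^sub>L A = A o\<^sub>L T \<longrightarrow> T o\<^sub>L R = R o\<^sub>L T)"
proof -
  define s :: "nat \<Rightarrow> real" where "s = rec_nat 0 (\<lambda>_ t. (1 + t\<^sup>2) / 2)"
  define X :: "nat \<Rightarrow> 'a \<Rightarrow>\<^sub>L 'a" where "X = rec_nat 0 (\<lambda>_ Y. (1/2) *\<^sub>R (A + (Y o\<^sub>L Y)))"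
  have s0: "s 0 = 0" and sS: "s (Suc n) = (1 + (s n)\<^sup>2) / 2" for n
    by (simp_all add: s_def)
  have X0: "X 0 = 0" and XS: "X (Suc n) = (1/2) *\<^sub>R (A + (X n o\<^sub>L X n))" for n
    by (simp_all add: X_def)
  note bil = bounded_bilinear_blinfun_compose
  have s: "0 \<le> s n \<and> s n \<le> 1" for n
  proof (induction n)
    case (Suc n)
    then have "(s n)\<^sup>2 \<le> 1"
      by (simp add: power_le_one)
    then show ?case by (simp add: sS)
  qed (simp add: s0)
  have smono: "s n \<le> s (Suc n)" for n
    using sum_squares_bound[of 1 "s n"] by (simp add: sS)
  have Xc: "X n \<in> clin_ops" for n
    by (induction n) (auto simp: X0 XS intro!: clin_ops_intros A(1))
  have Xadj: "cinner (X n x) y = cinner x (X n y)" for n x y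
  proof (induction n arbitrary: x y)
    case (Suc n)
    then show ?case
      by (simp add: XS blinfun.add_left blinfun.scaleR_left cinner_scaleR_left cinner_scaleR_right
          cinner_add_left cinner_add_right cinner_self_adj[OF A(1,2)])
  qed (simp add: X0)
  have Xcomm: "T o\<^sub>L X n = X n o\<^sub>L T" if "T o\<^sub>L A = A o\<^sub>L T" for T n
  proof (induction n)
    case (Suc n)
    have "T o\<^sub>L (X n o\<^sub>L X n) = (X n o\<^sub>L X n) o\<^sub>L T"
      by (metis Suc blinfun_compose_assoc)
    with that show ?case
      by (simp add: XS bounded_bilinear.add_left[OF bil] bounded_bilinear.add_right[OF bil]
          bounded_bilinear.scaleR_left[OF bil] bounded_bilinear.scaleR_right[OF bil])
  qed (simp add: X0 bounded_bilinear.zero_left[OF bil] bounded_bilinear.zero_right[OF bil])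
  \<comment> \<open>Commutation with the iterates is used twice: \<open>A\<close> commutes with
    itself, hence with \<open>X m\<close>, and hence \<open>X m\<close> with
    \<open>X n\<close>.\<close>
  have XX: "X m o\<^sub>L X n = X n o\<^sub>L X m" for m n
    by (rule Xcomm, rule Xcomm[symmetric], rule refl)
  have Xn: "norm (X n) \<le> s n" for n
  proof (induction n)
    case (Suc n)
    have "norm (A + (X n o\<^sub>L X n)) \<le> 1 + s n * s n"
      by (rule norm_triangle_mono[OF A(3) norm_compose_le[OF Suc Suc]])
    then show ?case
      by (simp add: XS sS power2_eq_square)
  qed (simp add: X0 s0)
  have step: "norm (X (Suc n) - X n) \<le> s (Suc n) - s n" for n
  proof (induction n)
    case (Suc n)
    have "X (Suc (Suc n)) - X (Suc n)
        = (1/2) *\<^sub>R ((X (Suc n) o\<^sub>L X (Suc n)) - (X n o\<^sub>L X n))"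
      unfolding XS[of "Suc n"] XS[of n] by (simp add: algebra_simps)
    \<comment> \<open>Commuting iterates let the difference of squares factor as for real numbers,
      which is how the bound by \<open>s\<close> propagates.\<close>
    also have "(X (Suc n) o\<^sub>L X (Suc n)) - (X n o\<^sub>L X n)
        = (X (Suc n) - X n) o\<^sub>L (X (Suc n) + X n)"
      using XX[of n "Suc n"]
      by (simp add: bounded_bilinear.add_right[OF bil] bounded_bilinear.diff_left[OF bil])
    finally have "norm (X (Suc (Suc n)) - X (Suc n))
        = (1/2) * norm ((X (Suc n) - X n) o\<^sub>L (X (Suc n) + X n))"
      by simp
    also have "\<dots> \<le> (1/2) * ((s (Suc n) - s n) * (s (Suc n) + s n))"
      by (intro mult_left_mono norm_compose_le Suc norm_triangle_mono Xn) auto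
    also have "\<dots> = s (Suc (Suc n)) - s (Suc n)"
      unfolding sS[of "Suc n"] by (subst (4) sS) (simp add: power2_eq_square field_simps)
    finally show ?case .
  qed (use Xn[of "Suc 0"] in \<open>simp add: X0 s0\<close>)
  have diff: "norm (X (n + k) - X n) \<le> s (n + k) - s n" for n k
  proof (induction k)
    case (Suc k)
    have "X (n + Suc k) - X n = (X (Suc (n + k)) - X (n + k)) + (X (n + k) - X n)"
      by simp
    then show ?case
      using norm_triangle_mono[OF step[of "n + k"] Suc] by simp
  qed simp
  have "incseq s"
    by (rule incseq_SucI) (rule smono)
  then obtain l where "s \<longlonglongrightarrow> l"
    using incseq_convergent[of s 1] s by blast
  then have "Cauchy s"
    by (rule LIMSEQ_imp_Cauchy)
  have "Cauchy X"
  proof (rule CauchyI')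
    fix e :: real assume "e > 0"
    then obtain M where M: "\<And>m n. m \<ge> M \<Longrightarrow> n \<ge> M \<Longrightarrow> norm (s m - s n) < e"
      using CauchyD[OF \<open>Cauchy s\<close>] by blast
    have "norm (X m - X n) < e" if "m \<ge> M" "n > m" for m n
      using diff[of m "n - m"] M[of n m] that by (simp add: norm_minus_commute)
    then show "\<exists>M. \<forall>m\<ge>M. \<forall>n>m. dist (X m) (X n) < e"
      unfolding dist_norm by blast
  qed
  then obtain Y where Y: "X \<longlonglongrightarrow> Y"
    by (auto simp: Cauchy_convergent_iff convergent_def)
  have YA: "Y = (1/2) *\<^sub>R (A + (Y o\<^sub>L Y))"
  proof (rule LIMSEQ_unique)
    show "(\<lambda>n. X (Suc n)) \<longlonglongrightarrow> Y"
      by (rule LIMSEQ_Suc[OF Y])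
    show "(\<lambda>n. X (Suc n)) \<longlonglongrightarrow> (1/2) *\<^sub>R (A + (Y o\<^sub>L Y))"
      unfolding XS by (intro tendsto_intros bounded_bilinear.tendsto[OF bil] Y)
  qed
  have Yc: "Y \<in> clin_ops"
    using closed_sequentially[OF closed_clin_ops _ Y] Xc by blast
  have Yadj: "cinner (Y x) y = cinner x (Y y)" for x y
  proof (rule LIMSEQ_unique)
    show "(\<lambda>n. cinner (X n x) y) \<longlonglongrightarrow> cinner (Y x) y"
      by (intro tendsto_cinner tendsto_const blinfun.tendsto Y)
    show "(\<lambda>n. cinner (X n x) y) \<longlonglongrightarrow> cinner x (Y y)"
      unfolding Xadj by (intro tendsto_cinner tendsto_const blinfun.tendsto Y)
  qed
  have Ycomm: "T o\<^sub>L Y = Y o\<^sub>L T" if "T o\<^sub>L A = A o\<^sub>L T" for T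
  proof (rule LIMSEQ_unique)
    show "(\<lambda>n. T o\<^sub>L X n) \<longlonglongrightarrow> (T o\<^sub>L Y)"
      by (intro bounded_bilinear.tendsto[OF bil] tendsto_const Y)
    show "(\<lambda>n. T o\<^sub>L X n) \<longlonglongrightarrow> (Y o\<^sub>L T)"
      unfolding Xcomm[OF that] by (intro bounded_bilinear.tendsto[OF bil] tendsto_const Y)
  qed
  have "A = 2 *\<^sub>R Y - (Y o\<^sub>L Y)"
    using arg_cong[OF YA, of "scaleR 2"] by simp
  then have "A x = 2 *\<^sub>R Y x - Y (Y x)" for x
    by (metis blinfun.diff_left blinfun.scaleR_left blinfun_apply_blinfun_compose)
  then have "(id_blinfun - Y) o\<^sub>L (id_blinfun - Y) = id_blinfun - A"
    by (intro blinfun_eqI) (simp add: blinfun.diff_left blinfun.diff_right scaleR_2)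
  moreover have "adj (id_blinfun - Y) = id_blinfun - Y"
    by (rule adj_selfI) (simp add: blinfun.diff_left cinner_diff_left cinner_diff_right Yadj)
  moreover have "T o\<^sub>L (id_blinfun - Y) = (id_blinfun - Y) o\<^sub>L T" if "T o\<^sub>L A = A o\<^sub>L T" for T
  proof (rule blinfun_eqI)
    show "(T o\<^sub>L (id_blinfun - Y)) x = ((id_blinfun - Y) o\<^sub>L T) x" for x
      using blinfun_compose_apply_eq[OF Ycomm[OF that], of x]
      by (simp add: blinfun.diff_left blinfun.diff_right)
  qed
  moreover have "id_blinfun - Y \<in> clin_ops"
    by (intro clin_ops_intros Yc)
  ultimately show ?thesis
    by blast
qed

text \<open>The root of \<open>T = adj B o\<^sub>L B\<close> is taken as that of
  \<open>1 - (1 - T)\<close>. That \<open>1 - T\<close> is a contraction follows by expanding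
  \<open>norm (x - T x)\<close> squared, where the square of \<open>norm (T x)\<close> is at most
  that of \<open>norm (B x)\<close>, which equals \<open>inner (T x) x\<close>.\<close>

lemma sqrt_adj_compose:
  fixes B :: "'a::chilbert_space \<Rightarrow>\<^sub>L 'b::chilbert_space"
  assumes B: "B \<in> clin_ops" "norm B \<le> 1"
  shows "\<exists>R\<in>clin_ops. adj R = R \<and> R o\<^sub>L R = adj B o\<^sub>L B \<and>
    (\<forall>T. T o\<^sub>L (adj B o\<^sub>L B) = (adj B o\<^sub>L B) o\<^sub>L T \<longrightarrow> T o\<^sub>L R = R o\<^sub>L T)"
proof -
  define T where "T = adj B o\<^sub>L B"
  note bil = bounded_bilinear_blinfun_compose
  have T: "T \<in> clin_ops"
    using B(1) adj_clin_ops[OF B(1)] by (auto simp: T_def)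
  have Tadj: "adj T = T"
    using B(1) adj_clin_ops[OF B(1)] by (simp add: T_def adj_compose adj_adj)
  have Tx: "inner (T x) x = (norm (B x))\<^sup>2" for x
    by (simp add: T_def inner_cinner cinner_adj_left[OF B(1)] cinner_self_norm)
  have nadj: "norm (adj B y) \<le> norm y" for y
  proof -
    have "(norm (adj B y))\<^sup>2 = Re (cinner y (B (adj B y)))"
      by (simp add: power2_norm_eq_inner inner_cinner cinner_adj_left[OF B(1)])
    also have "\<dots> \<le> norm y * norm (B (adj B y))"
      unfolding inner_cinner[symmetric] by (rule norm_cauchy_schwarz)
    also have "norm (B (adj B y)) \<le> 1 * norm (adj B y)"
      using B(2) by (meson mult_right_mono norm_blinfun norm_ge_zero order_trans)
    finally have "norm (adj B y) * norm (adj B y) \<le> norm y * norm (adj B y)"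
      by (simp add: power2_eq_square mult_left_mono)
    then show ?thesis
      by (cases "adj B y = 0") auto
  qed
  have "norm (id_blinfun - T) \<le> 1"
  proof (rule norm_blinfun_bound)
    fix x
    have "(norm (x - T x))\<^sup>2 = (norm x)\<^sup>2 - 2 * inner (T x) x + (norm (T x))\<^sup>2"
      by (simp add: power2_norm_eq_inner inner_diff_left inner_diff_right inner_commute)
    also have "norm (T x) \<le> norm (B x)"
      using nadj[of "B x"] by (simp add: T_def)
    then have "(norm (T x))\<^sup>2 \<le> inner (T x) x"
      by (simp add: Tx)
    finally have "(norm (x - T x))\<^sup>2 \<le> (norm x)\<^sup>2"
      using Tx[of x] by (smt (verit) zero_le_power2)
    then show "norm ((id_blinfun - T) x) \<le> 1 * norm x"
      by (simp add: blinfun.diff_left)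
  qed simp
  moreover have "adj (id_blinfun - T) = id_blinfun - T"
    by (rule adj_selfI)
       (simp add: blinfun.diff_left cinner_diff_left cinner_diff_right cinner_self_adj[OF T Tadj])
  ultimately obtain R where R: "R \<in> clin_ops" "adj R = R" "R o\<^sub>L R = id_blinfun - (id_blinfun - T)"
    "\<forall>S. S o\<^sub>L (id_blinfun - T) = (id_blinfun - T) o\<^sub>L S \<longrightarrow> S o\<^sub>L R = R o\<^sub>L S"
    using sqrt_one_minus[OF clin_ops_intros(4)[OF clin_ops_intros(1) T]] by blast
  have "S o\<^sub>L R = R o\<^sub>L S" if "S o\<^sub>L T = T o\<^sub>L S" for S
  proof (rule R(4)[rule_format], rule blinfun_eqI)
    show "(S o\<^sub>L (id_blinfun - T)) x = ((id_blinfun - T) o\<^sub>L S) x" for x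
      using blinfun_compose_apply_eq[OF that, of x] by (simp add: blinfun.diff_left blinfun.diff_right)
  qed
  moreover have "R o\<^sub>L R = T"
    using R(3) by simp
  ultimately show ?thesis
    unfolding T_def[symmetric] by (intro bexI[of _ R] conjI allI impI R(1,2))
qed

subsection \<open>Maximal Boolean algebras of projections\<close>

text \<open>The projections of a masa, described without the algebra: a family that equals its own
  commutant among projections. Commutativity, products, complements and projections onto invariant
  closed spans all follow from this one condition.\<close>

definition maximal_boolean :: "('a::complex_inner \<Rightarrow>\<^sub>L 'a) set \<Rightarrow> bool"
  where "maximal_boolean \<P> \<longleftrightarrow> (\<forall>P\<in>\<P>. is_projection P) \<and>
    (\<forall>P. is_projection P \<longrightarrow> (P \<in> \<P> \<longleftrightarrow> (\<forall>Q\<in>\<P>. P o\<^sub>L Q = Q o\<^sub>L P)))"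

context
  fixes \<P> :: "('a::chilbert_space \<Rightarrow>\<^sub>L 'a) set"
  assumes mb: "maximal_boolean \<P>"
begin

lemma boolean_proj: "P \<in> \<P> \<Longrightarrow> is_projection P"
  using mb by (simp add: maximal_boolean_def)

lemma boolean_clin_ops: "P \<in> \<P> \<Longrightarrow> P \<in> clin_ops"
  by (simp add: boolean_proj proj_clin_ops)

lemma boolean_commute: "P \<in> \<P> \<Longrightarrow> Q \<in> \<P> \<Longrightarrow> P o\<^sub>L Q = Q o\<^sub>L P"
  using mb unfolding maximal_boolean_def by blast

lemma boolean_commute_apply: "P \<in> \<P> \<Longrightarrow> Q \<in> \<P> \<Longrightarrow> blinfun_apply P (Q x) = Q (P x)"
  by (rule blinfun_compose_apply_eq) (rule boolean_commute)

lemma booleanI: "is_projection P \<Longrightarrow> (\<And>Q x. Q \<in> \<P> \<Longrightarrow> blinfun_apply P (Q x) = Q (P x)) \<Longrightarrow> P \<in> \<P>"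
  using mb by (auto simp: maximal_boolean_def intro!: blinfun_eqI)

lemma boolean_compose:
  assumes "P \<in> \<P>" "Q \<in> \<P>"
  shows "P o\<^sub>L Q \<in> \<P>"
proof (rule booleanI)
  show "is_projection (P o\<^sub>L Q)"
    by (intro is_projection_compose boolean_proj boolean_commute assms)
  show "(P o\<^sub>L Q) (R x) = R ((P o\<^sub>L Q) x)" if "R \<in> \<P>" for R x
    using boolean_commute_apply[OF assms(1) that] boolean_commute_apply[OF assms(2) that] by simp
qed

lemma boolean_id: "id_blinfun \<in> \<P>"
  by (rule booleanI) auto

lemma boolean_zero: "0 \<in> \<P>"
  by (rule booleanI) auto

lemma boolean_compl: "P \<in> \<P> \<Longrightarrow> id_blinfun - P \<in> \<P>"
  by (rule booleanI)
     (auto intro: is_projection_compl boolean_proj simp: blinfun.diff_left blinfun.diff_right boolean_commute_apply)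

text \<open>A span invariant under self-adjoint operators reduces them, so its projection commutes
  with the family and maximality absorbs it. This is the source of cyclic projections and of
  arbitrary suprema.\<close>

lemma boolean_proj_cspan:
  assumes "\<And>P g. P \<in> \<P> \<Longrightarrow> g \<in> G \<Longrightarrow> blinfun_apply P g \<in> cspan_closure G"
  shows "proj_cspan G \<in> \<P>"
proof (rule booleanI[OF is_projection_cspan])
  fix Q x assume Q: "Q \<in> \<P>"
  have "proj_cspan G o\<^sub>L Q = Q o\<^sub>L proj_cspan G"
    using assms Q by (intro proj_cspan_commute boolean_clin_ops proj_adj boolean_proj)
  then show "proj_cspan G (Q x) = Q (proj_cspan G x)"
    by (rule blinfun_compose_apply_eq)
qed

end

text \<open>The projection onto the span of all ranges is the supremum of the \<open>f i\<close>:
  here it is an upper bound, and \<open>compose_proj_cspan_UN\<close> makes it the least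
  one.\<close>

lemma proj_cspan_UN_compose:
  fixes f :: "'c \<Rightarrow> 'a::chilbert_space \<Rightarrow>\<^sub>L 'a"
  assumes "i \<in> C"
  shows "proj_cspan (\<Union>i\<in>C. range (blinfun_apply (f i))) o\<^sub>L f i = f i"
proof (rule blinfun_eqI)
  fix x
  have "f i x \<in> (\<Union>i\<in>C. range (blinfun_apply (f i)))"
    using assms by blast
  then show "(proj_cspan (\<Union>i\<in>C. range (blinfun_apply (f i))) o\<^sub>L f i) x = f i x"
    by (simp add: proj_cspan_fix cspan_closureI del: UN_iff)
qed

lemma compose_proj_cspan_UN:
  fixes f :: "'c \<Rightarrow> 'a::chilbert_space \<Rightarrow>\<^sub>L 'a"
  assumes "T \<in> clin_ops" and T: "\<And>i. i \<in> C \<Longrightarrow> T o\<^sub>L f i = f i"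
  shows "T o\<^sub>L proj_cspan (\<Union>i\<in>C. range (blinfun_apply (f i)))
    = proj_cspan (\<Union>i\<in>C. range (blinfun_apply (f i)))"
proof (rule proj_cspan_compose[OF assms(1)])
  fix g assume "g \<in> (\<Union>i\<in>C. range (blinfun_apply (f i)))"
  then obtain i x where "i \<in> C" "g = f i x"
    by blast
  then show "T g = g"
    using T[of i] by (metis blinfun_apply_blinfun_compose)
qed

text \<open>The union of a chain of ranges is already a subspace, so the projection of
  \<open>z\<close> onto its closure lies within \<open>e\<close> of a vector in a single range. This
  is continuity of the measure of \<open>z\<close> along chains of any cardinality.\<close>

lemma proj_chain_approx:
  fixes \<D> :: "('a::chilbert_space \<Rightarrow>\<^sub>L 'a) set"
  assumes proj: "\<And>P. P \<in> \<D> \<Longrightarrow> is_projection P" and ne: "\<D> \<noteq> {}" and e: "e > 0"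
    and chain: "\<And>P Q. P \<in> \<D> \<Longrightarrow> Q \<in> \<D> \<Longrightarrow>
      range (blinfun_apply P) \<subseteq> range (blinfun_apply Q) \<or> range (blinfun_apply Q) \<subseteq> range (blinfun_apply P)"
  shows "\<exists>P\<in>\<D>. norm (proj_cspan (\<Union>P\<in>\<D>. range (blinfun_apply P)) z) \<le> norm (P z) + e"
proof -
  let ?U = "\<Union>P\<in>\<D>. range (blinfun_apply P)"
  have mem: "x \<in> ?U \<longleftrightarrow> (\<exists>P\<in>\<D>. P x = x)" for x
    by (simp only: UN_iff) (intro bex_cong refl proj_range_iff proj)
  have "csubspace ?U"
    unfolding csubspace_def
  proof (intro conjI ballI allI)
    show "0 \<in> ?U"
      using ne unfolding mem by auto
    fix x y assume "x \<in> ?U" "y \<in> ?U"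
    then obtain P Q where PQ: "P \<in> \<D>" "x \<in> range P" "Q \<in> \<D>" "y \<in> range Q"
      by blast
    then consider "x \<in> range Q" | "y \<in> range P"
      using chain by blast
    then show "x + y \<in> ?U"
      using PQ proj unfolding mem by cases (metis blinfun.add_right proj_range_iff)+
  next
    fix c x assume "x \<in> ?U"
    then show "c *\<^sub>C x \<in> ?U"
      unfolding mem by (metis clin_opsD proj proj_clin_ops)
  qed
  then have "cspan_closure ?U = closure ?U"
    by (simp add: cspan_closure_def hull_same)
  then have "proj_cspan ?U z \<in> closure ?U"
    using proj_cspan_mem by blast
  then obtain u where u: "u \<in> ?U" "dist u (proj_cspan ?U z) < e"
    using e closure_approachable by blast
  then obtain P where P: "P \<in> \<D>" "P u = u"
    using mem by blast
  note isP = proj[OF P(1)]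
  let ?s = "proj_cspan ?U z"
  have "proj_cspan ?U o\<^sub>L P = P"
    by (rule proj_cspan_UN_compose[OF P(1), of "\<lambda>P. P"])
  then have "adj (proj_cspan ?U o\<^sub>L P) = adj P"
    by simp
  then have "P o\<^sub>L proj_cspan ?U = P"
    by (simp add: adj_compose proj_clin_ops[OF isP] proj_clin_ops[OF is_projection_cspan]
        proj_adj[OF isP] proj_adj[OF is_projection_cspan])
  then have Ps: "P ?s = P z"
    by (metis blinfun_apply_blinfun_compose)
  \<comment> \<open>\<open>P\<close> fixes \<open>u\<close>, so the part of \<open>?s\<close>
    outside the range of \<open>P\<close> is no longer than the distance from \<open>?s\<close> to
    \<open>u\<close>.\<close>
  have "norm (?s - P ?s) = norm ((?s - u) - P (?s - u))"
    by (simp add: blinfun.diff_right P(2))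
  also have "\<dots> \<le> norm (?s - u)"
    using proj_norm_le[OF is_projection_compl[OF isP], of "?s - u"] by (simp add: blinfun.diff_left)
  also have "\<dots> < e"
    using u(2) by (simp add: dist_norm norm_minus_commute)
  finally have "norm ?s \<le> norm (P z) + e"
    using norm_triangle_sub[of ?s "P z"] by (simp add: Ps)
  with P(1) show ?thesis by blast
qed

subsection \<open>Boolean isomorphisms are spatial\<close>

locale boolean_iso =
  fixes \<P>1 :: "('a::chilbert_space \<Rightarrow>\<^sub>L 'a) set" and \<P>2 :: "('b::chilbert_space \<Rightarrow>\<^sub>L 'b) set"
    and \<theta> :: "('a \<Rightarrow>\<^sub>L 'a) \<Rightarrow> ('b \<Rightarrow>\<^sub>L 'b)"
  assumes max1: "maximal_boolean \<P>1" and max2: "maximal_boolean \<P>2"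
    and bij: "bij_betw \<theta> \<P>1 \<P>2"
    and mult: "\<And>P Q. P \<in> \<P>1 \<Longrightarrow> Q \<in> \<P>1 \<Longrightarrow> \<theta> (P o\<^sub>L Q) = \<theta> P o\<^sub>L \<theta> Q"
    and compl: "\<And>P. P \<in> \<P>1 \<Longrightarrow> \<theta> (id_blinfun - P) = id_blinfun - \<theta> P"
begin

lemmas proj1 = boolean_proj[OF max1] and proj2 = boolean_proj[OF max2]

lemma theta_mem: "P \<in> \<P>1 \<Longrightarrow> \<theta> P \<in> \<P>2"
  using bij bij_betwE by blast

lemma theta_inj: "P \<in> \<P>1 \<Longrightarrow> Q \<in> \<P>1 \<Longrightarrow> \<theta> P = \<theta> Q \<Longrightarrow> P = Q"
  using bij by (meson bij_betw_imp_inj_on inj_onD)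

lemma theta_surj: "Q \<in> \<P>2 \<Longrightarrow> \<exists>P\<in>\<P>1. \<theta> P = Q"
  using bij by (metis bij_betw_imp_surj_on imageE)

lemma proj_theta: "P \<in> \<P>1 \<Longrightarrow> is_projection (\<theta> P)"
  by (simp add: proj2 theta_mem)

lemma mult_apply: "P \<in> \<P>1 \<Longrightarrow> Q \<in> \<P>1 \<Longrightarrow> \<theta> (P o\<^sub>L Q) x = \<theta> P (\<theta> Q x)"
  by (simp add: mult)

lemma theta_id: "\<theta> id_blinfun = id_blinfun"
proof -
  obtain P where P: "P \<in> \<P>1" "\<theta> P = id_blinfun"
    using theta_surj[OF boolean_id[OF max2]] by blast
  have "P o\<^sub>L id_blinfun = P"
    by (rule blinfun_eqI) simp
  then have "\<theta> P = \<theta> P o\<^sub>L \<theta> id_blinfun"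
    using mult[OF P(1) boolean_id[OF max1]] by simp
  then show ?thesis
    by (metis P(2) blinfun_apply_blinfun_compose blinfun_eqI id_blinfun.rep_eq id_apply)
qed

lemma theta_zero: "\<theta> 0 = 0"
  using compl[OF boolean_id[OF max1]] by (simp add: theta_id)

text \<open>The squared norms of \<open>P x\<close> form the spectral measure of \<open>x\<close>;
  matched vectors have the same measure under the identification \<open>\<theta>\<close>.\<close>

definition matched :: "'a \<Rightarrow> 'b \<Rightarrow> bool"
  where "matched x y \<longleftrightarrow> (\<forall>P\<in>\<P>1. norm (blinfun_apply P x) = norm (\<theta> P y))"

text \<open>The product \<open>P o\<^sub>L Q\<close> is again a projection of the family, so the
  inner product is a value of the measure of \<open>x\<close>.\<close>

lemma matched_cinner:
  assumes "matched x y" "P \<in> \<P>1" "Q \<in> \<P>1"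
  shows "cinner (blinfun_apply P x) (Q x) = cinner (\<theta> P y) (\<theta> Q y)"
proof -
  have PQ: "P o\<^sub>L Q \<in> \<P>1"
    by (rule boolean_compose[OF max1 assms(2,3)])
  have "cinner (P x) (Q x) = cinner x ((P o\<^sub>L Q) x)"
    by (simp add: proj_cinner[OF proj1[OF assms(2)]])
  also have "\<dots> = cinner y (\<theta> (P o\<^sub>L Q) y)"
    using assms(1) PQ
    by (simp only: proj_cinner_norm[OF proj1[OF PQ]] proj_cinner_norm[OF proj_theta[OF PQ]] matched_def)
  also have "\<dots> = cinner (\<theta> P y) (\<theta> Q y)"
    by (simp add: mult_apply assms proj_cinner[OF proj_theta[OF assms(2)]])
  finally show ?thesis .
qed

text \<open>Splitting off one projection at a time, \<open>v = P v + (v - P v)\<close>, reduces the inequality for linear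
  combinations to the inequality for single projections.\<close>
lemma simple_function_bound:
  assumes le: "\<And>P. P \<in> \<P>1 \<Longrightarrow> norm (blinfun_apply P x) \<le> norm (\<theta> P z)"
    and "finite J" "J \<subseteq> \<P>1" "R \<in> \<P>1"
  shows "norm (c0 *\<^sub>C R x + (\<Sum>P\<in>J. c P *\<^sub>C blinfun_apply P (R x)))
    \<le> norm (c0 *\<^sub>C \<theta> R z + (\<Sum>P\<in>J. c P *\<^sub>C \<theta> P (\<theta> R z)))"
  using assms(2,3,4)
proof (induction J arbitrary: c0 R rule: finite_induct)
  case empty
  then show ?case
    using le by (simp add: norm_scaleC mult_left_mono)
next
  case (insert P J)
  then have P: "P \<in> \<P>1" and J: "J \<subseteq> \<P>1" by auto
  let ?f = "\<lambda>c0 R. c0 *\<^sub>C R x + (\<Sum>Q\<in>J. c Q *\<^sub>C blinfun_apply Q (R x))"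
  let ?g = "\<lambda>c0 R. c0 *\<^sub>C \<theta> R z + (\<Sum>Q\<in>J. c Q *\<^sub>C \<theta> Q (\<theta> R z))"
  define v where "v = c0 *\<^sub>C R x + (\<Sum>Q\<in>insert P J. c Q *\<^sub>C Q (R x))"
  define w where "w = c0 *\<^sub>C \<theta> R z + (\<Sum>Q\<in>insert P J. c Q *\<^sub>C \<theta> Q (\<theta> R z))"
  define R' where "R' = (id_blinfun - P) o\<^sub>L R"
  have PR: "P o\<^sub>L R \<in> \<P>1" "R' \<in> \<P>1"
    unfolding R'_def by (intro boolean_compose[OF max1] boolean_compl[OF max1] P insert.prems)+
  have v: "v = c0 *\<^sub>C R x + c P *\<^sub>C P (R x) + (\<Sum>Q\<in>J. c Q *\<^sub>C Q (R x))"
    and w: "w = c0 *\<^sub>C \<theta> R z + c P *\<^sub>C \<theta> P (\<theta> R z) + (\<Sum>Q\<in>J. c Q *\<^sub>C \<theta> Q (\<theta> R z))"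
    using insert.hyps by (auto simp: v_def w_def algebra_simps)
  have c1: "P (Q y) = Q (P y)" "\<theta> P (\<theta> Q y') = \<theta> Q (\<theta> P y')" if "Q \<in> J" for Q y y'
    using that J P boolean_commute_apply[OF max1] boolean_commute_apply[OF max2] theta_mem
    by (meson subsetD)+
  have R'x: "R' x = R x - P (R x)" "\<theta> R' z = \<theta> R z - \<theta> P (\<theta> R z)"
    using insert.prems P boolean_compl[OF max1 P]
    by (simp_all add: R'_def blinfun.diff_left mult_apply compl)
  \<comment> \<open>On \<open>P\<close> the coefficient \<open>c P\<close> merges into the constant
    one, off \<open>P\<close> it disappears. Hence the induction runs over all \<open>c0\<close> and
    all localizations \<open>R\<close>.\<close>
  have Pv: "P v = ?f (c0 + c P) (P o\<^sub>L R)" "\<theta> P w = ?g (c0 + c P) (P o\<^sub>L R)"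
    using insert.prems
    by (simp_all add: v w blinfun.add_right blinfun.sum_right clin_opsD proj_clin_ops proj1 proj_theta
        proj_idem P c1 scaleC_add_left mult_apply)
  have Pv': "v - P v = ?f c0 R'" "w - \<theta> P w = ?g c0 R'"
    using J insert.prems
    by (simp_all add: v w R'x blinfun.add_right blinfun.sum_right blinfun.diff_right clin_opsD
        proj_clin_ops proj1 proj_theta proj_idem P c1 scaleC_diff_right sum_subtractf)
  have "(norm v)\<^sup>2 = (norm (P v))\<^sup>2 + (norm (v - P v))\<^sup>2"
    by (rule proj_pythagoras[OF proj1[OF P]])
  also have "\<dots> \<le> (norm (\<theta> P w))\<^sup>2 + (norm (w - \<theta> P w))\<^sup>2"
  proof (intro add_mono power_mono norm_ge_zero)
    show "norm (P v) \<le> norm (\<theta> P w)"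
      unfolding Pv by (intro insert.IH PR J)
    show "norm (v - P v) \<le> norm (w - \<theta> P w)"
      unfolding Pv' by (intro insert.IH PR J)
  qed
  also have "\<dots> = (norm w)\<^sup>2"
    by (rule proj_pythagoras[OF proj_theta[OF P], symmetric])
  finally show ?case
    unfolding v_def[symmetric] w_def[symmetric] by (rule power2_le_imp_le) simp
qed

text \<open>Only finite Boolean operations are preserved by assumption, but an order isomorphism
  between complete lattices preserves every supremum that exists. Here \<open>W\<close> is the
  preimage of the supremum of the images; it bounds \<open>C\<close> from above, hence lies above
  the supremum of \<open>C\<close>.\<close>

lemma theta_proj_cspan_chain:
  assumes C: "C \<subseteq> \<P>1"
  shows "proj_cspan (\<Union>P\<in>C. range (blinfun_apply P)) \<in> \<P>1"
    and "\<theta> (proj_cspan (\<Union>P\<in>C. range (blinfun_apply P))) = proj_cspan (\<Union>P\<in>C. range (blinfun_apply (\<theta> P)))"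
proof -
  let ?U1 = "\<Union>P\<in>C. range (blinfun_apply P)" and ?U2 = "\<Union>P\<in>C. range (blinfun_apply (\<theta> P))"
  have "Q g \<in> cspan_closure ?U1" if Q: "Q \<in> \<P>1" and g: "g \<in> ?U1" for Q g
  proof -
    obtain P x where P: "P \<in> C" "g = P x"
      using g by blast
    then have "Q g = P (Q x)"
      using boolean_commute_apply[OF max1 Q] C by blast
    then have "Q g \<in> ?U1"
      using P(1) by blast
    then show ?thesis
      by (rule cspan_closureI)
  qed
  then show S1: "proj_cspan ?U1 \<in> \<P>1"
    by (rule boolean_proj_cspan[OF max1])
  have "Q g \<in> cspan_closure ?U2" if Q: "Q \<in> \<P>2" and g: "g \<in> ?U2" for Q g
  proof -
    obtain P x where P: "P \<in> C" "g = \<theta> P x"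
      using g by blast
    then have "Q g = \<theta> P (Q x)"
      using boolean_commute_apply[OF max2 Q theta_mem] C by blast
    then have "Q g \<in> ?U2"
      using P(1) by blast
    then show ?thesis
      by (rule cspan_closureI)
  qed
  then have S2: "proj_cspan ?U2 \<in> \<P>2"
    by (rule boolean_proj_cspan[OF max2])
  then obtain W where W: "W \<in> \<P>1" "\<theta> W = proj_cspan ?U2"
    using theta_surj by blast
  have fix1: "proj_cspan ?U1 o\<^sub>L P = P" and fix2: "proj_cspan ?U2 o\<^sub>L \<theta> P = \<theta> P" if "P \<in> C" for P
    using proj_cspan_UN_compose[OF that, of "\<lambda>P. P"] proj_cspan_UN_compose[OF that, of \<theta>] by auto
  have "W o\<^sub>L P = P" if "P \<in> C" for P
    using that C W fix2 by (intro theta_inj boolean_compose[OF max1]) (auto simp: mult)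
  then have "W o\<^sub>L proj_cspan ?U1 = proj_cspan ?U1"
    by (rule compose_proj_cspan_UN[OF boolean_clin_ops[OF max1 W(1)], of C "\<lambda>P. P"])
  then have a: "proj_cspan ?U2 o\<^sub>L \<theta> (proj_cspan ?U1) = \<theta> (proj_cspan ?U1)"
    using mult[OF W(1) S1] W(2) by simp
  have "\<theta> (proj_cspan ?U1) o\<^sub>L \<theta> P = \<theta> P" if "P \<in> C" for P
    using mult[OF S1, of P] fix1[OF that] that C by auto
  then have "\<theta> (proj_cspan ?U1) o\<^sub>L proj_cspan ?U2 = proj_cspan ?U2"
    by (rule compose_proj_cspan_UN[OF boolean_clin_ops[OF max2 theta_mem[OF S1]]])
  with a show "\<theta> (proj_cspan ?U1) = proj_cspan ?U2"
    using boolean_commute[OF max2 S2 theta_mem[OF S1]] by simp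
qed

text \<open>\<open>adj B o\<^sub>L B\<close> acts as the Radon-Nikodym derivative of the measure of
  \<open>x\<close> by that of \<open>z\<close>. Its root \<open>R\<close> commutes with every
  \<open>\<theta> P\<close>, so \<open>norm (\<theta> P (R z)) = norm (B (\<theta> P z)) = norm (P
  x)\<close>.\<close>

lemma matched_of_dominated:
  assumes le: "\<And>P. P \<in> \<P>1 \<Longrightarrow> norm (blinfun_apply P x) \<le> norm (\<theta> P z)"
    and E: "E \<in> \<P>1" "\<theta> E z = z"
  shows "\<exists>y. \<theta> E y = y \<and> matched x y"
proof -
  have id1: "id_blinfun \<in> \<P>1"
    by (rule boolean_id[OF max1])
  have "norm (\<Sum>P\<in>J. c P *\<^sub>C blinfun_apply P x) \<le> norm (\<Sum>P\<in>J. c P *\<^sub>C \<theta> P z)"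
    if "finite J" "J \<subseteq> \<P>1" for J c
    using simple_function_bound[OF le that id1, where ?c0.0 = 0 and c = c] by (simp add: theta_id)
  from contraction_extension[of \<P>1, OF this]
  obtain B where B: "B \<in> clin_ops" "norm B \<le> 1" "\<And>P. P \<in> \<P>1 \<Longrightarrow> B (\<theta> P z) = P x"
    and B0: "\<And>v. (\<And>P. P \<in> \<P>1 \<Longrightarrow> cinner (\<theta> P z) v = 0) \<Longrightarrow> B v = 0"
    by blast
  let ?G = "{\<theta> P z | P. P \<in> \<P>1}"
  \<comment> \<open>The values of \<open>B\<close> are known on the cyclic subspace of
    \<open>z\<close>. The orthogonal part \<open>b\<close> is annihilated by \<open>B\<close>, and
    \<open>\<theta> P b\<close> is still orthogonal to that subspace.\<close>
  have inter: "B (\<theta> P v) = P (B v)" if P: "P \<in> \<P>1" for P v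
  proof -
    define a where "a = proj_cspan ?G v"
    define b where "b = v - a"
    have "(B o\<^sub>L \<theta> P) a = (P o\<^sub>L B) a"
    proof (rule clin_ops_eq_on_cspan_closure)
      show "B o\<^sub>L \<theta> P \<in> clin_ops" "P o\<^sub>L B \<in> clin_ops"
        using B(1) P proj_clin_ops proj1 proj_theta by blast+
      show "a \<in> cspan_closure ?G"
        by (simp add: a_def proj_cspan_mem)
      fix g assume "g \<in> ?G"
      then obtain R where R: "R \<in> \<P>1" "g = \<theta> R z" by blast
      then show "(B o\<^sub>L \<theta> P) g = (P o\<^sub>L B) g"
        using B(3)[OF boolean_compose[OF max1 P R(1)]] B(3)[OF R(1)] by (simp add: mult_apply P)
    qed
    moreover have b: "cinner (\<theta> R z) b = 0" if "R \<in> \<P>1" for R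
    proof -
      have "\<theta> R z \<in> cspan_closure ?G"
        using that by (intro cspan_closureI) blast
      then have "cinner (\<theta> R z) b = cinner (proj_cspan ?G (\<theta> R z)) b"
        by (simp add: proj_cspan_fix)
      also have "\<dots> = 0"
        by (simp add: proj_cinner[OF is_projection_cspan] b_def a_def blinfun.diff_right
            proj_idem[OF is_projection_cspan])
      finally show ?thesis .
    qed
    have "B b = 0"
      by (rule B0) (rule b)
    moreover have "B (\<theta> P b) = 0"
    proof (rule B0)
      fix R assume R: "R \<in> \<P>1"
      have "cinner (\<theta> R z) (\<theta> P b) = cinner (\<theta> (P o\<^sub>L R) z) b"
        by (simp add: mult_apply P R proj_cinner[OF proj_theta[OF P]])
      then show "cinner (\<theta> R z) (\<theta> P b) = 0"
        using b boolean_compose[OF max1 P R] by simp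
    qed
    moreover have "v = a + b"
      by (simp add: b_def)
    ultimately show ?thesis
      by (simp add: blinfun.add_right)
  qed
  obtain R where R: "R \<in> clin_ops" "adj R = R" "R o\<^sub>L R = adj B o\<^sub>L B"
    and Rc: "\<And>T. T o\<^sub>L (adj B o\<^sub>L B) = (adj B o\<^sub>L B) o\<^sub>L T \<Longrightarrow> T o\<^sub>L R = R o\<^sub>L T"
    using sqrt_adj_compose[OF B(1,2)] by blast
  have RP: "\<theta> P (R v) = R (\<theta> P v)" if P: "P \<in> \<P>1" for P v
  proof (rule blinfun_compose_apply_eq, rule Rc, rule blinfun_eqI, rule cinner_ext)
    fix v w
    have "cinner w (\<theta> P (adj B (B v))) = cinner (B (\<theta> P w)) (B v)"
      by (simp add: proj_cinner[OF proj_theta[OF P], symmetric] cinner_adj_right[OF B(1)])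
    also have "\<dots> = cinner w (adj B (B (\<theta> P v)))"
      by (simp add: inter P proj_cinner[OF proj1[OF P]] cinner_adj_right[OF B(1)])
    finally show "cinner w ((\<theta> P o\<^sub>L (adj B o\<^sub>L B)) v) = cinner w (((adj B o\<^sub>L B) o\<^sub>L \<theta> P) v)"
      by simp
  qed
  have "norm (P x) = norm (\<theta> P (R z))" if P: "P \<in> \<P>1" for P
  proof -
    have "cinner (\<theta> P (R z)) (\<theta> P (R z)) = cinner (\<theta> P z) ((R o\<^sub>L R) (\<theta> P z))"
      by (simp add: RP P cinner_self_adj[OF R(1,2)])
    also have "\<dots> = cinner (B (\<theta> P z)) (B (\<theta> P z))"
      unfolding R(3) by (simp add: cinner_adj_right[OF B(1)])
    also have "\<dots> = cinner (P x) (P x)"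
      by (simp add: B(3) P)
    finally show ?thesis
      by (simp add: norm_eq_sqrt_inner inner_cinner)
  qed
  then have "matched x (R z)"
    by (simp add: matched_def)
  moreover have "\<theta> E (R z) = R z"
    by (simp add: RP E)
  ultimately show ?thesis by blast
qed

text \<open>The Hahn decomposition of \<open>P \<mapsto> (norm (P x))\<^sup>2 - (norm (\<theta> P z))\<^sup>2\<close>, with \<open>P\<close> a maximal projection
  on which it is nonnegative.\<close>
lemma hahn_maximal:
  assumes Q: "Q \<in> \<P>1"
  shows "\<exists>P\<in>\<P>1. Q o\<^sub>L P = P \<and> norm (\<theta> P z) \<le> norm (P x) \<and>
    (\<forall>P'\<in>\<P>1. Q o\<^sub>L P' = P' \<longrightarrow> P o\<^sub>L P' = 0 \<longrightarrow> norm (P' x) \<le> norm (\<theta> P' z))"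
proof -
  define S where "S = {P\<in>\<P>1. Q o\<^sub>L P = P \<and> norm (\<theta> P z) \<le> norm (blinfun_apply P x)}"
  let ?A = "(\<lambda>P. range (blinfun_apply P)) ` S"
  have "\<exists>U\<in>?A. \<forall>X\<in>C. X \<subseteq> U" if C: "subset.chain ?A C" for C
  proof (cases "C = {}")
    case True
    have "0 \<in> S"
      by (auto simp: S_def boolean_zero[OF max1] theta_zero intro: blinfun_eqI)
    with True show ?thesis by blast
  next
    case False
    define D where "D = {P\<in>S. range (blinfun_apply P) \<in> C}"
    have CD: "C = (\<lambda>P. range (blinfun_apply P)) ` D"
      using C by (auto simp: D_def subset_chain_def)
    have Dne: "D \<noteq> {}"
      using False CD by auto
    have D1: "D \<subseteq> \<P>1"
      by (auto simp: D_def S_def)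
    let ?S = "proj_cspan (\<Union>P\<in>D. range (blinfun_apply P))"
    note S1 = theta_proj_cspan_chain[OF D1]
    have chainD: "P o\<^sub>L R = R \<or> R o\<^sub>L P = P" if PR: "P \<in> D" "R \<in> D" for P R
    proof -
      have "range R \<subseteq> range P \<or> range P \<subseteq> range R"
        using C PR by (auto simp: D_def subset_chain_def)
      then show ?thesis
        using proj_range_subset_iff[of R P] proj_range_subset_iff[of P R] PR D1 proj1 by blast
    qed
    have fixS: "?S o\<^sub>L P = P" if "P \<in> D" for P
      by (rule proj_cspan_UN_compose[OF that, of "\<lambda>P. P"])
    have "?S \<in> S"
      unfolding S_def
    proof (intro CollectI conjI S1(1))
      show "Q o\<^sub>L ?S = ?S"
        by (rule compose_proj_cspan_UN[OF boolean_clin_ops[OF max1 Q], of D "\<lambda>P. P"]) (simp add: D_def S_def)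
      \<comment> \<open>Only the left side has to be approximated along the chain; the right side
        increases with the projection.\<close>
      show "norm (\<theta> ?S z) \<le> norm (?S x)"
      proof (rule field_le_epsilon)
        fix e :: real assume e: "e > 0"
        have "\<exists>R\<in>\<theta> ` D. norm (proj_cspan (\<Union>R\<in>\<theta> ` D. range (blinfun_apply R)) z) \<le> norm (R z) + e"
        proof (rule proj_chain_approx[OF _ _ e])
          show "is_projection R" if "R \<in> \<theta> ` D" for R
            using that D1 proj_theta by blast
          show "\<theta> ` D \<noteq> {}"
            using Dne by simp
          fix P' R' assume "P' \<in> \<theta> ` D" "R' \<in> \<theta> ` D"
          then obtain P R where PR: "P \<in> D" "R \<in> D" and [simp]: "P' = \<theta> P" "R' = \<theta> R" by blast
          have "\<theta> P o\<^sub>L \<theta> R = \<theta> R \<or> \<theta> R o\<^sub>L \<theta> P = \<theta> P"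
            using chainD[OF PR] PR D1 by (auto simp: mult[symmetric] subset_iff)
          then show "range (blinfun_apply P') \<subseteq> range (blinfun_apply R') \<or>
              range (blinfun_apply R') \<subseteq> range (blinfun_apply P')"
            using proj_range_subset_iff[of R' P'] proj_range_subset_iff[of P' R'] PR D1 proj_theta by auto
        qed
        then obtain P where P: "P \<in> D" "norm (\<theta> ?S z) \<le> norm (\<theta> P z) + e"
          by (auto simp: S1(2))
        have "norm (\<theta> P z) \<le> norm (P x)"
          using P(1) by (simp add: D_def S_def)
        also have "P x = ?S (P x)"
          using fixS[OF P(1)] by (metis blinfun_apply_blinfun_compose)
        also have "\<dots> = P (?S x)"
          using boolean_commute_apply[OF max1 S1(1)] P(1) D1 by blast
        also have "norm (P (?S x)) \<le> norm (?S x)"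
          using P(1) D1 by (intro proj_norm_le proj1) blast
        finally show "norm (\<theta> ?S z) \<le> norm (?S x) + e"
          using P(2) by simp
      qed
    qed
    moreover have "range P \<subseteq> range ?S" if "P \<in> D" for P
      using fixS[OF that] that D1 by (subst proj_range_subset_iff) (auto simp: proj1 is_projection_cspan)
    ultimately show ?thesis
      unfolding CD by blast
  qed
  from subset_Zorn[OF this] obtain P where P: "P \<in> S"
    and max: "\<And>R. R \<in> S \<Longrightarrow> range (blinfun_apply P) \<subseteq> range R \<Longrightarrow> range (blinfun_apply R) = range P"
    by (metis (no_types, lifting) imageE imageI)
  have P1: "P \<in> \<P>1" and QP: "Q o\<^sub>L P = P" and Pz: "norm (\<theta> P z) \<le> norm (P x)"
    using P by (auto simp: S_def)
  have "norm (P' x) \<le> norm (\<theta> P' z)" if P': "P' \<in> \<P>1" "Q o\<^sub>L P' = P'" "P o\<^sub>L P' = 0" for P'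
  proof (rule ccontr)
    assume "\<not> norm (P' x) \<le> norm (\<theta> P' z)"
    then have lt: "norm (\<theta> P' z) < norm (P' x)" by simp
    \<comment> \<open>If \<open>P'\<close> violated the inequality, the join \<open>R\<close> of
      \<open>P\<close> and \<open>P'\<close> would lie in \<open>S\<close> and exceed
      \<open>P\<close>.\<close>
    define R where "R = id_blinfun - ((id_blinfun - P) o\<^sub>L (id_blinfun - P'))"
    have R1: "R \<in> \<P>1"
      unfolding R_def by (intro boolean_compl[OF max1] boolean_compose[OF max1] P1 P')
    have PP': "P (P' v) = 0" for v
      using P'(3) by (metis blinfun_apply_blinfun_compose zero_blinfun.rep_eq)
    have "\<theta> P (\<theta> P' v) = 0" for v
      using mult_apply[OF P1 P'(1), of v] by (simp add: P'(3) theta_zero)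
    moreover have "\<theta> R = id_blinfun - ((id_blinfun - \<theta> P) o\<^sub>L (id_blinfun - \<theta> P'))"
      unfolding R_def using P1 P'(1)
      by (simp add: compl mult boolean_compose[OF max1] boolean_compl[OF max1])
    ultimately have "(norm (\<theta> R z))\<^sup>2 = (norm (\<theta> P z))\<^sup>2 + (norm (\<theta> P' z))\<^sup>2"
      using proj_add_orthogonal[OF proj_theta[OF P1]] by simp
    also have "\<dots> \<le> (norm (P x))\<^sup>2 + (norm (P' x))\<^sup>2"
      using Pz lt by (intro add_mono power_mono) auto
    also have "\<dots> = (norm (R x))\<^sup>2"
      unfolding R_def by (rule proj_add_orthogonal[OF proj1[OF P1] PP', symmetric])
    finally have "norm (\<theta> R z) \<le> norm (R x)"
      by (rule power2_le_imp_le) simp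
    moreover have Rv: "R v = P v + P' v" for v
      by (simp add: R_def blinfun.diff_left blinfun.diff_right PP')
    have "Q o\<^sub>L R = R"
      using blinfun_compose_apply_eq[of Q P P id_blinfun] blinfun_compose_apply_eq[of Q P' P' id_blinfun]
      by (intro blinfun_eqI) (metis QP P'(2) Rv blinfun.add_right blinfun_apply_blinfun_compose)
    ultimately have "R \<in> S"
      using R1 by (simp add: S_def)
    moreover have "R o\<^sub>L P = P"
      using PP' boolean_commute_apply[OF max1 P'(1) P1]
      by (intro blinfun_eqI) (simp add: Rv proj_idem[OF proj1[OF P1]])
    then have "range P \<subseteq> range R"
      by (subst proj_range_subset_iff) (simp_all add: proj1 P1 R1)
    ultimately have "range R = range P"
      by (rule max)
    then have "R = P"
      by (intro is_projection_unique proj1 R1 P1)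
    then have "P' x = 0"
      using Rv[of x] by simp
    then show False
      using lt by simp
  qed
  then show ?thesis
    by (intro bexI[of _ P] conjI ballI impI P1 QP Pz)
qed

text \<open>With \<open>Q\<close> the cyclic projection of a vector \<open>x\<close> under
  \<open>E\<close>, and \<open>z\<close> a longer vector under \<open>\<theta> Q\<close>, the Hahn
  projection \<open>P\<close> cannot exhaust \<open>Q\<close>. On the remainder \<open>g\<close> the
  measure of \<open>z\<close> dominates that of \<open>x\<close>, and \<open>g x\<close> is nonzero
  because \<open>Q\<close> is the least projection of the family that fixes
  \<open>x\<close>.\<close>

lemma matched_exists:
  assumes E: "E \<in> \<P>1" "E \<noteq> 0"
  shows "\<exists>x y. x \<noteq> 0 \<and> E x = x \<and> \<theta> E y = y \<and> matched x y"
proof -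
  have id1: "id_blinfun \<in> \<P>1"
    by (rule boolean_id[OF max1])
  obtain v where "E v \<noteq> 0"
    using E(2) by (metis blinfun_eqI zero_blinfun.rep_eq)
  then obtain x where x: "x \<noteq> 0" "E x = x"
    using proj_idem[OF proj1[OF E(1)]] by blast
  let ?G = "{blinfun_apply P x | P. P \<in> \<P>1}"
  define Q where "Q = proj_cspan ?G"
  have "P g \<in> cspan_closure ?G" if P: "P \<in> \<P>1" and g: "g \<in> ?G" for P g
  proof -
    obtain R where R: "R \<in> \<P>1" "g = R x"
      using g by blast
    then have "P g = (P o\<^sub>L R) x" "P o\<^sub>L R \<in> \<P>1"
      using P boolean_compose[OF max1] by auto
    then show ?thesis
      by (intro cspan_closureI) blast
  qed
  then have Q1: "Q \<in> \<P>1"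
    unfolding Q_def by (rule boolean_proj_cspan[OF max1])
  have Qx: "Q x = x"
    unfolding Q_def
    by (intro proj_cspan_fix cspan_closureI CollectI exI[of _ id_blinfun]) (simp add: id1)
  have Qmin: "R o\<^sub>L Q = Q" if R: "R \<in> \<P>1" "R x = x" for R
    unfolding Q_def
    using R boolean_commute_apply[OF max1] by (intro proj_cspan_compose boolean_clin_ops[OF max1]) auto
  have "Q \<noteq> 0"
    using x(1) Qx by auto
  then have "\<theta> Q \<noteq> 0"
    using theta_inj[OF Q1 boolean_zero[OF max1]] theta_zero by auto
  then obtain w where w: "\<theta> Q w \<noteq> 0"
    by (metis blinfun_eqI zero_blinfun.rep_eq)
  \<comment> \<open>Scaled to length \<open>norm x + 1\<close>, so that
    \<open>\<theta> P z = z\<close> would contradict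
    \<open>norm (\<theta> P z) \<le> norm (P x)\<close>.\<close>
  define z where "z = ((norm x + 1) / norm (\<theta> Q w)) *\<^sub>R \<theta> Q w"
  have z: "\<theta> Q z = z" "norm z > norm x"
    using w by (auto simp: z_def blinfun.scaleR_right proj_idem[OF proj_theta[OF Q1]] add_nonneg_eq_0_iff)
  obtain P where P: "P \<in> \<P>1" "Q o\<^sub>L P = P" "norm (\<theta> P z) \<le> norm (P x)"
    and dom: "\<And>P'. P' \<in> \<P>1 \<Longrightarrow> Q o\<^sub>L P' = P' \<Longrightarrow> P o\<^sub>L P' = 0 \<Longrightarrow> norm (P' x) \<le> norm (\<theta> P' z)"
    using hahn_maximal[OF Q1, of z x] by blast
  define g where "g = Q o\<^sub>L (id_blinfun - P)"
  have g1: "g \<in> \<P>1"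
    unfolding g_def by (intro boolean_compose[OF max1] boolean_compl[OF max1] Q1 P)
  have PQ: "P (Q v) = P v" "Q (P v) = P v" for v
    using P(2) boolean_commute_apply[OF max1 P(1) Q1] by (metis blinfun_apply_blinfun_compose)+
  have gv: "g v = Q v - P v" for v
    by (simp add: g_def blinfun.diff_left blinfun.diff_right PQ)
  have "\<theta> g z = \<theta> Q z - \<theta> Q (\<theta> P z)"
    using Q1 P(1) boolean_compl[OF max1] by (simp add: g_def mult compl blinfun.diff_left blinfun.diff_right)
  also have "\<theta> Q (\<theta> P z) = \<theta> P z"
    using mult_apply[OF Q1 P(1)] by (simp add: P(2))
  finally have gz: "\<theta> g z = z - \<theta> P z"
    by (simp add: z)
  have "\<theta> g z \<noteq> 0"
    using P(3) proj_norm_le[OF proj1[OF P(1)], of x] z(2) by (auto simp: gz)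
  then have "g \<noteq> 0"
    using theta_zero by auto
  \<comment> \<open>Otherwise \<open>P\<close> fixes \<open>x\<close>, and minimality of
    \<open>Q\<close> forces \<open>g = 0\<close>.\<close>
  have gx: "g x \<noteq> 0"
  proof
    assume "g x = 0"
    then have "P x = x"
      by (simp add: gv Qx)
    then have "P o\<^sub>L Q = Q"
      by (rule Qmin[OF P(1)])
    then have "g v = 0" for v
      using PQ(1)[of v] by (metis gv blinfun_apply_blinfun_compose diff_self)
    then show False
      using \<open>g \<noteq> 0\<close> by (metis blinfun_eqI zero_blinfun.rep_eq)
  qed
  have EQ: "E o\<^sub>L Q = Q"
    by (rule Qmin[OF E(1) x(2)])
  then have Eg: "E o\<^sub>L g = g"
    by (simp add: g_def blinfun_compose_assoc[symmetric])
  have "norm (R (g x)) \<le> norm (\<theta> R (\<theta> g z))" if R: "R \<in> \<P>1" for R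
  proof -
    have Rg: "R o\<^sub>L g \<in> \<P>1"
      by (rule boolean_compose[OF max1 R g1])
    have "Q o\<^sub>L (R o\<^sub>L g) = R o\<^sub>L g"
      by (rule blinfun_eqI) (simp add: gv blinfun.diff_right boolean_commute_apply[OF max1 Q1 R]
          PQ proj_idem[OF proj1[OF Q1]])
    moreover have "P o\<^sub>L (R o\<^sub>L g) = 0"
      by (rule blinfun_eqI) (simp add: gv blinfun.diff_right boolean_commute_apply[OF max1 P(1) R]
          PQ proj_idem[OF proj1[OF P(1)]])
    ultimately have "norm ((R o\<^sub>L g) x) \<le> norm (\<theta> (R o\<^sub>L g) z)"
      by (rule dom[OF Rg])
    then show ?thesis
      by (simp add: mult_apply R g1)
  qed
  moreover have "\<theta> E (\<theta> g z) = \<theta> g z"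
    using mult_apply[OF E(1) g1, of z] by (simp add: Eg)
  ultimately obtain y where y: "\<theta> E y = y" "matched (g x) y"
    using matched_of_dominated[OF _ E(1)] by blast
  have "E (g x) = g x"
    using Eg by (metis blinfun_apply_blinfun_compose)
  with gx y show ?thesis by blast
qed

text \<open>Equivalent to orthogonality of the cyclic subspaces on both sides, since
  \<open>cinner (P x) (Q x') = cinner (Q (P x)) x'\<close> and the family is closed under
  products.\<close>

definition orthogonal_pairs :: "'a \<times> 'b \<Rightarrow> 'a \<times> 'b \<Rightarrow> bool"
  where "orthogonal_pairs p q \<longleftrightarrow> (\<forall>P\<in>\<P>1. cinner (blinfun_apply P (fst p)) (fst q) = 0 \<and>
    cinner (\<theta> P (snd p)) (snd q) = 0)"

lemma orthogonal_pairs_sym: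
  assumes "orthogonal_pairs p q"
  shows "orthogonal_pairs q p"
  unfolding orthogonal_pairs_def
proof (intro ballI conjI)
  fix P assume P: "P \<in> \<P>1"
  show "cinner (P (fst q)) (fst p) = 0" "cinner (\<theta> P (snd q)) (snd p) = 0"
    using assms P unfolding proj_cinner[OF proj1[OF P]] proj_cinner[OF proj_theta[OF P]]
    by (auto simp: orthogonal_pairs_def intro: cinner_swap_zero)
qed

text \<open>A nonzero \<open>E\<close> that annihilates all first components would contain another
  matched pair. Matching turns \<open>E x = 0\<close> into \<open>\<theta> E y = 0\<close>, so the
  new pair is orthogonal to the family on both sides and contradicts maximality.\<close>

lemma matched_family_exists:
  "\<exists>X. (\<forall>x y. (x, y) \<in> X \<longrightarrow> matched x y) \<and> pairwise orthogonal_pairs X \<and>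
    (\<forall>E\<in>\<P>1. (\<forall>x y. (x, y) \<in> X \<longrightarrow> blinfun_apply E x = 0) \<longrightarrow> E = 0)"
proof -
  define A where "A = {X. (\<forall>p\<in>X. matched (fst p) (snd p)) \<and> pairwise orthogonal_pairs X}"
  have "\<exists>X\<in>A. \<forall>Y\<in>A. X \<subseteq> Y \<longrightarrow> Y = X"
  proof (rule subset_Zorn_nonempty)
    have "{} \<in> A"
      by (simp add: A_def)
    then show "A \<noteq> {}" by blast
    fix C assume "subset.chain A C"
    then have C: "C \<subseteq> A" "\<And>X Y. X \<in> C \<Longrightarrow> Y \<in> C \<Longrightarrow> X \<subseteq> Y \<or> Y \<subseteq> X"
      by (auto simp: subset_chain_def)
    have "pairwise orthogonal_pairs (\<Union>C)"
    proof (rule pairwiseI)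
      fix p q assume pq: "p \<in> \<Union>C" "q \<in> \<Union>C" "p \<noteq> q"
      then obtain X where X: "X \<in> C" "p \<in> X" "q \<in> X"
        using C(2) by (meson UnionE subsetD)
      then have "pairwise orthogonal_pairs X"
        using C(1) by (auto simp: A_def)
      then show "orthogonal_pairs p q"
        by (rule pairwiseD) (use X pq(3) in auto)
    qed
    then show "\<Union>C \<in> A"
      using C(1) by (auto simp: A_def)
  qed
  then obtain X where X: "X \<in> A" and max: "\<And>Y. Y \<in> A \<Longrightarrow> X \<subseteq> Y \<Longrightarrow> Y = X"
    by blast
  have mX: "matched x y" if "(x, y) \<in> X" for x y
    using X that by (force simp: A_def)
  have pX: "pairwise orthogonal_pairs X"
    using X by (simp add: A_def)
  have "E = 0" if E: "E \<in> \<P>1" and Ex: "\<forall>x y. (x, y) \<in> X \<longrightarrow> blinfun_apply E x = 0" for E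
  proof (rule ccontr)
    assume "E \<noteq> 0"
    then obtain x y where xy: "x \<noteq> 0" "E x = x" "\<theta> E y = y" "matched x y"
      using matched_exists[OF E] by blast
    have Ey: "\<theta> E b = 0" if "(a, b) \<in> X" for a b
    proof -
      have "norm (E a) = norm (\<theta> E b)"
        using mX[OF that] E by (simp add: matched_def)
      then show ?thesis
        using Ex[rule_format, OF that] by simp
    qed
    have orth1: "cinner (P a) x = 0" and orth2: "cinner (\<theta> P b) y = 0"
      if "(a, b) \<in> X" "P \<in> \<P>1" for a b P
    proof -
      have "cinner (P a) x = cinner (E (P a)) x"
        by (simp add: proj_cinner[OF proj1[OF E]] xy)
      then show "cinner (P a) x = 0"
        by (simp add: boolean_commute_apply[OF max1 E that(2)] Ex[rule_format, OF that(1)])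
      have "cinner (\<theta> P b) y = cinner (\<theta> E (\<theta> P b)) y"
        by (simp add: proj_cinner[OF proj_theta[OF E]] xy)
      then show "cinner (\<theta> P b) y = 0"
        by (simp add: boolean_commute_apply[OF max2 theta_mem[OF E] theta_mem[OF that(2)]] Ey[OF that(1)])
    qed
    have "orthogonal_pairs q (x, y)" if "q \<in> X" for q
      unfolding orthogonal_pairs_def using orth1[of "fst q" "snd q"] orth2[of "fst q" "snd q"] that by simp
    then have "pairwise orthogonal_pairs (insert (x, y) X)"
      unfolding pairwise_insert using pX orthogonal_pairs_sym by simp
    then have "insert (x, y) X \<in> A"
      using X xy(4) by (simp add: A_def)
    then have "insert (x, y) X = X"
      by (rule max) blast
    then have "E x = 0"
      using Ex by blast
    with xy show False by simp
  qed
  then show ?thesis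
    by (intro exI[of _ X] conjI) (blast intro: mX, rule pX, blast)
qed

text \<open>The vectors \<open>w i\<close> and \<open>u i\<close> have the same Gram matrix: within
  one pair by matching, across pairs because both entries vanish. Hence the correspondence extends
  to contractions in both directions, and these are mutually inverse once both systems are
  total.\<close>

lemma spatial:
  "\<exists>V :: 'b \<Rightarrow>\<^sub>L 'a. unitary V \<and> (\<forall>P\<in>\<P>1. \<forall>v. V (\<theta> P v) = P (V v))"
proof -
  obtain X where mX: "\<And>x y. (x, y) \<in> X \<Longrightarrow> matched x y"
    and orth: "pairwise orthogonal_pairs X"
    and total: "\<forall>E\<in>\<P>1. (\<forall>x y. (x, y) \<in> X \<longrightarrow> blinfun_apply E x = 0) \<longrightarrow> E = 0"
    using matched_family_exists by auto
  have id1: "id_blinfun \<in> \<P>1"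
    by (rule boolean_id[OF max1])
  define I where "I = \<P>1 \<times> X"
  define w :: "('a \<Rightarrow>\<^sub>L 'a) \<times> 'a \<times> 'b \<Rightarrow> 'a" where "w i = fst i (fst (snd i))" for i
  define u :: "('a \<Rightarrow>\<^sub>L 'a) \<times> 'a \<times> 'b \<Rightarrow> 'b" where "u i = \<theta> (fst i) (snd (snd i))" for i
  have gram: "cinner (w i) (w j) = cinner (u i) (u j)" if ij: "i \<in> I" "j \<in> I" for i j
  proof -
    obtain P p where i: "i = (P, p)" "P \<in> \<P>1" "p \<in> X"
      using ij(1) by (cases i) (auto simp: I_def)
    obtain Q q where j: "j = (Q, q)" "Q \<in> \<P>1" "q \<in> X"
      using ij(2) by (cases j) (auto simp: I_def)
    show ?thesis
    proof (cases "p = q")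
      case True
      then show ?thesis
        using matched_cinner[OF mX i(2) j(2), of "fst p" "snd p"] i(3)
        by (simp add: w_def u_def i(1) j(1))
    next
      case False
      then have "cinner ((Q o\<^sub>L P) (fst p)) (fst q) = 0" "cinner (\<theta> (Q o\<^sub>L P) (snd p)) (snd q) = 0"
        using pairwiseD[OF orth i(3) j(3)] boolean_compose[OF max1 j(2) i(2)]
        by (auto simp: orthogonal_pairs_def)
      then show ?thesis
        by (simp add: w_def u_def i(1) j(1) mult_apply i(2) j(2) proj_cinner[OF proj1[OF j(2)]]
            proj_cinner[OF proj_theta[OF j(2)]])
    qed
  qed
  have norm_eq: "norm (\<Sum>i\<in>J. c i *\<^sub>C w i) = norm (\<Sum>i\<in>J. c i *\<^sub>C u i)" if "J \<subseteq> I" for J c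
  proof -
    have "cinner (\<Sum>i\<in>J. c i *\<^sub>C w i) (\<Sum>i\<in>J. c i *\<^sub>C w i) = cinner (\<Sum>i\<in>J. c i *\<^sub>C u i) (\<Sum>i\<in>J. c i *\<^sub>C u i)"
      unfolding cinner_sum_left cinner_sum_right cinner_scaleC_left cinner_scaleC_right
      by (intro sum.cong refl arg_cong2[where f = "(*)"] gram subsetD[OF that])
    then show ?thesis
      by (simp add: norm_eq_sqrt_inner inner_cinner)
  qed
  obtain V :: "'b \<Rightarrow>\<^sub>L 'a" where V: "V \<in> clin_ops" "\<And>i. i \<in> I \<Longrightarrow> V (u i) = w i"
    using contraction_extension[of I w u, OF eq_refl[OF norm_eq]] by blast
  obtain V' :: "'a \<Rightarrow>\<^sub>L 'b" where V': "V' \<in> clin_ops" "\<And>i. i \<in> I \<Longrightarrow> V' (w i) = u i"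
    using contraction_extension[of I u w, OF eq_refl[OF norm_eq[symmetric]]] by blast
  have PI: "(P, p) \<in> I" if "P \<in> \<P>1" "p \<in> X" for P p
    using that by (simp add: I_def)
  have Pw: "P (w i) = w (P o\<^sub>L fst i, snd i)" "\<theta> P (u i) = u (P o\<^sub>L fst i, snd i)"
      "(P o\<^sub>L fst i, snd i) \<in> I" if "P \<in> \<P>1" "i \<in> I" for P i
    using that boolean_compose[OF max1] by (auto simp: w_def u_def I_def mult_apply)
  have "proj_cspan (w ` I) \<in> \<P>1"
  proof (rule boolean_proj_cspan[OF max1])
    fix P g assume "P \<in> \<P>1" "g \<in> w ` I"
    then show "P g \<in> cspan_closure (w ` I)"
      using Pw by (intro cspan_closureI) auto
  qed
  moreover have "proj_cspan (w ` I) x = x" if "(x, y) \<in> X" for x y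
    using PI[OF id1 that]
    by (intro proj_cspan_fix cspan_closureI image_eqI[of _ _ "(id_blinfun, x, y)"]) (auto simp: w_def)
  ultimately have "id_blinfun - proj_cspan (w ` I) = 0"
    by (intro total[rule_format] boolean_compl[OF max1]) (auto simp: blinfun.diff_left)
  then have w_total: "proj_cspan (w ` I) = id_blinfun"
    by simp
  have "proj_cspan (u ` I) \<in> \<P>2"
  proof (rule boolean_proj_cspan[OF max2])
    fix Q g assume "Q \<in> \<P>2" "g \<in> u ` I"
    then obtain P i where "P \<in> \<P>1" "Q = \<theta> P" "i \<in> I" "g = u i"
      using theta_surj by blast
    then show "Q g \<in> cspan_closure (u ` I)"
      using Pw by (intro cspan_closureI) auto
  qed
  \<comment> \<open>Totality on the second side is pulled back: the complement of the span is some
    \<open>\<theta> E\<close>, and matching shows that \<open>E\<close> annihilates all first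
    components.\<close>
  then obtain E where E: "E \<in> \<P>1" "\<theta> E = id_blinfun - proj_cspan (u ` I)"
    using theta_surj boolean_compl[OF max2] by blast
  have "E = 0"
  proof (rule total[rule_format, OF E(1)])
    fix x y assume xy: "(x, y) \<in> X"
    have "proj_cspan (u ` I) y = y"
      using PI[OF id1 xy]
      by (intro proj_cspan_fix cspan_closureI image_eqI[of _ _ "(id_blinfun, x, y)"]) (auto simp: u_def theta_id)
    then have "\<theta> E y = 0"
      by (simp add: E(2) blinfun.diff_left)
    moreover have "norm (E x) = norm (\<theta> E y)"
      using mX[OF xy] E(1) by (simp add: matched_def)
    ultimately show "E x = 0"
      by simp
  qed
  then have u_total: "proj_cspan (u ` I) = id_blinfun"
    using E(2) theta_zero by simp
  have w_eqI: "S = T" if "S \<in> clin_ops" "T \<in> clin_ops" "\<And>i. i \<in> I \<Longrightarrow> S (w i) = T (w i)"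
    for S T :: "'a \<Rightarrow>\<^sub>L 'c::complex_inner"
    by (rule blinfun_eqI, rule clin_ops_eq_on_cspan_closure[OF that(1,2), of "w ` I"])
       (use that(3) w_total[folded cspan_closure_eq_UNIV_iff] in auto)
  have u_eqI: "S = T" if "S \<in> clin_ops" "T \<in> clin_ops" "\<And>i. i \<in> I \<Longrightarrow> S (u i) = T (u i)"
    for S T :: "'b \<Rightarrow>\<^sub>L 'c::complex_inner"
    by (rule blinfun_eqI, rule clin_ops_eq_on_cspan_closure[OF that(1,2), of "u ` I"])
       (use that(3) u_total[folded cspan_closure_eq_UNIV_iff] in auto)
  have "adj V = V'"
  proof (rule w_eqI[OF adj_clin_ops[OF V(1)] V'(1)])
    fix i assume i: "i \<in> I"
    have "proj_cspan (u ` I) (adj V (w i) - u i) = 0"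
    proof (rule proj_cspan_orthogonal)
      fix g assume "g \<in> u ` I"
      then obtain j where "j \<in> I" "g = u j" by blast
      then show "cinner g (adj V (w i) - u i) = 0"
        by (simp add: cinner_diff_right cinner_adj_right[OF V(1)] V(2) gram i)
    qed
    then show "adj V (w i) = V' (w i)"
      by (simp add: u_total V' i)
  qed
  moreover have "V o\<^sub>L V' = id_blinfun"
    by (rule w_eqI) (use V V' in auto)
  moreover have "V' o\<^sub>L V = id_blinfun"
    by (rule u_eqI) (use V V' in auto)
  ultimately have "unitary V"
    by (simp add: unitary_def V(1))
  moreover have "V (\<theta> P v) = P (V v)" if P: "P \<in> \<P>1" for P v
  proof (rule blinfun_compose_apply_eq, rule u_eqI)
    show "V o\<^sub>L \<theta> P \<in> clin_ops" "P o\<^sub>L V \<in> clin_ops"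
      using V(1) P proj_clin_ops proj1 proj_theta by blast+
    show "(V o\<^sub>L \<theta> P) (u i) = (P o\<^sub>L V) (u i)" if "i \<in> I" for i
      using Pw[OF P that] that by (simp add: V)
  qed
  ultimately show ?thesis
    by blast
qed

end

subsection \<open>Elementary tensors and rank one operators\<close>

lemma tensor_add_left: "(x + x') \<otimes>\<^sub>h y = x \<otimes>\<^sub>h y + x' \<otimes>\<^sub>h y"
proof -
  have "elem_tensor (x + x') y = elem_tensor x y + elem_tensor x' y"
    by transfer (simp add: cinner_add_right algebra_simps)
  then show ?thesis
    by (simp add: tensor_def embed_completion_add)
qed

lemma tensor_add_right: "x \<otimes>\<^sub>h (y + y') = x \<otimes>\<^sub>h y + x \<otimes>\<^sub>h y'"
proof -
  have "elem_tensor x (y + y') = elem_tensor x y + elem_tensor x y'"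
    by transfer (simp add: cinner_add_right algebra_simps)
  then show ?thesis
    by (simp add: tensor_def embed_completion_add)
qed

lemma tensor_scaleC_left: "(c *\<^sub>C x) \<otimes>\<^sub>h y = c *\<^sub>C (x \<otimes>\<^sub>h y)"
proof -
  have "elem_tensor (c *\<^sub>C x) y = c *\<^sub>C elem_tensor x y"
    by transfer (simp add: cinner_scaleC_right algebra_simps)
  then show ?thesis
    by (simp add: tensor_def embed_completion_scaleC)
qed

lemma tensor_scaleC_right: "x \<otimes>\<^sub>h (c *\<^sub>C y) = c *\<^sub>C (x \<otimes>\<^sub>h y)"
proof -
  have "elem_tensor x (c *\<^sub>C y) = c *\<^sub>C elem_tensor x y"
    by transfer (simp add: cinner_scaleC_right algebra_simps)
  then show ?thesis
    by (simp add: tensor_def embed_completion_scaleC)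
qed

lemma norm_tensor: "norm (x \<otimes>\<^sub>h y) = norm x * norm y"
proof -
  have "complex_of_real ((norm (x \<otimes>\<^sub>h y))\<^sup>2) = complex_of_real ((norm x * norm y)\<^sup>2)"
    unfolding cinner_self_norm[symmetric] cinner_tensor
    by (simp add: cinner_self_norm power_mult_distrib)
  then show ?thesis
    unfolding of_real_eq_iff by (simp add: power2_eq_iff_nonneg)
qed

lemma tensor_zero_left [simp]: "0 \<otimes>\<^sub>h y = 0"
  using norm_tensor[of 0 y] by simp

lemma tensor_zero_right [simp]: "x \<otimes>\<^sub>h 0 = 0"
  using norm_tensor[of x 0] by simp

lemma tensor_diff_left: "(x - x') \<otimes>\<^sub>h y = x \<otimes>\<^sub>h y - x' \<otimes>\<^sub>h y"
  using tensor_add_left[of "x - x'" x' y] by simp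

lemma tensor_cancel: "x \<otimes>\<^sub>h e = y \<otimes>\<^sub>h e \<Longrightarrow> norm e = 1 \<Longrightarrow> x = y"
  using norm_tensor[of "x - y" e] by (simp add: tensor_diff_left)

lemma tensor_ext:
  fixes z z' :: "('a::complex_inner, 'b::complex_inner) hilbert_tensor"
  assumes "\<And>x y. cinner (x \<otimes>\<^sub>h y) z = cinner (x \<otimes>\<^sub>h y) z'"
  shows "z = z'"
proof -
  have "closed {v. cinner v (z - z') = 0}"
    by (intro closed_Collect_eq bounded_bilinear.continuous_on[OF bounded_bilinear_cinner]
        continuous_on_id continuous_on_const)
  then have "{v. cinner v (z - z') = 0} = UNIV"
    using assms
    by (intro tensor_total) (auto simp: csubspace_def cinner_add_left cinner_scaleC_left cinner_diff_right)
  then have "cinner (z - z') (z - z') = 0"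
    by blast
  then show ?thesis
    by (simp only: cinner_eq_zero_iff right_minus_eq)
qed

lemma tensor_op_compose:
  fixes S S' :: "'a::chilbert_space \<Rightarrow>\<^sub>L 'a" and T T' :: "'b::chilbert_space \<Rightarrow>\<^sub>L 'b"
  assumes "S \<in> clin_ops" "T \<in> clin_ops" "S' \<in> clin_ops" "T' \<in> clin_ops"
  shows "tensor_op S T o\<^sub>L tensor_op S' T' = tensor_op (S o\<^sub>L S') (T o\<^sub>L T')"
  by (rule clin_ops_tensor_eqI)
     (use assms in \<open>auto simp: tensor_op_apply tensor_op_clin_ops clin_ops_intros\<close>)

lemma tensor_op_diff_left:
  fixes S S' :: "'a::chilbert_space \<Rightarrow>\<^sub>L 'a" and T :: "'b::chilbert_space \<Rightarrow>\<^sub>L 'b"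
  assumes "S \<in> clin_ops" "S' \<in> clin_ops" "T \<in> clin_ops"
  shows "tensor_op (S - S') T = tensor_op S T - tensor_op S' T"
  by (rule clin_ops_tensor_eqI)
     (use assms in \<open>auto simp: tensor_op_apply tensor_op_clin_ops clin_ops_intros blinfun.diff_left
       tensor_diff_left\<close>)

lemma tensor_op_id: "tensor_op id_blinfun id_blinfun
    = (id_blinfun :: ('a::chilbert_space, 'b::chilbert_space) hilbert_tensor \<Rightarrow>\<^sub>L _)"
  by (rule clin_ops_tensor_eqI) (auto simp: tensor_op_apply tensor_op_clin_ops clin_ops_intros)

lemma tensor_op_zero_left: "T \<in> clin_ops \<Longrightarrow> tensor_op (0 :: 'a::chilbert_space \<Rightarrow>\<^sub>L 'a) T = 0"
  for T :: "'b::chilbert_space \<Rightarrow>\<^sub>L 'b"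
  by (rule clin_ops_tensor_eqI) (auto simp: tensor_op_apply tensor_op_clin_ops clin_ops_intros)

lemma adj_tensor_op:
  fixes S :: "'a::chilbert_space \<Rightarrow>\<^sub>L 'a" and T :: "'b::chilbert_space \<Rightarrow>\<^sub>L 'b"
  assumes S: "S \<in> clin_ops" and T: "T \<in> clin_ops"
  shows "adj (tensor_op S T) = tensor_op (adj S) (adj T)"
proof (rule clin_ops_tensor_eqI)
  show "adj (tensor_op S T) \<in> clin_ops" "tensor_op (adj S) (adj T) \<in> clin_ops"
    by (intro adj_clin_ops tensor_op_clin_ops S T)+
  fix x y
  show "adj (tensor_op S T) (x \<otimes>\<^sub>h y) = tensor_op (adj S) (adj T) (x \<otimes>\<^sub>h y)"
    by (rule tensor_ext)
       (simp add: cinner_adj_right tensor_op_clin_ops tensor_op_apply adj_clin_ops S T cinner_tensor)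
qed

lemma is_projection_tensor_op:
  fixes P :: "'a::chilbert_space \<Rightarrow>\<^sub>L 'a" and Q :: "'b::chilbert_space \<Rightarrow>\<^sub>L 'b"
  assumes "is_projection P" "is_projection Q"
  shows "is_projection (tensor_op P Q)"
  using assms unfolding is_projection_def
  by (auto simp: tensor_op_clin_ops tensor_op_compose adj_tensor_op)

definition rank_one :: "'a::complex_inner \<Rightarrow> 'a \<Rightarrow> ('a \<Rightarrow>\<^sub>L 'a)"
  where "rank_one u v = Blinfun (\<lambda>x. cinner v x *\<^sub>C u)"

lemma
  shows rank_one_clin_ops: "rank_one u v \<in> clin_ops"
    and rank_one_apply [simp]: "blinfun_apply (rank_one u v) x = cinner v x *\<^sub>C u"
proof -
  have *: "norm (cinner v x *\<^sub>C u) \<le> norm x * (norm v * norm u)" for x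
    using mult_right_mono[OF norm_cinner_le[of v x], of "norm u"] by (simp add: norm_scaleC mult_ac)
  show "rank_one u v \<in> clin_ops" "blinfun_apply (rank_one u v) x = cinner v x *\<^sub>C u"
    unfolding rank_one_def
    by (rule clin_ops_Blinfun[OF _ _ *]; simp add: cinner_add_right scaleC_add_left cinner_scaleC_right scaleC_scaleC)+
qed

lemma rank_one_compact: "rank_one u v \<in> compact_ops"
proof -
  have "continuous_on (cball 0 (norm v)) (\<lambda>c. c *\<^sub>C u)"
    by (rule linear_continuous_on, rule bounded_linear_intro[of _ "norm u"])
       (auto simp: scaleC_add_left norm_scaleC scaleR_scaleC scaleC_scaleC scaleR_conv_of_real)
  then have K: "compact ((\<lambda>c. c *\<^sub>C u) ` cball 0 (norm v))"
    by (intro compact_continuous_image) auto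
  have "blinfun_apply (rank_one u v) ` cball 0 1 \<subseteq> (\<lambda>c. c *\<^sub>C u) ` cball 0 (norm v)"
  proof (rule image_subsetI)
    fix x :: 'a assume "x \<in> cball 0 1"
    then have "cmod (cinner v x) \<le> norm v"
      using norm_cinner_le[of v x] mult_left_mono[of "norm x" 1 "norm v"] by simp
    then show "rank_one u v x \<in> (\<lambda>c. c *\<^sub>C u) ` cball 0 (norm v)"
      by (intro image_eqI[of _ _ "cinner v x"]) auto
  qed
  then have "closure (blinfun_apply (rank_one u v) ` cball 0 1) \<subseteq> (\<lambda>c. c *\<^sub>C u) ` cball 0 (norm v)"
    by (intro closure_minimal compact_imp_closed K)
  then have "compact (closure (blinfun_apply (rank_one u v) ` cball 0 1))"
    using compact_Int_closed[OF K closed_closure, of "blinfun_apply (rank_one u v) ` cball 0 1"]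
    by (simp add: Int_absorb1)
  then show ?thesis
    by (simp add: compact_ops_def rank_one_clin_ops)
qed

lemma compose_rank_one: "T \<in> clin_ops \<Longrightarrow> T o\<^sub>L rank_one u v = rank_one (T u) v"
  by (rule blinfun_eqI) (simp add: clin_opsD)

lemma is_projection_rank_one: "norm e = 1 \<Longrightarrow> is_projection (rank_one e e)"
  for e :: "'a::chilbert_space"
proof (rule is_projectionI[OF rank_one_clin_ops])
  fix x y assume e: "norm e = 1"
  then show "rank_one e e (rank_one e e x) = rank_one e e x"
    by (simp add: cinner_scaleC_right cinner_self_norm)
  show "cinner (rank_one e e x) y = cinner x (rank_one e e y)"
    by (simp add: cinner_scaleC_left cinner_scaleC_right mult.commute cinner_commute[of x e])
qed

text \<open>Allows a projection \<open>rank_one u u\<close> to be inserted to the left of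
  \<open>rank_one w e\<close>; in contrast to \<open>rank_one w e\<close> itself, it leads to
  elements whose image under \<open>\<phi>\<close> is a projection.\<close>

lemma rank_one_split:
  fixes w :: "'a::chilbert_space"
  assumes "w \<noteq> 0"
  shows "\<exists>u. norm u = 1 \<and> rank_one u u o\<^sub>L rank_one w e = rank_one w e"
proof (intro exI[of _ "(1 / norm w) *\<^sub>R w"] conjI)
  have "cinner ((1 / norm w) *\<^sub>R w) w = complex_of_real (norm w)"
    using assms by (simp only: cinner_scaleR_left cinner_self_norm) (simp add: power2_eq_square)
  then have "cinner ((1 / norm w) *\<^sub>R w) w *\<^sub>C ((1 / norm w) *\<^sub>R w) = w"
    using assms by (simp only: scaleR_scaleC[symmetric]) simp
  then show "rank_one ((1 / norm w) *\<^sub>R w) ((1 / norm w) *\<^sub>R w) o\<^sub>L rank_one w e = rank_one w e"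
    by (simp add: compose_rank_one rank_one_clin_ops)
qed (use assms in simp)

subsection \<open>The projections commuting with a multiplicity free lattice\<close>

lemma commutant_clin_ops: "commutant X \<subseteq> clin_ops"
  by (auto simp: commutant_def)

lemma commutant_antimono: "X \<subseteq> Y \<Longrightarrow> commutant Y \<subseteq> commutant X"
  by (auto simp: commutant_def)

lemma subset_double_commutant: "X \<subseteq> clin_ops \<Longrightarrow> X \<subseteq> commutant (commutant X)"
  by (auto simp: commutant_def)

lemma commutant_iff:
  "T \<in> commutant X \<longleftrightarrow> T \<in> clin_ops \<and> (\<forall>R\<in>X. \<forall>x. blinfun_apply T (R x) = R (T x))"
  unfolding commutant_def
  by (auto intro: blinfun_eqI dest: blinfun_compose_apply_eq)

lemma subalgebra_commutant:
  assumes X: "X \<subseteq> clin_ops"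
  shows "subalgebra (commutant X)"
  unfolding subalgebra_def csubspace_def
proof (intro conjI ballI allI)
  show "0 \<in> commutant X"
    by (simp add: commutant_iff clin_ops_intros)
next
  fix S T assume "S \<in> commutant X" "T \<in> commutant X"
  then show "S + T \<in> commutant X" "S o\<^sub>L T \<in> commutant X"
    by (simp_all add: commutant_iff clin_ops_intros blinfun.add_left blinfun.add_right)
next
  fix c S assume S: "S \<in> commutant X"
  have "R (c *\<^sub>C x) = c *\<^sub>C R x" if "R \<in> X" for R x
    using that X by (intro clin_opsD) blast
  with S show "c *\<^sub>C S \<in> commutant X"
    by (simp add: commutant_iff clin_ops_intros)
qed (rule commutant_clin_ops)

lemma adj_commutant:
  fixes X :: "('a::chilbert_space \<Rightarrow>\<^sub>L 'a) set"
  assumes X: "X \<subseteq> clin_ops" "adj ` X \<subseteq> X"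
  shows "adj ` commutant X \<subseteq> commutant X"
proof (rule image_subsetI)
  fix T assume T: "T \<in> commutant X"
  then have Tc: "T \<in> clin_ops"
    by (simp add: commutant_def)
  have "adj T o\<^sub>L S = S o\<^sub>L adj T" if S: "S \<in> X" for S
  proof -
    have Sc: "S \<in> clin_ops" and "adj S \<in> X"
      using S X by auto
    then have "adj (T o\<^sub>L adj S) = adj (adj S o\<^sub>L T)"
      using T by (simp add: commutant_def)
    then show ?thesis
      by (simp add: adj_compose Tc Sc adj_clin_ops adj_adj)
  qed
  then show "adj T \<in> commutant X"
    by (simp add: commutant_def adj_clin_ops Tc)
qed

text \<open>The projections of \<open>L'\<close>. For a multiplicity free commutative lattice they
  are exactly those of the masa \<open>L''\<close>.\<close>

definition commuting_projections :: "('a::complex_inner \<Rightarrow>\<^sub>L 'a) set \<Rightarrow> ('a \<Rightarrow>\<^sub>L 'a) set"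
  where "commuting_projections L = {P \<in> commutant L. is_projection P}"

text \<open>A projection commuting with \<open>L\<close> generates together with the masa \<open>L''\<close> an abelian algebra,
  so it already belongs to \<open>L''\<close>.\<close>
lemma commuting_projections_double_commutant:
  fixes L :: "('a::chilbert_space \<Rightarrow>\<^sub>L 'a) set"
  assumes L: "L \<subseteq> clin_ops" and mf: "multiplicity_free L"
  shows "commuting_projections L \<subseteq> commutant (commutant L)"
proof
  fix P assume P: "P \<in> commuting_projections L"
  then have P': "P \<in> commutant L" and isP: "is_projection P"
    by (auto simp: commuting_projections_def)
  define M where "M = commutant (commutant L)"
  define X where "X = insert P M"
  have masa: "masa M"
    using mf by (simp add: multiplicity_free_def M_def)
  have abM: "adj ` M \<subseteq> M" "\<And>S T. S \<in> M \<Longrightarrow> T \<in> M \<Longrightarrow> S o\<^sub>L T = T o\<^sub>L S"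
    using masa by (auto simp: masa_def abelian_selfadjoint_subalgebra_def)
  have Xc: "X \<subseteq> clin_ops"
    using P' by (auto simp: X_def M_def commutant_def)
  have Xadj: "adj ` X \<subseteq> X"
    using abM(1) proj_adj[OF isP] by (auto simp: X_def)
  have PM: "P o\<^sub>L T = T o\<^sub>L P" if "T \<in> M" for T
    using that P' by (simp add: M_def commutant_def[of "commutant L"])
  have XX: "X \<subseteq> commutant X"
    using Xc PM abM(2) by (auto simp: commutant_def X_def)
  let ?N = "commutant (commutant X)"
  have "?N \<subseteq> commutant X"
    by (rule commutant_antimono[OF XX])
  then have "S o\<^sub>L T = T o\<^sub>L S" if "S \<in> ?N" "T \<in> ?N" for S T
    using that by (auto simp: commutant_def[of "commutant X"])
  then have "abelian_selfadjoint_subalgebra ?N"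
    unfolding abelian_selfadjoint_subalgebra_def
    by (intro conjI ballI subalgebra_commutant commutant_clin_ops adj_commutant Xc Xadj)
  moreover have "X \<subseteq> ?N"
    by (rule subset_double_commutant[OF Xc])
  ultimately have "?N = M"
    using masa by (auto simp: masa_def X_def)
  then show "P \<in> commutant (commutant L)"
    using \<open>X \<subseteq> ?N\<close> by (auto simp: X_def M_def)
qed

lemma csubspace_clin_ops: "csubspace clin_ops"
  by (simp add: csubspace_def clin_ops_intros)

lemma
  fixes R :: "'c::complex_inner \<Rightarrow>\<^sub>L 'd::complex_inner" and P :: "'b::real_normed_vector \<Rightarrow>\<^sub>L 'c"
  assumes R: "R \<in> clin_ops" and X: "csubspace X" "closed X"
  shows csubspace_compose_vimage: "csubspace {a. R o\<^sub>L (a o\<^sub>L P) \<in> X}"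
    and closed_compose_vimage: "closed {a. R o\<^sub>L (a o\<^sub>L P) \<in> X}"
proof -
  note bil = bounded_bilinear_blinfun_compose
  have "R o\<^sub>L ((c *\<^sub>C a) o\<^sub>L P) = c *\<^sub>C (R o\<^sub>L (a o\<^sub>L P))" for c a
    by (rule blinfun_eqI) (simp add: clin_opsD[OF R])
  then show "csubspace {a. R o\<^sub>L (a o\<^sub>L P) \<in> X}"
    using X(1) unfolding csubspace_def
    by (auto simp: bounded_bilinear.add_left[OF bil] bounded_bilinear.add_right[OF bil])
  have "closed ((\<lambda>a. R o\<^sub>L (a o\<^sub>L P)) -` X)"
    by (intro closed_vimage X(2) bounded_bilinear.continuous_on[OF bil] continuous_on_const continuous_on_id)
  then show "closed {a. R o\<^sub>L (a o\<^sub>L P) \<in> X}"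
    by (simp add: vimage_def)
qed

lemma in_Alg_iff:
  "T \<in> Alg L \<longleftrightarrow> T \<in> clin_ops \<and> (\<forall>P\<in>L. (id_blinfun - P) o\<^sub>L (T o\<^sub>L P) = 0)"
  by (simp add: Alg_def blinfun_compose_assoc)

subsection \<open>The algebras \<open>Alg L \<otimes> B\<close>\<close>

locale stable_algebra =
  fixes L :: "('h::chilbert_space \<Rightarrow>\<^sub>L 'h) set" and B :: "('k::chilbert_space \<Rightarrow>\<^sub>L 'k) set"
  assumes csl: "csl L" and mf: "multiplicity_free L"
    and B_algebra: "operator_algebra B" and compact: "compact_ops \<subseteq> B"
begin

abbreviation "\<P> \<equiv> commuting_projections L"

definition "A = spatial_tensor (Alg L) B"

lemma L_proj: "Q \<in> L \<Longrightarrow> is_projection Q"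
  using csl by (simp add: csl_def subspace_lattice_def)

lemma L_clin_ops: "L \<subseteq> clin_ops"
  using L_proj proj_clin_ops by blast

lemma L_commuting: "L \<subseteq> \<P>"
  using csl L_proj L_clin_ops by (auto simp: csl_def commuting_projections_def commutant_def)

lemma commuting_proj: "P \<in> \<P> \<Longrightarrow> is_projection P"
  by (simp add: commuting_projections_def)

lemma commuting_clin_ops: "P \<in> \<P> \<Longrightarrow> P \<in> clin_ops"
  by (simp add: commuting_proj proj_clin_ops)

text \<open>The family contains \<open>L\<close>, so a projection commuting with all of it lies in
  \<open>L'\<close>. Two members commute because each lies in \<open>L'\<close> and, by multiplicity
  freeness, also in \<open>L''\<close>.\<close>

lemma maximal_boolean_commuting: "maximal_boolean \<P>"
  unfolding maximal_boolean_def
proof (intro conjI ballI allI impI iffI)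
  fix P assume "is_projection P" "\<forall>Q\<in>\<P>. P o\<^sub>L Q = Q o\<^sub>L P"
  then show "P \<in> \<P>"
    using L_commuting by (auto simp: commuting_projections_def commutant_def proj_clin_ops)
next
  fix P Q assume "P \<in> \<P>" "Q \<in> \<P>"
  then have "P \<in> commutant (commutant L)" "Q \<in> commutant L"
    using commuting_projections_double_commutant[OF L_clin_ops mf] by (auto simp: commuting_projections_def)
  then show "P o\<^sub>L Q = Q o\<^sub>L P"
    by (simp add: commutant_def[of "commutant L"])
qed (rule commuting_proj)

section \<open>Generators and multipliers of \<open>A\<close>\<close>

lemma commuting_Alg:
  assumes P: "P \<in> \<P>"
  shows "P \<in> Alg L"
  unfolding Alg_def
proof (intro CollectI conjI ballI blinfun_eqI)
  show "P \<in> clin_ops"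
    by (rule commuting_clin_ops[OF P])
  fix Q x assume Q: "Q \<in> L"
  have "P o\<^sub>L Q = Q o\<^sub>L P"
    using P Q by (simp add: commuting_projections_def commutant_def)
  from blinfun_compose_apply_eq[OF this, of x] blinfun_compose_apply_eq[OF this, of "Q x"]
  show "((id_blinfun - Q) o\<^sub>L P o\<^sub>L Q) x = blinfun_apply 0 x"
    using L_proj[OF Q] by (simp add: blinfun.diff_left proj_idem)
qed

lemma Alg_clin_ops: "Alg L \<subseteq> clin_ops"
  by (auto simp: Alg_def)

lemma Alg_compose:
  assumes "S \<in> Alg L" "T \<in> Alg L"
  shows "S o\<^sub>L T \<in> Alg L"
proof -
  have inv: "Q (R (Q x)) = R (Q x)" if "R \<in> Alg L" "Q \<in> L" for R Q x
  proof -
    have "(id_blinfun - Q) o\<^sub>L R o\<^sub>L Q = 0"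
      using that by (simp add: Alg_def)
    then have "((id_blinfun - Q) o\<^sub>L R o\<^sub>L Q) x = 0"
      by simp
    then show ?thesis
      by (simp add: blinfun.diff_left)
  qed
  have "((id_blinfun - Q) o\<^sub>L (S o\<^sub>L T) o\<^sub>L Q) x = 0" if "Q \<in> L" for Q x
    using inv[OF assms(1) that, of "T (Q x)"] inv[OF assms(2) that, of x]
    by (simp add: blinfun.diff_left)
  then show ?thesis
    using assms by (auto simp: Alg_def intro!: clin_ops_intros blinfun_eqI)
qed

lemma B_clin_ops: "B \<subseteq> clin_ops"
  and B_compose: "S \<in> B \<Longrightarrow> T \<in> B \<Longrightarrow> S o\<^sub>L T \<in> B"
  using B_algebra by (auto simp: operator_algebra_def subalgebra_def)

lemma rank_one_B: "rank_one u v \<in> B"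
  using rank_one_compact compact by blast

lemma A_eq: "A = cspan_closure {tensor_op S T | S T. S \<in> Alg L \<and> T \<in> B}"
  by (simp add: A_def spatial_tensor_def cspan_closure_def)

lemma closed_A: "closed A" and csubspace_A: "csubspace A"
  by (simp_all add: A_eq closed_cspan_closure csubspace_cspan_closure_blinfun)

lemma tensor_op_A: "S \<in> Alg L \<Longrightarrow> T \<in> B \<Longrightarrow> tensor_op S T \<in> A"
  unfolding A_eq by (intro cspan_closureI) blast

lemma A_induct:
  assumes "csubspace X" "closed X" "\<And>S T. S \<in> Alg L \<Longrightarrow> T \<in> B \<Longrightarrow> tensor_op S T \<in> X"
  shows "A \<subseteq> X"
  unfolding A_eq by (rule cspan_closure_minimal[OF assms(1,2)]) (use assms(3) in blast)

lemma A_clin_ops: "A \<subseteq> clin_ops"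
  using Alg_clin_ops B_clin_ops
  by (intro A_induct csubspace_clin_ops closed_clin_ops tensor_op_clin_ops) auto

text \<open>The form in which density of the elementary tensors is used: a closed linear condition
  on the compression of \<open>a\<close> has to be checked on generators only.\<close>

lemma A_compose_closed:
  assumes R: "R \<in> clin_ops" and X: "csubspace X" "closed X"
    and gen: "\<And>S T. S \<in> Alg L \<Longrightarrow> T \<in> B \<Longrightarrow> R o\<^sub>L (tensor_op S T o\<^sub>L P) \<in> X" and a: "a \<in> A"
  shows "R o\<^sub>L (a o\<^sub>L P) \<in> X"
proof -
  have "A \<subseteq> {a. R o\<^sub>L (a o\<^sub>L P) \<in> X}"
    by (intro A_induct csubspace_compose_vimage closed_compose_vimage R X CollectI gen)
  then show ?thesis
    using a by blast
qed

text \<open>\<open>T\<close> is only required to multiply \<open>B\<close> into itself. This admits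
  \<open>T = id_blinfun\<close> when \<open>B\<close> has no unit, and so makes
  \<open>S \<otimes> 1\<close> a multiplier of \<open>A\<close>.\<close>

lemma tensor_op_compose_A:
  assumes S: "S \<in> Alg L" and T: "T \<in> clin_ops" "\<And>T'. T' \<in> B \<Longrightarrow> T o\<^sub>L T' \<in> B" and a: "a \<in> A"
  shows "tensor_op S T o\<^sub>L a \<in> A"
proof -
  have Sc: "S \<in> clin_ops"
    using S Alg_clin_ops by blast
  have "tensor_op S T o\<^sub>L (a o\<^sub>L id_blinfun) \<in> A"
  proof (rule A_compose_closed[OF tensor_op_clin_ops[OF Sc T(1)] csubspace_A closed_A _ a])
    fix S' T' assume ST: "S' \<in> Alg L" "T' \<in> B"
    then have "S' \<in> clin_ops" "T' \<in> clin_ops"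
      using Alg_clin_ops B_clin_ops by auto
    then have "tensor_op S T o\<^sub>L (tensor_op S' T' o\<^sub>L id_blinfun) = tensor_op (S o\<^sub>L S') (T o\<^sub>L T')"
      by (simp add: compose_id tensor_op_compose Sc T(1))
    then show "tensor_op S T o\<^sub>L (tensor_op S' T' o\<^sub>L id_blinfun) \<in> A"
      by (simp add: tensor_op_A Alg_compose S T(2) ST)
  qed
  then show ?thesis
    by (simp add: compose_id)
qed

lemma A_compose_tensor_op:
  assumes S: "S \<in> Alg L" and T: "T \<in> clin_ops" "\<And>T'. T' \<in> B \<Longrightarrow> T' o\<^sub>L T \<in> B" and a: "a \<in> A"
  shows "a o\<^sub>L tensor_op S T \<in> A"
proof -
  have Sc: "S \<in> clin_ops"
    using S Alg_clin_ops by blast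
  have "id_blinfun o\<^sub>L (a o\<^sub>L tensor_op S T) \<in> A"
  proof (rule A_compose_closed[OF clin_ops_intros(1) csubspace_A closed_A _ a])
    fix S' T' assume ST: "S' \<in> Alg L" "T' \<in> B"
    then have "S' \<in> clin_ops" "T' \<in> clin_ops"
      using Alg_clin_ops B_clin_ops by auto
    then have "id_blinfun o\<^sub>L (tensor_op S' T' o\<^sub>L tensor_op S T) = tensor_op (S' o\<^sub>L S) (T' o\<^sub>L T)"
      by (simp add: compose_id tensor_op_compose Sc T(1))
    then show "id_blinfun o\<^sub>L (tensor_op S' T' o\<^sub>L tensor_op S T) \<in> A"
      by (simp add: tensor_op_A Alg_compose S T(2) ST)
  qed
  then show ?thesis
    by (simp add: compose_id)
qed

lemma A_left: "S \<in> Alg L \<Longrightarrow> a \<in> A \<Longrightarrow> tensor_op S id_blinfun o\<^sub>L a \<in> A"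
  by (rule tensor_op_compose_A) (auto simp: compose_id)

lemma A_right: "S \<in> Alg L \<Longrightarrow> a \<in> A \<Longrightarrow> a o\<^sub>L tensor_op S id_blinfun \<in> A"
  by (rule A_compose_tensor_op) (auto simp: compose_id)

lemma A_compose:
  assumes a: "a \<in> A" and b: "b \<in> A"
  shows "a o\<^sub>L b \<in> A"
proof -
  have "id_blinfun o\<^sub>L (a o\<^sub>L b) \<in> A"
  proof (rule A_compose_closed[OF clin_ops_intros(1) csubspace_A closed_A _ a])
    fix S T assume "S \<in> Alg L" "T \<in> B"
    then show "id_blinfun o\<^sub>L (tensor_op S T o\<^sub>L b) \<in> A"
      unfolding compose_id using B_clin_ops by (intro tensor_op_compose_A b B_compose) auto
  qed
  then show ?thesis
    by (simp add: compose_id)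
qed

text \<open>With \<open>R = id_blinfun - P\<close> and \<open>P\<close> in \<open>L\<close>, the
  defining condition of \<open>Alg L\<close> passes to all of \<open>A\<close>.\<close>

lemma A_corner_zero:
  assumes PR: "P \<in> clin_ops" "R \<in> clin_ops" and zero: "\<And>S. S \<in> Alg L \<Longrightarrow> R o\<^sub>L (S o\<^sub>L P) = 0"
    and a: "a \<in> A"
  shows "tensor_op R id_blinfun o\<^sub>L (a o\<^sub>L tensor_op P id_blinfun) = 0"
proof -
  have "tensor_op R id_blinfun o\<^sub>L (a o\<^sub>L tensor_op P id_blinfun) \<in> {0}"
  proof (rule A_compose_closed[OF _ _ _ _ a])
    fix S T assume ST: "S \<in> Alg L" "T \<in> B"
    then have ST': "S \<in> clin_ops" "T \<in> clin_ops"
      using Alg_clin_ops B_clin_ops by auto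
    have "tensor_op R id_blinfun o\<^sub>L (tensor_op S T o\<^sub>L tensor_op P id_blinfun)
        = tensor_op (R o\<^sub>L (S o\<^sub>L P)) (id_blinfun o\<^sub>L (T o\<^sub>L id_blinfun))"
      by (simp add: tensor_op_compose ST' PR clin_ops_intros)
    also have "\<dots> = 0"
      using ST' by (simp add: zero[OF ST(1)] tensor_op_zero_left compose_id)
    finally show "tensor_op R id_blinfun o\<^sub>L (tensor_op S T o\<^sub>L tensor_op P id_blinfun) \<in> {0}"
      by simp
  qed (auto simp: tensor_op_clin_ops PR clin_ops_intros csubspace_def intro: blinfun_eqI)
  then show ?thesis by simp
qed

text \<open>The slices of a self-adjoint \<open>a\<close> commute with \<open>L\<close>, hence with \<open>L''\<close>.\<close>
lemma selfadjoint_A_commute: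
  assumes a: "a \<in> A" "adj a = a" and P: "P \<in> \<P>"
  shows "tensor_op P id_blinfun o\<^sub>L a = a o\<^sub>L tensor_op P id_blinfun"
proof -
  have ac: "a \<in> clin_ops"
    using a(1) A_clin_ops by blast
  have T1: "tensor_op R (id_blinfun :: 'k \<Rightarrow>\<^sub>L 'k) \<in> clin_ops" if "R \<in> clin_ops" for R :: "'h \<Rightarrow>\<^sub>L 'h"
    using that by (intro tensor_op_clin_ops clin_ops_intros)
  \<comment> \<open>The range of \<open>Q \<otimes> 1\<close> is invariant under all of
    \<open>A\<close>; a self-adjoint element is therefore reduced by it.\<close>
  have Lcomm: "tensor_op Q id_blinfun o\<^sub>L a = a o\<^sub>L tensor_op Q id_blinfun" if Q: "Q \<in> L" for Q
  proof (rule proj_commute_invariant)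
    have Qc: "Q \<in> clin_ops"
      using Q L_clin_ops by blast
    show "is_projection (tensor_op Q id_blinfun :: ('h, 'k) hilbert_tensor \<Rightarrow>\<^sub>L _)"
      by (intro is_projection_tensor_op L_proj Q is_projection_id)
    have "tensor_op (id_blinfun - Q) id_blinfun o\<^sub>L (a o\<^sub>L tensor_op Q id_blinfun) = 0"
      by (rule A_corner_zero[OF _ _ _ a(1)])
         (use Q Qc in \<open>auto simp: Alg_def clin_ops_intros blinfun_compose_assoc\<close>)
    then have "(tensor_op (id_blinfun - Q) id_blinfun o\<^sub>L (a o\<^sub>L tensor_op Q id_blinfun)) x = 0" for x
      by simp
    then show "tensor_op Q id_blinfun (a (tensor_op Q id_blinfun x)) = a (tensor_op Q id_blinfun x)" for x
      by (simp add: tensor_op_diff_left Qc clin_ops_intros tensor_op_id blinfun.diff_left)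
  qed (rule ac a(2))+
  have slice: "cinner (P y \<otimes>\<^sub>h u) (a (x \<otimes>\<^sub>h v)) = cinner (y \<otimes>\<^sub>h u) (a (P x \<otimes>\<^sub>h v))" for x y u v
  proof -
    define U :: "'k \<Rightarrow> 'h \<Rightarrow>\<^sub>L ('h, 'k) hilbert_tensor" where "U u = Blinfun (\<lambda>x. x \<otimes>\<^sub>h u)" for u
    have U: "U u \<in> clin_ops" "U u x = x \<otimes>\<^sub>h u" for u x
      unfolding U_def
      by (rule clin_ops_Blinfun[of _ "norm u"]; simp add: tensor_add_left tensor_scaleC_left norm_tensor)+
    \<comment> \<open>The matrix coefficient of \<open>a\<close> at \<open>u\<close> and
      \<open>v\<close> in the second factor; it lies in \<open>L'\<close>, whereas \<open>P\<close>
      lies in \<open>L''\<close>.\<close>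
    define s where "s = adj (U u) o\<^sub>L (a o\<^sub>L U v)"
    have sc: "s \<in> clin_ops"
      unfolding s_def by (intro clin_ops_intros adj_clin_ops U ac)
    have s: "cinner y (s x) = cinner (y \<otimes>\<^sub>h u) (a (x \<otimes>\<^sub>h v))" for x y
      by (simp add: s_def cinner_adj_right[OF U(1)] U(2))
    have "s o\<^sub>L Q = Q o\<^sub>L s" if Q: "Q \<in> L" for Q
    proof (rule blinfun_eqI, rule cinner_ext)
      fix x z
      have Qc: "Q \<in> clin_ops"
        using Q L_clin_ops by blast
      have "cinner z (s (Q x)) = cinner (z \<otimes>\<^sub>h u) ((a o\<^sub>L tensor_op Q id_blinfun) (x \<otimes>\<^sub>h v))"
        by (simp add: s tensor_op_apply Qc clin_ops_intros)
      also have "\<dots> = cinner (tensor_op Q id_blinfun (z \<otimes>\<^sub>h u)) (a (x \<otimes>\<^sub>h v))"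
        unfolding Lcomm[OF Q, symmetric]
        by (simp add: proj_cinner[OF is_projection_tensor_op[OF L_proj[OF Q] is_projection_id]])
      also have "\<dots> = cinner z (Q (s x))"
        by (simp add: tensor_op_apply Qc clin_ops_intros s[symmetric] proj_cinner[OF L_proj[OF Q]])
      finally show "cinner z ((s o\<^sub>L Q) x) = cinner z ((Q o\<^sub>L s) x)"
        by simp
    qed
    then have "s \<in> commutant L"
      using sc by (simp add: commutant_def)
    moreover have "P \<in> commutant (commutant L)"
      using commuting_projections_double_commutant[OF L_clin_ops mf] P by blast
    ultimately have "P o\<^sub>L s = s o\<^sub>L P"
      by (simp add: commutant_def[of "commutant L"])
    then have "cinner y (P (s x)) = cinner y (s (P x))"
      by (metis blinfun_apply_blinfun_compose)
    then show ?thesis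
      by (simp add: s[symmetric] proj_cinner[OF commuting_proj[OF P]])
  qed
  have Pc: "P \<in> clin_ops"
    by (rule commuting_clin_ops[OF P])
  note PT = is_projection_tensor_op[OF commuting_proj[OF P] is_projection_id]
  show ?thesis
  proof (rule clin_ops_tensor_eqI)
    show "tensor_op P id_blinfun o\<^sub>L a \<in> clin_ops" "a o\<^sub>L tensor_op P id_blinfun \<in> clin_ops"
      by (intro clin_ops_intros T1 Pc ac)+
    fix x v
    show "(tensor_op P id_blinfun o\<^sub>L a) (x \<otimes>\<^sub>h v) = (a o\<^sub>L tensor_op P id_blinfun) (x \<otimes>\<^sub>h v)"
    proof (rule tensor_ext)
      fix y u
      have "cinner (y \<otimes>\<^sub>h u) (tensor_op P id_blinfun (a (x \<otimes>\<^sub>h v))) = cinner (P y \<otimes>\<^sub>h u) (a (x \<otimes>\<^sub>h v))"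
        by (simp add: proj_cinner[OF PT, symmetric] tensor_op_apply Pc clin_ops_intros)
      then show "cinner (y \<otimes>\<^sub>h u) ((tensor_op P id_blinfun o\<^sub>L a) (x \<otimes>\<^sub>h v))
          = cinner (y \<otimes>\<^sub>h u) ((a o\<^sub>L tensor_op P id_blinfun) (x \<otimes>\<^sub>h v))"
        by (simp add: slice tensor_op_apply Pc clin_ops_intros)
    qed
  qed
qed

text \<open>Uniqueness of \<open>\<theta>(P)\<close> rests on this. The test element is
  \<open>1 \<otimes> rank_one e e\<close>, which is in \<open>A\<close> whether or not
  \<open>1 \<otimes> 1\<close> is.\<close>

lemma tensor_left_cancel:
  fixes e :: 'k
  assumes F: "F \<in> clin_ops" "F' \<in> clin_ops" and e: "norm e = 1"
    and eq: "\<And>b. b \<in> A \<Longrightarrow> tensor_op F id_blinfun o\<^sub>L b = tensor_op F' id_blinfun o\<^sub>L b"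
  shows "F = F'"
proof (rule blinfun_eqI, rule tensor_cancel[OF _ e])
  fix x
  have id: "id_blinfun \<in> \<P>"
    by (rule boolean_id[OF maximal_boolean_commuting])
  have "tensor_op id_blinfun (rank_one e e) \<in> A"
    by (intro tensor_op_A commuting_Alg id rank_one_B)
  from blinfun_compose_apply_eq[OF eq[OF this], of "x \<otimes>\<^sub>h e"]
  show "F x \<otimes>\<^sub>h e = F' x \<otimes>\<^sub>h e"
    using e by (simp add: tensor_op_apply clin_ops_intros rank_one_clin_ops F cinner_self_norm)
qed

text \<open>The operator \<open>F\<close> is the slice of \<open>E\<close> at \<open>e\<close>.\<close>
lemma proj_eq_tensor_op:
  fixes E :: "('h, 'k) hilbert_tensor \<Rightarrow>\<^sub>L ('h, 'k) hilbert_tensor" and e :: 'k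
  assumes E: "is_projection E" and e: "norm e = 1"
    and comm: "\<And>Q v. Q \<in> \<P> \<Longrightarrow> norm v = 1 \<Longrightarrow>
      E o\<^sub>L tensor_op Q (rank_one v v) = tensor_op Q (rank_one v v) o\<^sub>L E"
  shows "\<exists>F\<in>\<P>. E = tensor_op F id_blinfun"
proof -
  define U :: "'h \<Rightarrow>\<^sub>L ('h, 'k) hilbert_tensor" where "U = Blinfun (\<lambda>x. x \<otimes>\<^sub>h e)"
  have U: "U \<in> clin_ops" "U x = x \<otimes>\<^sub>h e" for x
    unfolding U_def
    by (rule clin_ops_Blinfun[of _ "norm e"]; simp add: tensor_add_left tensor_scaleC_left norm_tensor)+
  have Ec: "E \<in> clin_ops"
    by (rule proj_clin_ops[OF E])
  have id: "id_blinfun \<in> \<P>"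
    by (rule boolean_id[OF maximal_boolean_commuting])
  define F where "F = adj U o\<^sub>L (E o\<^sub>L U)"
  have Fc: "F \<in> clin_ops"
    unfolding F_def by (intro clin_ops_intros adj_clin_ops U Ec)
  have UU: "U o\<^sub>L adj U = tensor_op id_blinfun (rank_one e e)"
  proof (rule clin_ops_tensor_eqI)
    show "U o\<^sub>L adj U \<in> clin_ops" "tensor_op (id_blinfun :: 'h \<Rightarrow>\<^sub>L 'h) (rank_one e e) \<in> clin_ops"
      by (intro clin_ops_intros adj_clin_ops U tensor_op_clin_ops rank_one_clin_ops)+
    fix y k
    have "adj U (y \<otimes>\<^sub>h k) = cinner e k *\<^sub>C y"
      by (rule cinner_ext) (simp add: cinner_adj_right[OF U(1)] U(2) cinner_tensor cinner_scaleC_right)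
    then show "(U o\<^sub>L adj U) (y \<otimes>\<^sub>h k) = tensor_op id_blinfun (rank_one e e) (y \<otimes>\<^sub>h k)"
      by (simp add: U tensor_op_apply clin_ops_intros rank_one_clin_ops tensor_scaleC_left tensor_scaleC_right)
  qed
  have Qe: "tensor_op Q (rank_one v v) (x \<otimes>\<^sub>h k) = cinner v k *\<^sub>C (Q x \<otimes>\<^sub>h v)"
    if "Q \<in> clin_ops" for Q :: "'h \<Rightarrow>\<^sub>L 'h" and v k :: 'k and x
    by (simp add: tensor_op_apply that rank_one_clin_ops tensor_scaleC_right)
  have Ee: "E (x \<otimes>\<^sub>h e) = F x \<otimes>\<^sub>h e" for x
  proof -
    have "E (x \<otimes>\<^sub>h e) = (E o\<^sub>L tensor_op id_blinfun (rank_one e e)) (x \<otimes>\<^sub>h e)"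
      using e by (simp add: Qe clin_ops_intros cinner_self_norm)
    also have "\<dots> = (U o\<^sub>L adj U) (E (x \<otimes>\<^sub>h e))"
      unfolding comm[OF id e] UU by simp
    also have "\<dots> = F x \<otimes>\<^sub>h e"
      by (simp add: F_def U(2))
    finally show ?thesis .
  qed
  \<comment> \<open>The rank one projection onto \<open>v\<close> takes
    \<open>x \<otimes>\<^sub>h e\<close> to a multiple of \<open>x \<otimes>\<^sub>h v\<close>,
    nonzero unless \<open>v\<close> is orthogonal to \<open>e\<close>; commutation with
    \<open>E\<close> thus carries the slice from \<open>e\<close> to \<open>v\<close>.\<close>
  have Ev0: "E (x \<otimes>\<^sub>h v) = F x \<otimes>\<^sub>h v" if v: "norm v = 1" "cinner v e \<noteq> 0" for x v
  proof -
    have "cinner v e *\<^sub>C E (x \<otimes>\<^sub>h v) = (E o\<^sub>L tensor_op id_blinfun (rank_one v v)) (x \<otimes>\<^sub>h e)"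
      by (simp add: Qe clin_ops_intros clin_opsD[OF Ec])
    also have "\<dots> = cinner v e *\<^sub>C (F x \<otimes>\<^sub>h v)"
      unfolding comm[OF id v(1)] by (simp add: Ee Qe clin_ops_intros)
    finally have "inverse (cinner v e) *\<^sub>C cinner v e *\<^sub>C E (x \<otimes>\<^sub>h v)
        = inverse (cinner v e) *\<^sub>C cinner v e *\<^sub>C (F x \<otimes>\<^sub>h v)"
      by simp
    then show ?thesis
      using v(2) by (simp add: scaleC_scaleC)
  qed
  have Ev: "E (x \<otimes>\<^sub>h v) = F x \<otimes>\<^sub>h v" if v: "cinner v e \<noteq> 0" for x v
  proof -
    have "v \<noteq> 0"
      using v by auto
    then have "E (x \<otimes>\<^sub>h ((1 / norm v) *\<^sub>R v)) = F x \<otimes>\<^sub>h ((1 / norm v) *\<^sub>R v)"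
      using v by (intro Ev0) (auto simp: cinner_scaleR_left)
    then have "norm v *\<^sub>R E (x \<otimes>\<^sub>h ((1 / norm v) *\<^sub>R v)) = norm v *\<^sub>R (F x \<otimes>\<^sub>h ((1 / norm v) *\<^sub>R v))"
      by simp
    then show ?thesis
      using \<open>v \<noteq> 0\<close>
      by (simp add: scaleR_scaleC tensor_scaleC_right clin_opsD[OF Ec] scaleC_scaleC)
  qed
  have "E (x \<otimes>\<^sub>h v) = F x \<otimes>\<^sub>h v" for x v
  proof (cases "cinner v e = 0")
    \<comment> \<open>A vector orthogonal to \<open>e\<close> is the difference of
      \<open>v + e\<close> and \<open>e\<close>, neither of which is orthogonal to
      \<open>e\<close>.\<close>
    case True
    have ne: "cinner (v + e) e \<noteq> 0" "cinner e e \<noteq> 0"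
      using e by (auto simp: cinner_add_left True cinner_self_norm)
    show ?thesis
      using Ev[OF ne(1), of x] Ev[OF ne(2), of x] by (simp add: tensor_add_right blinfun.add_right)
  qed (rule Ev)
  then have "E = tensor_op F id_blinfun"
    by (intro clin_ops_tensor_eqI Ec tensor_op_clin_ops Fc clin_ops_intros)
       (simp add: tensor_op_apply Fc clin_ops_intros)
  moreover have "is_projection F"
  proof (rule is_projectionI[OF Fc])
    show "F (F x) = F x" for x
      by (rule tensor_cancel[OF _ e]) (simp add: Ee[symmetric] proj_idem[OF E])
    show "cinner (F x) y = cinner x (F y)" for x y
      by (simp add: F_def cinner_adj_left[OF U(1)] cinner_adj_right[OF U(1)] proj_cinner[OF E])
  qed
  moreover have "F o\<^sub>L Q = Q o\<^sub>L F" if Q: "Q \<in> L" for Q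
  proof (rule blinfun_eqI, rule tensor_cancel[OF _ e])
    fix x
    have Qc: "Q \<in> clin_ops"
      using Q L_clin_ops by blast
    have "E (tensor_op Q (rank_one e e) (x \<otimes>\<^sub>h e)) = tensor_op Q (rank_one e e) (E (x \<otimes>\<^sub>h e))"
      using Q L_commuting by (intro blinfun_compose_apply_eq comm e) blast
    then show "(F o\<^sub>L Q) x \<otimes>\<^sub>h e = (Q o\<^sub>L F) x \<otimes>\<^sub>h e"
      using e by (simp add: Qe Qc Ee cinner_self_norm)
  qed
  ultimately show ?thesis
    using Fc by (intro bexI[of _ F]) (auto simp: commuting_projections_def commutant_def)
qed

end

subsection \<open>An isometric isomorphism carries \<open>P \<otimes> 1\<close> to some \<open>F \<otimes> 1\<close>\<close>

locale stable_iso =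
  s1: stable_algebra L1 B1 + s2: stable_algebra L2 B2
  for L1 :: "('h1::chilbert_space \<Rightarrow>\<^sub>L 'h1) set" and L2 :: "('h2::chilbert_space \<Rightarrow>\<^sub>L 'h2) set"
    and B1 B2 :: "('k::chilbert_space \<Rightarrow>\<^sub>L 'k) set" +
  fixes \<phi> :: "(('h1, 'k) hilbert_tensor \<Rightarrow>\<^sub>L ('h1, 'k) hilbert_tensor) \<Rightarrow>
      (('h2, 'k) hilbert_tensor \<Rightarrow>\<^sub>L ('h2, 'k) hilbert_tensor)"
    and e :: 'k
  assumes onto: "\<phi> ` s1.A = s2.A"
    and add: "\<And>S T. S \<in> s1.A \<Longrightarrow> T \<in> s1.A \<Longrightarrow> \<phi> (S + T) = \<phi> S + \<phi> T"
    and scale: "\<And>c S. S \<in> s1.A \<Longrightarrow> \<phi> (c *\<^sub>C S) = c *\<^sub>C \<phi> S"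
    and mult: "\<And>S T. S \<in> s1.A \<Longrightarrow> T \<in> s1.A \<Longrightarrow> \<phi> (S o\<^sub>L T) = \<phi> S o\<^sub>L \<phi> T"
    and isom: "\<And>S. S \<in> s1.A \<Longrightarrow> norm (\<phi> S) = norm S"
    and e: "norm e = 1"
begin

abbreviation amp :: "('h \<Rightarrow>\<^sub>L 'h) \<Rightarrow> (('h::chilbert_space, 'k) hilbert_tensor \<Rightarrow>\<^sub>L ('h, 'k) hilbert_tensor)"
  where "amp P \<equiv> tensor_op P id_blinfun"

section \<open>Transport of projections by \<open>\<phi>\<close>\<close>

lemma phi_mem: "a \<in> s1.A \<Longrightarrow> \<phi> a \<in> s2.A"
  using onto by blast

lemma A1_diff: "a \<in> s1.A \<Longrightarrow> b \<in> s1.A \<Longrightarrow> a - b \<in> s1.A"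
  and phi_diff: "a \<in> s1.A \<Longrightarrow> b \<in> s1.A \<Longrightarrow> \<phi> (a - b) = \<phi> a - \<phi> b"
proof -
  assume a: "a \<in> s1.A" and b: "b \<in> s1.A"
  have m: "(- 1) *\<^sub>C S = - S" for S :: "'c::real_normed_vector \<Rightarrow>\<^sub>L 'd::complex_inner"
    by (rule blinfun_eqI) (simp add: scaleC_minus_one blinfun.minus_left)
  have mb: "- b \<in> s1.A"
    using csubspaceD(3)[OF s1.csubspace_A b, of "-1"] by (simp add: m)
  then show "a - b \<in> s1.A"
    using csubspaceD(2)[OF s1.csubspace_A a, of "- b"] by simp
  have "\<phi> (- b) = - \<phi> b"
    using scale[OF b, of "-1"] by (simp add: m)
  then show "\<phi> (a - b) = \<phi> a - \<phi> b"
    using add[OF a mb] by simp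
qed

lemma phi_zero: "\<phi> 0 = 0"
  using isom[OF csubspaceD(1)[OF s1.csubspace_A]] by simp

lemma phi_onto: "b \<in> s2.A \<Longrightarrow> \<exists>a\<in>s1.A. \<phi> a = b"
  unfolding onto[symmetric] by (simp add: image_iff) metis

lemma phi_inj: "a \<in> s1.A \<Longrightarrow> b \<in> s1.A \<Longrightarrow> \<phi> a = \<phi> b \<Longrightarrow> a = b"
  using isom[OF A1_diff, of a b] phi_diff[of a b] by simp

lemma phi_projection:
  assumes a: "a \<in> s1.A" "is_projection a"
  shows "is_projection (\<phi> a)"
proof (rule contractive_idempotent_is_projection)
  show "\<phi> a \<in> clin_ops"
    using phi_mem[OF a(1)] s2.A_clin_ops by blast
  show "\<phi> a o\<^sub>L \<phi> a = \<phi> a"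
    using mult[OF a(1) a(1)] a(2) by (simp add: is_projection_def)
  show "norm (\<phi> a) \<le> 1"
    using isom[OF a(1)] norm_proj_le_1[OF a(2)] by simp
qed

lemma projection_pullback:
  assumes b: "b \<in> s2.A" "is_projection b"
  shows "\<exists>a\<in>s1.A. is_projection a \<and> \<phi> a = b"
proof -
  obtain a where a: "a \<in> s1.A" "\<phi> a = b"
    using phi_onto[OF b(1)] by (elim bexE) (rule that)
  have "is_projection a"
  proof (rule contractive_idempotent_is_projection)
    show "a \<in> clin_ops"
      using a(1) s1.A_clin_ops by blast
    have "\<phi> (a o\<^sub>L a) = \<phi> a"
      using mult[OF a(1) a(1)] a(2) b(2) by (simp add: is_projection_def)
    then show "a o\<^sub>L a = a"
      by (intro phi_inj s1.A_compose a)
    show "norm a \<le> 1"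
      using isom[OF a(1)] norm_proj_le_1[OF b(2)] a(2) by simp
  qed
  with a show ?thesis
    by (intro bexI[of _ a] conjI)
qed

lemma rank_A1: "P \<in> s1.\<P> \<Longrightarrow> tensor_op P (rank_one w v) \<in> s1.A"
  by (intro s1.tensor_op_A s1.commuting_Alg s1.rank_one_B)

lemma rank_A2: "P \<in> s2.\<P> \<Longrightarrow> tensor_op P (rank_one w v) \<in> s2.A"
  by (intro s2.tensor_op_A s2.commuting_Alg s2.rank_one_B)

lemma id1: "id_blinfun \<in> s1.\<P>"
  by (rule boolean_id[OF s1.maximal_boolean_commuting])

lemma amp_A1: "P \<in> s1.\<P> \<Longrightarrow> a \<in> s1.A \<Longrightarrow> amp P o\<^sub>L a \<in> s1.A"
  and A1_amp: "P \<in> s1.\<P> \<Longrightarrow> a \<in> s1.A \<Longrightarrow> a o\<^sub>L amp P \<in> s1.A"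
  by (simp_all add: s1.A_left s1.A_right s1.commuting_Alg)

lemma amp_rank:
  fixes P Q :: "'h \<Rightarrow>\<^sub>L 'h::chilbert_space"
  assumes "P \<in> clin_ops" "Q \<in> clin_ops"
  shows "amp P o\<^sub>L tensor_op Q (rank_one w v) = tensor_op (P o\<^sub>L Q) (rank_one w v)"
    and "tensor_op Q (rank_one w v) o\<^sub>L amp P = tensor_op (Q o\<^sub>L P) (rank_one w v)"
  using assms by (simp_all add: tensor_op_compose clin_ops_intros rank_one_clin_ops compose_id)

text \<open>Its closed span becomes the range of \<open>\<theta>(P) \<otimes> 1\<close>. With the
  right vector fixed at \<open>e\<close>, this span is invariant under \<open>\<phi> a\<close> for
  every \<open>a\<close> in the first algebra that commutes with
  \<open>P \<otimes> 1\<close>.\<close>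

definition corner :: "('h1 \<Rightarrow>\<^sub>L 'h1) \<Rightarrow> ('h2, 'k) hilbert_tensor set"
  where "corner P = {\<phi> (tensor_op P (rank_one w e)) \<eta> | w \<eta>. True}"

lemma cornerI: "\<phi> (tensor_op P (rank_one w e)) \<eta> \<in> corner P"
  by (auto simp: corner_def)

text \<open>For \<open>c = S \<otimes> T\<close> the argument of \<open>\<phi>\<close> factors as
  \<open>P \<otimes> rank_one (T w) e\<close> times \<open>S \<otimes> rank_one e e\<close>, and the
  image of the left factor has its range in the corner. The set \<open>X\<close> of good elements is
  closed because \<open>\<phi>\<close> is isometric, so general \<open>c\<close> follow.\<close>

lemma phi_corner_mem:
  assumes P: "P \<in> s1.\<P>" and c: "c \<in> s1.A"
  shows "\<phi> (amp P o\<^sub>L (c o\<^sub>L tensor_op id_blinfun (rank_one w e))) \<eta> \<in> cspan_closure (corner P)"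
proof -
  let ?K = "\<lambda>c. amp P o\<^sub>L (c o\<^sub>L tensor_op id_blinfun (rank_one w e))"
  define X where "X = {a \<in> s1.A. \<phi> a \<eta> \<in> cspan_closure (corner P)}"
  have Pc: "P \<in> clin_ops"
    by (rule s1.commuting_clin_ops[OF P])
  have Xs: "csubspace X"
    unfolding csubspace_def X_def
    using csubspaceD[OF s1.csubspace_A] csubspaceD[OF csubspace_cspan_closure[of "corner P"]]
    by (auto simp: phi_zero add scale blinfun.add_left)
  have Xc: "closed X"
    unfolding closed_sequential_limits
  proof (intro allI impI, elim conjE)
    fix f l assume f: "\<forall>n. f n \<in> X" and l: "f \<longlonglongrightarrow> l"
    have fA: "f n \<in> s1.A" for n
      using f by (simp add: X_def)
    have lA: "l \<in> s1.A"
      using closed_sequentially[OF s1.closed_A _ l] fA by blast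
    have "(\<lambda>n. norm (\<phi> (f n) - \<phi> l)) \<longlonglongrightarrow> 0"
      using l unfolding phi_diff[OF fA lA, symmetric] isom[OF A1_diff[OF fA lA]]
      by (simp add: tendsto_norm_zero_iff LIM_zero_iff)
    then have "(\<lambda>n. \<phi> (f n)) \<longlonglongrightarrow> \<phi> l"
      by (simp add: tendsto_norm_zero_iff LIM_zero_iff)
    then have "(\<lambda>n. \<phi> (f n) \<eta>) \<longlonglongrightarrow> \<phi> l \<eta>"
      by (intro blinfun.tendsto tendsto_const)
    from closed_sequentially[OF closed_cspan_closure _ this]
    have "\<phi> l \<eta> \<in> cspan_closure (corner P)"
      using f by (simp add: X_def)
    with lA show "l \<in> X"
      by (simp add: X_def)
  qed
  have gen: "?K (tensor_op S T) \<in> X" if ST: "S \<in> Alg L1" "T \<in> B1" for S T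
  proof -
    have STc: "S \<in> clin_ops" "T \<in> clin_ops"
      using ST s1.Alg_clin_ops s1.B_clin_ops by auto
    have K: "?K (tensor_op S T) = tensor_op P (rank_one (T w) e) o\<^sub>L tensor_op S (rank_one e e)"
      using STc Pc
      by (simp add: tensor_op_compose clin_ops_intros rank_one_clin_ops compose_id compose_rank_one
          cinner_self_norm e)
    note A = rank_A1[OF P, of "T w" e] s1.tensor_op_A[OF ST(1) s1.rank_one_B, of e e]
    have "\<phi> (?K (tensor_op S T)) \<eta> = \<phi> (tensor_op P (rank_one (T w) e)) (\<phi> (tensor_op S (rank_one e e)) \<eta>)"
      unfolding K mult[OF A] by simp
    then have "\<phi> (?K (tensor_op S T)) \<eta> \<in> corner P"
      by (simp add: cornerI)
    moreover have "?K (tensor_op S T) \<in> s1.A"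
      unfolding K by (rule s1.A_compose[OF A])
    ultimately show ?thesis
      by (simp add: X_def cspan_closureI)
  qed
  have "?K c \<in> X"
    by (rule s1.A_compose_closed[OF tensor_op_clin_ops[OF Pc clin_ops_intros(1)] Xs Xc gen c])
  then show ?thesis
    by (simp add: X_def)
qed

text \<open>The projection \<open>Q \<otimes> rank_one v v\<close> is \<open>\<phi> a\<close> for a
  projection \<open>a\<close>, which commutes with \<open>P \<otimes> 1\<close>. So \<open>a\<close>
  times \<open>P \<otimes> rank_one w e\<close> has the form treated in
  \<open>phi_corner_mem\<close>, and the corner is reduced.\<close>

lemma corner_proj_commute:
  assumes P: "P \<in> s1.\<P>" and Q: "Q \<in> s2.\<P>" and v: "norm v = 1"
  shows "proj_cspan (corner P) o\<^sub>L tensor_op Q (rank_one v v) = tensor_op Q (rank_one v v) o\<^sub>L proj_cspan (corner P)"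
proof -
  let ?b = "tensor_op Q (rank_one v v)"
  have b: "is_projection ?b"
    by (intro is_projection_tensor_op s2.commuting_proj Q is_projection_rank_one v)
  obtain a where a: "a \<in> s1.A" "is_projection a" "\<phi> a = ?b"
    using projection_pullback[OF rank_A2[OF Q] b] by (elim bexE conjE) (rule that)
  have Pc: "P \<in> clin_ops"
    by (rule s1.commuting_clin_ops[OF P])
  show ?thesis
  proof (rule proj_cspan_commute[OF proj_clin_ops[OF b] proj_adj[OF b]])
    fix g assume "g \<in> corner P"
    then obtain w \<eta> where g: "g = \<phi> (tensor_op P (rank_one w e)) \<eta>"
      by (auto simp: corner_def)
    have "?b g = \<phi> (a o\<^sub>L tensor_op P (rank_one w e)) \<eta>"
      by (simp add: g mult[OF a(1) rank_A1[OF P]] a(3))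
    also have "a o\<^sub>L tensor_op P (rank_one w e) = (a o\<^sub>L amp P) o\<^sub>L tensor_op id_blinfun (rank_one w e)"
      by (simp add: blinfun_compose_assoc amp_rank Pc clin_ops_intros compose_id)
    also have "\<dots> = amp P o\<^sub>L (a o\<^sub>L tensor_op id_blinfun (rank_one w e))"
      by (simp add: s1.selfadjoint_A_commute[OF a(1) proj_adj[OF a(2)] P, symmetric] blinfun_compose_assoc)
    finally show "?b g \<in> cspan_closure (corner P)"
      by (simp add: phi_corner_mem[OF P a(1)])
  qed
qed

lemma corner_proj: "P \<in> s1.\<P> \<Longrightarrow> \<exists>F\<in>s2.\<P>. proj_cspan (corner P) = amp F"
  by (rule s2.proj_eq_tensor_op[OF is_projection_cspan e corner_proj_commute])

text \<open>The span is the range of some \<open>F \<otimes> 1\<close>. For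
  \<open>f = 1 - F\<close>, the preimage \<open>a\<close> of \<open>f \<otimes> rank_one e e\<close>
  annihilates every \<open>1 \<otimes> rank_one w e\<close> by left multiplication, and these reach
  all elementary tensors; so \<open>a = 0\<close> and \<open>f = 0\<close>.\<close>

lemma corner_id: "proj_cspan (corner id_blinfun) = id_blinfun"
proof -
  obtain F where F: "F \<in> s2.\<P>" "proj_cspan (corner id_blinfun) = amp F"
    using corner_proj[OF id1] by (elim bexE) (rule that)
  define f where "f = id_blinfun - F"
  have f: "f \<in> s2.\<P>"
    unfolding f_def by (rule boolean_compl[OF s2.maximal_boolean_commuting F(1)])
  have fc: "f \<in> clin_ops" and Fc: "F \<in> clin_ops"
    using f F(1) s2.commuting_clin_ops by auto
  have fF: "f o\<^sub>L F = 0"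
    using proj_idem[OF s2.commuting_proj[OF F(1)]] by (intro blinfun_eqI) (simp add: f_def blinfun.diff_left)
  let ?b = "tensor_op f (rank_one e e)"
  obtain a where a: "a \<in> s1.A" "\<phi> a = ?b"
    using phi_onto[OF rank_A2[OF f, of e e]] by (elim bexE) (rule that)
  have "a o\<^sub>L tensor_op id_blinfun (rank_one w e) = 0" for w
  proof (rule phi_inj[OF s1.A_compose[OF a(1) rank_A1[OF id1]] csubspaceD(1)[OF s1.csubspace_A]], rule blinfun_eqI)
    fix \<eta>
    let ?g = "\<phi> (tensor_op id_blinfun (rank_one w e)) \<eta>"
    have "amp F ?g = ?g"
      unfolding F(2)[symmetric] by (intro proj_cspan_fix cspan_closureI cornerI)
    then have "?b ?g = (?b o\<^sub>L amp F) ?g"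
      by simp
    also have "\<dots> = 0"
      by (simp add: amp_rank fc Fc fF tensor_op_zero_left rank_one_clin_ops)
    finally show "\<phi> (a o\<^sub>L tensor_op id_blinfun (rank_one w e)) \<eta> = \<phi> 0 \<eta>"
      by (simp add: mult[OF a(1) rank_A1[OF id1]] a(2) phi_zero)
  qed
  then have "(a o\<^sub>L tensor_op id_blinfun (rank_one w e)) (x \<otimes>\<^sub>h e) = 0" for w x
    by simp
  then have "a (x \<otimes>\<^sub>h w) = 0" for x w
    by (simp add: tensor_op_apply clin_ops_intros rank_one_clin_ops cinner_self_norm e)
  then have "a = 0"
    using a(1) s1.A_clin_ops by (intro clin_ops_tensor_eqI) (auto simp: clin_ops_intros)
  then have b0: "?b = 0"
    using a(2) phi_zero by simp
  have "f = 0"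
  proof (rule blinfun_eqI, rule tensor_cancel[OF _ e])
    fix x
    have "?b (x \<otimes>\<^sub>h e) = 0"
      by (simp add: b0)
    then show "f x \<otimes>\<^sub>h e = blinfun_apply 0 x \<otimes>\<^sub>h e"
      by (simp add: tensor_op_apply fc rank_one_clin_ops cinner_self_norm e)
  qed
  then have "F = id_blinfun"
    by (simp add: f_def)
  then show ?thesis
    unfolding F(2) by (simp only: tensor_op_id)
qed

lemma cornerE:
  assumes "g \<in> corner P"
  obtains w \<eta> where "g = \<phi> (tensor_op P (rank_one w e)) \<eta>"
  using assms unfolding corner_def by blast

lemma corner_total:
  assumes "\<And>w \<eta>. cinner (\<phi> (tensor_op id_blinfun (rank_one w e)) \<eta>) \<zeta> = 0"
  shows "\<zeta> = 0"
proof -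
  have "proj_cspan (corner id_blinfun) \<zeta> = 0"
  proof (rule proj_cspan_orthogonal)
    fix g assume "g \<in> corner id_blinfun"
    then show "cinner g \<zeta> = 0"
      by (rule cornerE) (simp only: assms)
  qed
  then show ?thesis
    by (simp add: corner_id)
qed

lemma corner_eqI:
  assumes "S \<in> clin_ops" "T \<in> clin_ops"
    and eq: "\<And>w. S o\<^sub>L \<phi> (tensor_op id_blinfun (rank_one w e)) = T o\<^sub>L \<phi> (tensor_op id_blinfun (rank_one w e))"
  shows "S = T"
proof (rule blinfun_eqI, rule clin_ops_eq_on_cspan_closure[OF assms(1,2)])
  fix g assume "g \<in> corner id_blinfun"
  then show "S g = T g"
    by (rule cornerE) (simp only: blinfun_compose_apply_eq[OF eq])
next
  show "x \<in> cspan_closure (corner id_blinfun)" for x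
    using iffD2[OF cspan_closure_eq_UNIV_iff corner_id] by simp
qed

text \<open>After inserting rank one projections on the left, both vectors lie in ranges of images
  of projections whose product is zero; the images are again projections, so their ranges are
  orthogonal.\<close>

lemma phi_rank_orthogonal:
  assumes P: "P \<in> s1.\<P>" and Q: "Q \<in> s1.\<P>" and PQ: "P o\<^sub>L Q = 0"
  shows "cinner (\<phi> (tensor_op P (rank_one w e)) \<eta>) (\<phi> (tensor_op Q (rank_one u e)) \<zeta>) = 0"
proof (cases "w = 0 \<or> u = 0")
  case True
  have "rank_one 0 e = 0"
    by (rule blinfun_eqI) simp
  moreover have "tensor_op R (0 :: 'k \<Rightarrow>\<^sub>L 'k) = 0" if "R \<in> clin_ops" for R :: "'h1 \<Rightarrow>\<^sub>L 'h1"
    using that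
    by (intro clin_ops_tensor_eqI)
       (auto simp: tensor_op_clin_ops[OF _ clin_ops_intros(2)] tensor_op_apply[OF _ clin_ops_intros(2)] clin_ops_intros)
  ultimately show ?thesis
    using True P Q by (auto simp: s1.commuting_clin_ops phi_zero)
next
  case False
  then obtain w' u' where w': "norm w' = 1" "rank_one w' w' o\<^sub>L rank_one w e = rank_one w e"
    and u': "norm u' = 1" "rank_one u' u' o\<^sub>L rank_one u e = rank_one u e"
    using rank_one_split[of w e] rank_one_split[of u e] by blast
  have Pc: "P \<in> clin_ops" "Q \<in> clin_ops"
    using P Q by (simp_all add: s1.commuting_clin_ops)
  have split: "\<phi> (tensor_op R (rank_one v e)) = \<phi> (tensor_op R (rank_one v' v')) o\<^sub>L \<phi> (tensor_op R (rank_one v e))"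
    if R: "R \<in> s1.\<P>" and v: "rank_one v' v' o\<^sub>L rank_one v e = rank_one v e" for R v v'
  proof -
    have "tensor_op R (rank_one v e) = tensor_op R (rank_one v' v') o\<^sub>L tensor_op R (rank_one v e)"
      using R s1.commuting_proj[OF R]
      by (simp add: tensor_op_compose s1.commuting_clin_ops rank_one_clin_ops v is_projection_def)
    then show ?thesis
      using mult[OF rank_A1[OF R] rank_A1[OF R]] by metis
  qed
  have proj: "is_projection (\<phi> (tensor_op P (rank_one w' w')))"
    by (intro phi_projection rank_A1 P is_projection_tensor_op s1.commuting_proj is_projection_rank_one w'(1))
  have "\<phi> (tensor_op P (rank_one w' w')) o\<^sub>L \<phi> (tensor_op Q (rank_one u' u')) = 0"
    unfolding mult[OF rank_A1[OF P] rank_A1[OF Q], symmetric]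
    by (simp add: tensor_op_compose Pc rank_one_clin_ops PQ tensor_op_zero_left clin_ops_intros phi_zero)
  then have zero: "\<phi> (tensor_op P (rank_one w' w')) (\<phi> (tensor_op Q (rank_one u' u')) v) = 0" for v
    by (metis blinfun_apply_blinfun_compose zero_blinfun.rep_eq)
  have "cinner (\<phi> (tensor_op P (rank_one w e)) \<eta>) (\<phi> (tensor_op Q (rank_one u e)) \<zeta>)
      = cinner (\<phi> (tensor_op P (rank_one w' w')) (\<phi> (tensor_op P (rank_one w e)) \<eta>))
          (\<phi> (tensor_op Q (rank_one u' u')) (\<phi> (tensor_op Q (rank_one u e)) \<zeta>))"
    using split[OF P w'(2)] split[OF Q u'(2)] by (metis blinfun_apply_blinfun_compose)
  also have "\<dots> = 0"
    by (simp add: proj_cinner[OF proj] zero)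
  finally show ?thesis .
qed

text \<open>Split \<open>1 = P + P'\<close>: the part of \<open>P\<close> lies in the corner of
  \<open>P\<close>, and the part of \<open>P'\<close> is orthogonal to it.\<close>

lemma amp_corner:
  assumes P: "P \<in> s1.\<P>" and F: "proj_cspan (corner P) = amp F"
  shows "amp F o\<^sub>L \<phi> (tensor_op id_blinfun (rank_one w e)) = \<phi> (tensor_op P (rank_one w e))"
proof (rule blinfun_eqI)
  fix \<eta>
  define P' where "P' = id_blinfun - P"
  have P': "P' \<in> s1.\<P>"
    unfolding P'_def by (rule boolean_compl[OF s1.maximal_boolean_commuting P])
  have Pc: "P \<in> clin_ops"
    by (rule s1.commuting_clin_ops[OF P])
  have PP': "P o\<^sub>L P' = 0"
    using proj_idem[OF s1.commuting_proj[OF P]]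
    by (intro blinfun_eqI) (simp add: P'_def blinfun.diff_left blinfun.diff_right)
  let ?t = "\<lambda>R. tensor_op R (rank_one w e)"
  have "?t P' = ?t id_blinfun - ?t P"
    unfolding P'_def by (rule tensor_op_diff_left[OF clin_ops_intros(1) Pc rank_one_clin_ops])
  then have "\<phi> (?t P') = \<phi> (?t id_blinfun) - \<phi> (?t P)"
    by (simp add: phi_diff rank_A1 id1 P)
  then have "\<phi> (?t id_blinfun) = \<phi> (?t P) + \<phi> (?t P')"
    by simp
  moreover have "proj_cspan (corner P) (\<phi> (?t P) \<eta>) = \<phi> (?t P) \<eta>"
    by (intro proj_cspan_fix cspan_closureI cornerI)
  moreover have "proj_cspan (corner P) (\<phi> (?t P') \<eta>) = 0"
  proof (rule proj_cspan_orthogonal)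
    fix g assume "g \<in> corner P"
    then show "cinner g (\<phi> (?t P') \<eta>) = 0"
      by (rule cornerE) (simp only: phi_rank_orthogonal[OF P P' PP'])
  qed
  ultimately show "(amp F o\<^sub>L \<phi> (?t id_blinfun)) \<eta> = \<phi> (?t P) \<eta>"
    unfolding F by (simp add: blinfun.add_left blinfun.add_right)
qed

text \<open>The identity on the right is tested on the total set of vectors in the corner of
  \<open>1\<close>. For the one on the left, the error \<open>d\<close> is annihilated by every
  \<open>\<phi> (1 \<otimes> rank_one u u)\<close>, hence orthogonal to that same set.\<close>

lemma amp_image:
  assumes P: "P \<in> s1.\<P>"
  shows "\<exists>F\<in>s2.\<P>. \<forall>a\<in>s1.A. \<phi> (amp P o\<^sub>L a) = amp F o\<^sub>L \<phi> a \<and> \<phi> (a o\<^sub>L amp P) = \<phi> a o\<^sub>L amp F"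
proof -
  obtain F where F: "F \<in> s2.\<P>" "proj_cspan (corner P) = amp F"
    using corner_proj[OF P] by (elim bexE) (rule that)
  have Pc: "P \<in> clin_ops" and Fc: "F \<in> clin_ops"
    by (rule s1.commuting_clin_ops[OF P], rule s2.commuting_clin_ops[OF F(1)])
  have phic: "\<phi> a \<in> clin_ops" if "a \<in> s1.A" for a
    using phi_mem[OF that] s2.A_clin_ops by blast
  have ampF: "amp F \<in> clin_ops"
    by (rule tensor_op_clin_ops[OF Fc clin_ops_intros(1)])
  have right: "\<phi> (a o\<^sub>L amp P) = \<phi> a o\<^sub>L amp F" if a: "a \<in> s1.A" for a
  proof (rule corner_eqI[OF phic[OF A1_amp[OF P a]] clin_ops_intros(7)[OF phic[OF a] ampF]])
    fix w
    let ?t = "\<lambda>R. tensor_op R (rank_one w e)"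
    have "\<phi> (a o\<^sub>L amp P) o\<^sub>L \<phi> (?t id_blinfun) = \<phi> ((a o\<^sub>L amp P) o\<^sub>L ?t id_blinfun)"
      by (rule mult[OF A1_amp[OF P a] rank_A1[OF id1], symmetric])
    also have "(a o\<^sub>L amp P) o\<^sub>L ?t id_blinfun = a o\<^sub>L ?t P"
      by (simp add: blinfun_compose_assoc amp_rank Pc clin_ops_intros compose_id)
    also have "\<phi> (a o\<^sub>L ?t P) = \<phi> a o\<^sub>L \<phi> (?t P)"
      by (rule mult[OF a rank_A1[OF P]])
    also have "\<dots> = (\<phi> a o\<^sub>L amp F) o\<^sub>L \<phi> (?t id_blinfun)"
      by (simp add: blinfun_compose_assoc amp_corner[OF P F(2)])
    finally show "\<phi> (a o\<^sub>L amp P) o\<^sub>L \<phi> (?t id_blinfun) = (\<phi> a o\<^sub>L amp F) o\<^sub>L \<phi> (?t id_blinfun)" .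
  qed
  have left: "\<phi> (amp P o\<^sub>L a) = amp F o\<^sub>L \<phi> a" if a: "a \<in> s1.A" for a
  proof (rule blinfun_eqI)
    fix \<zeta>
    define d where "d = \<phi> (amp P o\<^sub>L a) \<zeta> - amp F (\<phi> a \<zeta>)"
    \<comment> \<open>Associativity moves \<open>P \<otimes> 1\<close> from \<open>a\<close> to the
      factor in front of it, where the identity \<open>right\<close> applies.\<close>
    have kill: "\<phi> (tensor_op id_blinfun (rank_one u u)) d = 0" for u
    proof -
      let ?p = "tensor_op id_blinfun (rank_one u u)"
      have "\<phi> ?p o\<^sub>L \<phi> (amp P o\<^sub>L a) = \<phi> (?p o\<^sub>L amp P) o\<^sub>L \<phi> a"
        unfolding mult[OF rank_A1[OF id1] amp_A1[OF P a], symmetric]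
          mult[OF A1_amp[OF P rank_A1[OF id1]] a, symmetric]
        by (simp add: blinfun_compose_assoc)
      also have "\<dots> = \<phi> ?p o\<^sub>L (amp F o\<^sub>L \<phi> a)"
        by (simp add: right[OF rank_A1[OF id1]] blinfun_compose_assoc)
      finally have "(\<phi> ?p o\<^sub>L \<phi> (amp P o\<^sub>L a)) \<zeta> = (\<phi> ?p o\<^sub>L (amp F o\<^sub>L \<phi> a)) \<zeta>"
        by simp
      then show ?thesis
        by (simp add: d_def blinfun.diff_right)
    qed
    have "cinner (\<phi> (tensor_op id_blinfun (rank_one w e)) \<eta>) d = 0" for w \<eta>
    proof (cases "w = 0")
      case True
      have "tensor_op id_blinfun (rank_one 0 e) = (0 :: ('h1, 'k) hilbert_tensor \<Rightarrow>\<^sub>L _)"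
        by (rule clin_ops_tensor_eqI)
           (auto simp: tensor_op_clin_ops rank_one_clin_ops tensor_op_apply clin_ops_intros)
      then show ?thesis
        by (simp add: True phi_zero)
    next
      case False
      then obtain u where u: "norm u = 1" "rank_one u u o\<^sub>L rank_one w e = rank_one w e"
        using rank_one_split by blast
      let ?p = "tensor_op (id_blinfun :: 'h1 \<Rightarrow>\<^sub>L 'h1) (rank_one u u)"
        and ?q = "tensor_op (id_blinfun :: 'h1 \<Rightarrow>\<^sub>L 'h1) (rank_one w e)"
      have "is_projection (\<phi> ?p)"
        by (intro phi_projection rank_A1 id1 is_projection_tensor_op is_projection_id is_projection_rank_one u(1))
      moreover have "?q = ?p o\<^sub>L ?q"
        by (simp add: tensor_op_compose rank_one_clin_ops clin_ops_intros compose_id u)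
      then have "\<phi> ?q = \<phi> ?p o\<^sub>L \<phi> ?q"
        using mult[OF rank_A1[OF id1] rank_A1[OF id1]] by metis
      then have "\<phi> ?q \<eta> = \<phi> ?p (\<phi> ?q \<eta>)"
        by (metis blinfun_apply_blinfun_compose)
      ultimately have "cinner (\<phi> ?q \<eta>) d = cinner (\<phi> ?q \<eta>) (\<phi> ?p d)"
        by (metis proj_cinner)
      then show ?thesis
        by (simp add: kill)
    qed
    then have "d = 0"
      by (rule corner_total)
    then show "\<phi> (amp P o\<^sub>L a) \<zeta> = (amp F o\<^sub>L \<phi> a) \<zeta>"
      by (simp add: d_def)
  qed
  show ?thesis
    using F(1) left right by blast
qed

text \<open>The situation is symmetric; \<open>amp_image\<close> for the inverse isomorphism is what
  yields surjectivity of \<open>\<theta>\<close>.\<close>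

lemma stable_iso_inverse: "stable_iso L2 L1 B2 B1 (inv_into s1.A \<phi>) e"
proof -
  let ?\<psi> = "inv_into s1.A \<phi>"
  have inj: "inj_on \<phi> s1.A"
    by (rule inj_onI) (rule phi_inj)
  have mem: "?\<psi> b \<in> s1.A" and right: "\<phi> (?\<psi> b) = b" if "b \<in> s2.A" for b
    using that onto by (auto intro: inv_into_into f_inv_into_f)
  have eqI: "?\<psi> b = a" if "a \<in> s1.A" "\<phi> a = b" for a b
    using inv_into_f_f[OF inj that(1)] that(2) by simp
  show ?thesis
  proof
    show "?\<psi> ` s2.A = s1.A"
      using onto inj by (simp only: onto[symmetric]) simp
    show "?\<psi> (S + T) = ?\<psi> S + ?\<psi> T" if "S \<in> s2.A" "T \<in> s2.A" for S T
      using that by (intro eqI csubspaceD(2)[OF s1.csubspace_A] mem) (simp_all add: add mem right)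
    show "?\<psi> (c *\<^sub>C S) = c *\<^sub>C ?\<psi> S" if "S \<in> s2.A" for c S
      using that by (intro eqI csubspaceD(3)[OF s1.csubspace_A] mem) (simp_all add: scale mem right)
    show "?\<psi> (S o\<^sub>L T) = ?\<psi> S o\<^sub>L ?\<psi> T" if "S \<in> s2.A" "T \<in> s2.A" for S T
      using that by (intro eqI s1.A_compose mem) (simp_all add: mult mem right)
    show "norm (?\<psi> S) = norm S" if "S \<in> s2.A" for S
      using isom[OF mem[OF that]] by (simp add: right that)
    show "norm e = 1"
      by (rule e)
  qed
qed

section \<open>From \<open>\<phi>\<close> to a Boolean isomorphism\<close>

lemma amp_unique:
  assumes F: "F \<in> s2.\<P>" "F' \<in> s2.\<P>"
    and eq: "\<And>a. a \<in> s1.A \<Longrightarrow> amp F o\<^sub>L \<phi> a = amp F' o\<^sub>L \<phi> a"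
  shows "F = F'"
proof (rule s2.tensor_left_cancel[OF s2.commuting_clin_ops[OF F(1)] s2.commuting_clin_ops[OF F(2)] e])
  fix b assume "b \<in> s2.A"
  then obtain a where "a \<in> s1.A" "\<phi> a = b"
    using phi_onto by (metis (no_types))
  then show "amp F o\<^sub>L b = amp F' o\<^sub>L b"
    using eq by blast
qed

lemma amp_compose:
  fixes P Q :: "'h::chilbert_space \<Rightarrow>\<^sub>L 'h"
  assumes "P \<in> clin_ops" "Q \<in> clin_ops"
  shows "amp (P o\<^sub>L Q) = amp P o\<^sub>L amp Q"
  by (simp add: tensor_op_compose assms clin_ops_intros compose_id)

lemma amp_compl:
  fixes P :: "'h::chilbert_space \<Rightarrow>\<^sub>L 'h"
  assumes "P \<in> clin_ops"
  shows "amp (id_blinfun - P) o\<^sub>L a = a - (amp P o\<^sub>L a)"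
  by (rule blinfun_eqI)
     (simp add: tensor_op_diff_left assms clin_ops_intros tensor_op_id blinfun.diff_left)

lemma boolean_iso_exists:
  "\<exists>\<theta>. boolean_iso s1.\<P> s2.\<P> \<theta> \<and>
    (\<forall>P\<in>s1.\<P>. \<forall>a\<in>s1.A. \<phi> (amp P o\<^sub>L a) = amp (\<theta> P) o\<^sub>L \<phi> a \<and> \<phi> (a o\<^sub>L amp P) = \<phi> a o\<^sub>L amp (\<theta> P))"
proof -
  have "\<exists>\<theta>. \<forall>P\<in>s1.\<P>. \<theta> P \<in> s2.\<P> \<and> (\<forall>a\<in>s1.A. \<phi> (amp P o\<^sub>L a) = amp (\<theta> P) o\<^sub>L \<phi> a \<and>
      \<phi> (a o\<^sub>L amp P) = \<phi> a o\<^sub>L amp (\<theta> P))"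
    using amp_image by (intro bchoice) blast
  then obtain \<theta> where \<theta>: "\<And>P. P \<in> s1.\<P> \<Longrightarrow> \<theta> P \<in> s2.\<P>"
    and left: "\<And>P a. P \<in> s1.\<P> \<Longrightarrow> a \<in> s1.A \<Longrightarrow> \<phi> (amp P o\<^sub>L a) = amp (\<theta> P) o\<^sub>L \<phi> a"
    and right: "\<And>P a. P \<in> s1.\<P> \<Longrightarrow> a \<in> s1.A \<Longrightarrow> \<phi> (a o\<^sub>L amp P) = \<phi> a o\<^sub>L amp (\<theta> P)"
    by auto
  note c1 = s1.commuting_clin_ops and c2 = s2.commuting_clin_ops
  interpret inv: stable_iso L2 L1 B2 B1 "inv_into s1.A \<phi>" e
    by (rule stable_iso_inverse)
  have "boolean_iso s1.\<P> s2.\<P> \<theta>"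
  proof
    show "maximal_boolean s1.\<P>" "maximal_boolean s2.\<P>"
      by (rule s1.maximal_boolean_commuting, rule s2.maximal_boolean_commuting)
    show "\<theta> (P o\<^sub>L Q) = \<theta> P o\<^sub>L \<theta> Q" if P: "P \<in> s1.\<P>" and Q: "Q \<in> s1.\<P>" for P Q
    proof (rule amp_unique)
      have PQ: "P o\<^sub>L Q \<in> s1.\<P>"
        by (rule boolean_compose[OF s1.maximal_boolean_commuting P Q])
      then show "\<theta> (P o\<^sub>L Q) \<in> s2.\<P>"
        by (rule \<theta>)
      show "\<theta> P o\<^sub>L \<theta> Q \<in> s2.\<P>"
        by (rule boolean_compose[OF s2.maximal_boolean_commuting \<theta>[OF P] \<theta>[OF Q]])
      fix a assume a: "a \<in> s1.A"
      have "amp (\<theta> (P o\<^sub>L Q)) o\<^sub>L \<phi> a = \<phi> (amp P o\<^sub>L (amp Q o\<^sub>L a))"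
        by (simp add: left[OF PQ a, symmetric] amp_compose c1 P Q blinfun_compose_assoc)
      also have "\<dots> = amp (\<theta> P o\<^sub>L \<theta> Q) o\<^sub>L \<phi> a"
        by (simp add: left[OF P amp_A1[OF Q a]] left[OF Q a] amp_compose c2 \<theta> P Q blinfun_compose_assoc)
      finally show "amp (\<theta> (P o\<^sub>L Q)) o\<^sub>L \<phi> a = amp (\<theta> P o\<^sub>L \<theta> Q) o\<^sub>L \<phi> a" .
    qed
    show "\<theta> (id_blinfun - P) = id_blinfun - \<theta> P" if P: "P \<in> s1.\<P>" for P
    proof (rule amp_unique)
      have P': "id_blinfun - P \<in> s1.\<P>"
        by (rule boolean_compl[OF s1.maximal_boolean_commuting P])
      then show "\<theta> (id_blinfun - P) \<in> s2.\<P>"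
        by (rule \<theta>)
      show "id_blinfun - \<theta> P \<in> s2.\<P>"
        by (rule boolean_compl[OF s2.maximal_boolean_commuting \<theta>[OF P]])
      fix a assume a: "a \<in> s1.A"
      show "amp (\<theta> (id_blinfun - P)) o\<^sub>L \<phi> a = amp (id_blinfun - \<theta> P) o\<^sub>L \<phi> a"
        unfolding left[OF P' a, symmetric] amp_compl[OF c1[OF P]] amp_compl[OF c2[OF \<theta>[OF P]]]
        by (simp add: phi_diff[OF a amp_A1[OF P a]] left[OF P a])
    qed
    have "P = Q" if P: "P \<in> s1.\<P>" and Q: "Q \<in> s1.\<P>" and eq: "\<theta> P = \<theta> Q" for P Q
    proof (rule s1.tensor_left_cancel[OF c1[OF P] c1[OF Q] e])
      fix a assume a: "a \<in> s1.A"
      show "amp P o\<^sub>L a = amp Q o\<^sub>L a"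
        by (rule phi_inj[OF amp_A1[OF P a] amp_A1[OF Q a]]) (simp only: left[OF P a] left[OF Q a] eq)
    qed
    then have "inj_on \<theta> s1.\<P>"
      by (rule inj_onI)
    moreover have "\<exists>P\<in>s1.\<P>. \<theta> P = Q" if Q: "Q \<in> s2.\<P>" for Q
    proof -
      obtain P where P: "P \<in> s1.\<P>"
        and PQ: "\<And>b. b \<in> s2.A \<Longrightarrow> inv_into s1.A \<phi> (amp Q o\<^sub>L b) = amp P o\<^sub>L inv_into s1.A \<phi> b"
        using inv.amp_image[OF Q] by blast
      have "\<theta> P = Q"
      proof (rule amp_unique[OF \<theta>[OF P] Q])
        fix a assume a: "a \<in> s1.A"
        have inj: "inj_on \<phi> s1.A"
          by (rule inj_onI) (rule phi_inj)
        have "amp (\<theta> P) o\<^sub>L \<phi> a = \<phi> (amp P o\<^sub>L inv_into s1.A \<phi> (\<phi> a))"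
          by (simp add: left[OF P a] inv_into_f_f[OF inj a])
        also have "\<dots> = \<phi> (inv_into s1.A \<phi> (amp Q o\<^sub>L \<phi> a))"
          by (simp add: PQ phi_mem a)
        also have "\<dots> = amp Q o\<^sub>L \<phi> a"
          using inv.amp_A1[OF Q phi_mem[OF a]] onto by (intro f_inv_into_f) blast
        finally show "amp (\<theta> P) o\<^sub>L \<phi> a = amp Q o\<^sub>L \<phi> a" .
      qed
      with P show ?thesis by blast
    qed
    ultimately show "bij_betw \<theta> s1.\<P> s2.\<P>"
      using \<theta> by (auto simp: bij_betw_def image_iff)
  qed
  then show ?thesis
    using left right by blast
qed

text \<open>Descends from \<open>A\<close> back to \<open>Alg L\<close>, opposite to
  \<open>A_corner_zero\<close>: the unit vector \<open>e\<close> recovers the first factor.\<close>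

lemma tensor_corner_zero:
  fixes R S P :: "'h::chilbert_space \<Rightarrow>\<^sub>L 'h"
  assumes clin: "R \<in> clin_ops" "S \<in> clin_ops" "P \<in> clin_ops"
    and zero: "amp R o\<^sub>L (tensor_op S (rank_one e e) o\<^sub>L amp P) = 0"
  shows "R o\<^sub>L (S o\<^sub>L P) = 0"
proof (rule blinfun_eqI, rule tensor_cancel[OF _ e])
  fix x
  have "(amp R o\<^sub>L (tensor_op S (rank_one e e) o\<^sub>L amp P)) (x \<otimes>\<^sub>h e) = 0"
    by (simp add: zero)
  then show "(R o\<^sub>L (S o\<^sub>L P)) x \<otimes>\<^sub>h e = blinfun_apply 0 x \<otimes>\<^sub>h e"
    by (simp add: tensor_op_apply clin clin_ops_intros rank_one_clin_ops cinner_self_norm e)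
qed

text \<open>Each inclusion starts from a projection of the target lattice: the corresponding corner
  of its algebra vanishes, \<open>\<phi>\<close> or its inverse carries this to the partner
  projection under \<open>\<theta>\<close>, and \<open>V\<close> carries the resulting corner
  condition back. The partner is a member of the other masa and is not claimed to lie in the other
  lattice.\<close>

lemma Alg_unitarily_equivalent:
  "\<exists>V :: 'h2 \<Rightarrow>\<^sub>L 'h1. unitary V \<and> Alg L2 = {adj V o\<^sub>L T o\<^sub>L V | T. T \<in> Alg L1}"
proof -
  obtain \<theta> where iso: "boolean_iso s1.\<P> s2.\<P> \<theta>"
    and left: "\<And>P a. P \<in> s1.\<P> \<Longrightarrow> a \<in> s1.A \<Longrightarrow> \<phi> (amp P o\<^sub>L a) = amp (\<theta> P) o\<^sub>L \<phi> a"
    and right: "\<And>P a. P \<in> s1.\<P> \<Longrightarrow> a \<in> s1.A \<Longrightarrow> \<phi> (a o\<^sub>L amp P) = \<phi> a o\<^sub>L amp (\<theta> P)"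
    using boolean_iso_exists by auto
  interpret b: boolean_iso s1.\<P> s2.\<P> \<theta>
    by (rule iso)
  obtain V :: "'h2 \<Rightarrow>\<^sub>L 'h1" where V: "unitary V"
    and inter: "\<And>P v. P \<in> s1.\<P> \<Longrightarrow> V (\<theta> P v) = P (V v)"
    using b.spatial by auto
  have Vc: "V \<in> clin_ops" and Vc': "adj V \<in> clin_ops"
    using V adj_clin_ops by (auto simp: unitary_def)
  have V'V: "adj V (V x) = x" and VV': "V (adj V y) = y" for x y
    using V unfolding unitary_def by (metis blinfun_apply_blinfun_compose id_blinfun.rep_eq id_apply)+
  have inter': "adj V (P y) = \<theta> P (adj V y)" if "P \<in> s1.\<P>" for P y
    using inter[OF that, of "adj V y"] by (metis V'V VV')
  have corner: "\<phi> (amp (id_blinfun - P) o\<^sub>L (a o\<^sub>L amp P)) = amp (id_blinfun - \<theta> P) o\<^sub>L (\<phi> a o\<^sub>L amp (\<theta> P))"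
    if P: "P \<in> s1.\<P>" and a: "a \<in> s1.A" for P a
    using left[OF boolean_compl[OF s1.maximal_boolean_commuting P] A1_amp[OF P a]]
    by (simp add: right[OF P a] b.compl[OF P])
  have compl1: "id_blinfun - P \<in> clin_ops" if "P \<in> clin_ops" for P :: "'h1 \<Rightarrow>\<^sub>L 'h1"
    using that by (intro clin_ops_intros)
  have compl2: "id_blinfun - P \<in> clin_ops" if "P \<in> clin_ops" for P :: "'h2 \<Rightarrow>\<^sub>L 'h2"
    using that by (intro clin_ops_intros)
  have sub1: "V o\<^sub>L (T o\<^sub>L adj V) \<in> Alg L1" if T: "T \<in> Alg L2" for T
    unfolding in_Alg_iff
  proof (intro conjI ballI blinfun_eqI)
    have Tc: "T \<in> clin_ops"
      using T s2.Alg_clin_ops by blast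
    then show "V o\<^sub>L (T o\<^sub>L adj V) \<in> clin_ops"
      by (intro clin_ops_intros Vc Vc')
    fix P y assume PL: "P \<in> L1"
    then have P: "P \<in> s1.\<P>"
      using s1.L_commuting by blast
    obtain a where a: "a \<in> s1.A" "\<phi> a = tensor_op T (rank_one e e)"
      using phi_onto[OF s2.tensor_op_A[OF T s2.rank_one_B, of e e]] by (elim bexE) (rule that)
    have "amp (id_blinfun - P) o\<^sub>L (a o\<^sub>L amp P) = 0"
      by (rule s1.A_corner_zero[OF s1.commuting_clin_ops[OF P] compl1[OF s1.commuting_clin_ops[OF P]] _ a(1)])
         (use PL in \<open>simp add: in_Alg_iff\<close>)
    then have "amp (id_blinfun - \<theta> P) o\<^sub>L (tensor_op T (rank_one e e) o\<^sub>L amp (\<theta> P)) = 0"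
      using corner[OF P a(1)] by (simp add: phi_zero a(2))
    then have "(id_blinfun - \<theta> P) o\<^sub>L (T o\<^sub>L \<theta> P) = 0"
      using s2.commuting_clin_ops[OF b.theta_mem[OF P]] by (intro tensor_corner_zero[OF compl2 Tc])
    then have "((id_blinfun - \<theta> P) o\<^sub>L (T o\<^sub>L \<theta> P)) (adj V y) = 0"
      by simp
    then have "T (\<theta> P (adj V y)) = \<theta> P (T (\<theta> P (adj V y)))"
      by (simp add: blinfun.diff_left)
    then have "V (T (adj V (P y))) = P (V (T (adj V (P y))))"
      by (metis inter[OF P] inter'[OF P])
    then show "((id_blinfun - P) o\<^sub>L ((V o\<^sub>L (T o\<^sub>L adj V)) o\<^sub>L P)) y = blinfun_apply 0 y"
      by (simp add: blinfun.diff_left)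
  qed
  have sub2: "adj V o\<^sub>L T o\<^sub>L V \<in> Alg L2" if T: "T \<in> Alg L1" for T
    unfolding in_Alg_iff
  proof (intro conjI ballI blinfun_eqI)
    have Tc: "T \<in> clin_ops"
      using T s1.Alg_clin_ops by blast
    then show "adj V o\<^sub>L T o\<^sub>L V \<in> clin_ops"
      by (intro clin_ops_intros Vc Vc')
    fix Q x assume QL: "Q \<in> L2"
    then have Q: "Q \<in> s2.\<P>"
      using s2.L_commuting by blast
    obtain P where P: "P \<in> s1.\<P>" and PQ: "\<theta> P = Q"
      using b.theta_surj[OF Q] by (elim bexE) (rule that)
    let ?a = "tensor_op T (rank_one e e)"
    have a: "?a \<in> s1.A"
      by (rule s1.tensor_op_A[OF T s1.rank_one_B])
    have "amp (id_blinfun - Q) o\<^sub>L (\<phi> ?a o\<^sub>L amp Q) = 0"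
      by (rule s2.A_corner_zero[OF s2.commuting_clin_ops[OF Q] compl2[OF s2.commuting_clin_ops[OF Q]] _ phi_mem[OF a]])
         (use QL in \<open>simp add: in_Alg_iff\<close>)
    then have "\<phi> (amp (id_blinfun - P) o\<^sub>L (?a o\<^sub>L amp P)) = \<phi> 0"
      using corner[OF P a] by (simp add: phi_zero PQ)
    then have "amp (id_blinfun - P) o\<^sub>L (?a o\<^sub>L amp P) = 0"
      by (rule phi_inj[OF amp_A1[OF boolean_compl[OF s1.maximal_boolean_commuting P] A1_amp[OF P a]]
            csubspaceD(1)[OF s1.csubspace_A]])
    then have "(id_blinfun - P) o\<^sub>L (T o\<^sub>L P) = 0"
      using s1.commuting_clin_ops[OF P] by (intro tensor_corner_zero[OF compl1 Tc])
    then have "((id_blinfun - P) o\<^sub>L (T o\<^sub>L P)) (V x) = 0"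
      by simp
    then have "T (P (V x)) = P (T (P (V x)))"
      by (simp add: blinfun.diff_left)
    then have "adj V (T (V (Q x))) = Q (adj V (T (V (Q x))))"
      unfolding PQ[symmetric] by (metis inter[OF P] inter'[OF P])
    then show "((id_blinfun - Q) o\<^sub>L ((adj V o\<^sub>L T o\<^sub>L V) o\<^sub>L Q)) x = blinfun_apply 0 x"
      by (simp add: blinfun.diff_left)
  qed
  have "T = adj V o\<^sub>L (V o\<^sub>L (T o\<^sub>L adj V)) o\<^sub>L V" for T :: "'h2 \<Rightarrow>\<^sub>L 'h2"
    by (rule blinfun_eqI) (simp add: V'V)
  then have "Alg L2 = {adj V o\<^sub>L T o\<^sub>L V | T. T \<in> Alg L1}"
    using sub1 sub2 by blast
  with V show ?thesis
    by blast
qed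

end

theorem theorem2p9:
  fixes L1 :: "('h1::chilbert_space \<Rightarrow>\<^sub>L 'h1) set"
    and L2 :: "('h2::chilbert_space \<Rightarrow>\<^sub>L 'h2) set"
    and B1 B2 :: "('k::chilbert_space \<Rightarrow>\<^sub>L 'k) set"
  assumes "\<exists>x::'k. x \<noteq> 0"
    and "separable_space (euclidean :: 'k topology)"
    and "csl L1" and "multiplicity_free L1"
    and "csl L2" and "multiplicity_free L2"
    and "operator_algebra B1" and "compact_ops \<subseteq> B1"
    and "operator_algebra B2" and "compact_ops \<subseteq> B2"
    and "isometrically_isomorphic (spatial_tensor (Alg L1) B1) (spatial_tensor (Alg L2) B2)"
  shows "\<exists>V :: 'h2 \<Rightarrow>\<^sub>L 'h1. unitary V \<and> Alg L2 = {adj V o\<^sub>L T o\<^sub>L V | T. T \<in> Alg L1}"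
proof -
  obtain x :: 'k where "x \<noteq> 0"
    using assms(1) by blast
  then have e: "norm ((1 / norm x) *\<^sub>R x) = 1"
    by simp
  interpret s1: stable_algebra L1 B1
    by unfold_locales (rule assms)+
  interpret s2: stable_algebra L2 B2
    by unfold_locales (rule assms)+
  from assms(11) obtain \<phi> where phi: "\<phi> ` s1.A = s2.A"
    "\<forall>S\<in>s1.A. \<forall>T\<in>s1.A. \<phi> (S + T) = \<phi> S + \<phi> T"
    "\<forall>c. \<forall>S\<in>s1.A. \<phi> (c *\<^sub>C S) = c *\<^sub>C \<phi> S"
    "\<forall>S\<in>s1.A. \<forall>T\<in>s1.A. \<phi> (S o\<^sub>L T) = \<phi> S o\<^sub>L \<phi> T"
    "\<forall>S\<in>s1.A. norm (\<phi> S) = norm S"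
    unfolding isometrically_isomorphic_def s1.A_def[symmetric] s2.A_def[symmetric] by (elim exE conjE) (rule that)
  interpret stable_iso L1 L2 B1 B2 \<phi> "(1 / norm x) *\<^sub>R x"
    by unfold_locales (use phi e in simp_all)
  show ?thesis
    by (rule Alg_unitarily_equivalent)
qed

end
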